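(* Let $\delta>0$, $\beta>0$, $\alpha>0$, let $V(u)=\tfrac12\alpha u^2$, and fix either Dirichlet or Neumann boundary conditions. For each $N\ge 1$ let $H_N$ be the discrete Hamiltonian on $\mathbb{R}^{2N}$ with these boundary conditions, let $m_N$ be the microcanonical probability measure of $H_N$ on the energy shell $H_N=E_N$ with $E_N=N/\beta$, and let $M_N$ be the canonical probability measure of $H_N$ at inverse temperature $\beta$ (all defined in the context). Let $s,t:[0,1]\to\mathbb{R}$ be smooth functions and set $\boldsymbol{s}=(s(x_1),\dots,s(x_N))$, $\boldsymbol{t}=(t(x_1),\dots,t(x_N))$ with $x_j=j/(N+1)$. Define $$\phi_N^m(\boldsymbol s,\boldsymbol t)=\int_{\mathbb{R}^{2N}}\exp\Big(\tfrac{i}{N}\boldsymbol s\cdot\boldsymbol p+\tfrac{i}{N}\boldsymbol t\cdot\boldsymbol u\Big)\,dm_N(\boldsymbol p,\boldsymbol u),\qquad \phi_N^M(\boldsymbol s,\boldsymbol t)=\int_{\mathbb{R}^{2N}}\exp\Big(\tfrac{i}{N}\boldsymbol s\cdot\boldsymbol p+\tfrac{i}{N}\boldsymbol t\cdot\boldsymbol u\Big)\,dM_N(\boldsymbol p,\boldsymbol u).$$ Then $\phi_N^m$ and $\phi_N^M$ have the same limit as $N\to\infty$: $$\lim_{N\to\infty}\phi_N^m(\boldsymbol s,\boldsymbol t)=\lim_{N\to\infty}\phi_N^M(\boldsymbol s,\boldsymbol t)=\exp\left(-\frac{1}{2\beta}\left[\int_0^1 s^2(x)\,dx+\int_0^1\int_0^1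 t(x)\,C(x,y)\,t(y)\,dx\,dy\right]\right),$$ where $C(x,y)$ is the solution of $$\left(-\delta^2\frac{\partial^2}{\partial x^2}+\alpha\right)C(x,y)=\delta(x-y)$$ on $[0,1]$ with the chosen (Dirichlet or Neumann) boundary conditions in $x$, where $\delta(x-y)$ on the right-hand side is the Dirac distribution.
   Context: For $\boldsymbol p=(p_1,\dots,p_N)$, $\boldsymbol u=(u_1,\dots,u_N)\in\mathbb{R}^N$ the discrete Hamiltonian is $$H_N(\boldsymbol p,\boldsymbol u)=\frac1N\sum_{j=1}^N\Big(\tfrac12p_j^2+V(u_j)\Big)+N\sum_{j=0}^N\tfrac12\delta^2(u_{j+1}-u_j)^2,$$ where $u_0,u_{N+1}$ are fixed by the boundary conditions: $u_0=u_{N+1}=0$ for Dirichlet, and $u_0=u_1$, $u_{N+1}=u_N$ for Neumann. The corresponding continuum boundary conditions on $[0,1]$ are vanishing at $x=0,1$ (Dirichlet) and vanishing $x$-derivative at $x=0,1$ (Neumann). The microcanonical measure on the energy shell $H_N=E_N$ is the probability measure $$dm_N=c_N^{-1}\,\frac{d\sigma(\boldsymbol p,\boldsymbol u)}{|\nabla H_N(\boldsymbol p,\boldsymbol u)|},\qquad c_N=\int_{\{H_N=E_N\}}\frac{d\sigma}{|\nabla H_N|},$$ where $d\sigma$ is the surface element on $\{H_N=E_N\}\subset\mathbb{R}^{2N}$. The canonical measure at inverse temperature $\beta$ is the probability measure $$dM_N=C_N^{-1}e^{-\beta H_N(\boldsymbol p,\boldsymbol u)}\,d\boldsymbol p\,d\boldsymbol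 u,\qquad C_N=\int_{\mathbb{R}^{2N}}e^{-\beta H_N(\boldsymbol p,\boldsymbol u)}\,d\boldsymbol p\,d\boldsymbol u .$$ *)

theory Defs
  imports "HOL-Analysis.Analysis"
begin

text \<open>
  Since the dimension is a variable of the statement, the Euclidean space of dimension
  \<open>card I\<close> is represented by the extensional functions on a finite index set \<open>I\<close>, i.e. the space
  of \<open>PiM I (\<lambda>_. lborel)\<close>; this product measure is the Lebesgue measure on the Borel sets.
\<close>

definition partial_deriv :: "'i \<Rightarrow> (('i \<Rightarrow> real) \<Rightarrow> real) \<Rightarrow> ('i \<Rightarrow> real) \<Rightarrow> real" where
  "partial_deriv i f x = deriv (\<lambda>t. f (x(i := t))) (x i)"

definition gradient_norm :: "'i set \<Rightarrow> (('i \<Rightarrow> real) \<Rightarrow> real) \<Rightarrow> ('i \<Rightarrow> real) \<Rightarrow> real" where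
  "gradient_norm I f x = sqrt (\<Sum>i\<in>I. (partial_deriv i f x)\<^sup>2)"

definition C1_on :: "'i set \<Rightarrow> ('i \<Rightarrow> real) set \<Rightarrow> (('i \<Rightarrow> real) \<Rightarrow> real) \<Rightarrow> bool" where
  "C1_on I U f \<longleftrightarrow> continuous_on U f \<and>
     (\<forall>i\<in>I. (\<forall>x\<in>U. (\<lambda>t. f (x(i := t))) field_differentiable at (x i)) \<and>
             continuous_on U (partial_deriv i f))"

definition open_box :: "'i set \<Rightarrow> ('i \<Rightarrow> real) \<Rightarrow> ('i \<Rightarrow> real) \<Rightarrow> ('i \<Rightarrow> real) set" where
  "open_box J a b = (\<Pi>\<^sub>E i\<in>J. {a i<..<b i})"

text \<open>
  The surface element of a \<open>C\<^sup>1\<close> hypersurface \<open>S\<close>: the Borel measure carried by \<open>S\<close> which on each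
  piece of \<open>S\<close> that is the graph \<open>x\<^sub>k = g(x')\<close> of a \<open>C\<^sup>1\<close> function \<open>g\<close> over an open box of the
  remaining coordinates is \<open>sqrt (1 + |\<nabla>g|\<^sup>2) dx'\<close>. Such an \<open>S\<close> is covered by countably many
  such pieces, so this determines the measure uniquely.
\<close>

definition is_surface_measure :: "'i set \<Rightarrow> ('i \<Rightarrow> real) set \<Rightarrow> ('i \<Rightarrow> real) measure \<Rightarrow> bool" where
  "is_surface_measure I S \<sigma> \<longleftrightarrow>
     sets \<sigma> = sets (PiM I (\<lambda>_. borel)) \<and>
     (AE x in \<sigma>. x \<in> S) \<and>
     (\<forall>k\<in>I. \<forall>a b g.
        C1_on (I - {k}) (open_box (I - {k}) a b) g \<longrightarrow>
        (\<lambda>x. x(k := g x)) ` open_box (I - {k}) a b \<subseteq> S \<longrightarrow>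
        (\<forall>A\<in>sets \<sigma>. A \<subseteq> (\<lambda>x. x(k := g x)) ` open_box (I - {k}) a b \<longrightarrow>
           emeasure \<sigma> A =
             (\<integral>\<^sup>+x. ennreal (sqrt (1 + (gradient_norm (I - {k}) g x)\<^sup>2)) *
                     indicator {x \<in> open_box (I - {k}) a b. x(k := g x) \<in> A} x
                \<partial>PiM (I - {k}) (\<lambda>_. lborel))))"

definition surface_measure :: "'i set \<Rightarrow> ('i \<Rightarrow> real) set \<Rightarrow> ('i \<Rightarrow> real) measure" where
  "surface_measure I S = (THE \<sigma>. is_surface_measure I S \<sigma>)"

definition energy_shell :: "'i set \<Rightarrow> (('i \<Rightarrow> real) \<Rightarrow> real) \<Rightarrow> real \<Rightarrow> ('i \<Rightarrow> real) set" where
  "energy_shell I H E = {x \<in> extensional I. H x = E}"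

definition microcanonical_measure ::
    "'i set \<Rightarrow> (('i \<Rightarrow> real) \<Rightarrow> real) \<Rightarrow> real \<Rightarrow> ('i \<Rightarrow> real) measure" where
  "microcanonical_measure I H E =
     (let \<sigma> = surface_measure I (energy_shell I H E);
          c = (\<integral>\<^sup>+x. ennreal (1 / gradient_norm I H x) \<partial>\<sigma>)
      in density \<sigma> (\<lambda>x. ennreal (1 / gradient_norm I H x) / c))"

definition canonical_measure ::
    "'i set \<Rightarrow> (('i \<Rightarrow> real) \<Rightarrow> real) \<Rightarrow> real \<Rightarrow> ('i \<Rightarrow> real) measure" where
  "canonical_measure I H \<beta> =
     (let L = PiM I (\<lambda>_. lborel);
          C = (\<integral>\<^sup>+x. ennreal (exp (- \<beta> * H x)) \<partial>L)
      in density L (\<lambda>x. ennreal (exp (- \<beta> * H x)) / C))"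


datatype boundary = Dirichlet | Neumann

fun extend_bc :: "boundary \<Rightarrow> nat \<Rightarrow> (nat \<Rightarrow> real) \<Rightarrow> nat \<Rightarrow> real" where
  "extend_bc Dirichlet N u j = (if j = 0 \<or> j = N + 1 then 0 else u j)"
| "extend_bc Neumann N u j = (if j = 0 then u 1 else if j = N + 1 then u N else u j)"

definition hamiltonian ::
    "boundary \<Rightarrow> real \<Rightarrow> (real \<Rightarrow> real) \<Rightarrow> nat \<Rightarrow> (nat \<Rightarrow> real) \<Rightarrow> (nat \<Rightarrow> real) \<Rightarrow> real" where
  "hamiltonian bc \<delta> V N p u =
     1 / real N * (\<Sum>j=1..N. 1/2 * (p j)\<^sup>2 + V (u j)) +
     real N * (\<Sum>j=0..N. 1/2 * \<delta>\<^sup>2 * (extend_bc bc N u (j + 1) - extend_bc bc N u j)\<^sup>2)"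

text \<open>A point \<open>x\<close> of phase space has momenta \<open>p\<^sub>j = x (Inl j)\<close> and positions \<open>u\<^sub>j = x (Inr j)\<close>.\<close>

definition phase_index :: "nat \<Rightarrow> (nat + nat) set" where
  "phase_index N = {1..N} <+> {1..N}"

definition phase_hamiltonian ::
    "boundary \<Rightarrow> real \<Rightarrow> (real \<Rightarrow> real) \<Rightarrow> nat \<Rightarrow> (nat + nat \<Rightarrow> real) \<Rightarrow> real" where
  "phase_hamiltonian bc \<delta> V N x = hamiltonian bc \<delta> V N (\<lambda>j. x (Inl j)) (\<lambda>j. x (Inr j))"

definition char_fun ::
    "(nat + nat \<Rightarrow> real) measure \<Rightarrow> nat \<Rightarrow> (nat \<Rightarrow> real) \<Rightarrow> (nat \<Rightarrow> real) \<Rightarrow> complex" where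
  "char_fun \<mu> N s t =
     (\<integral>x. exp (\<i> / of_nat N * of_real (\<Sum>j=1..N. s j * x (Inl j)) +
               \<i> / of_nat N * of_real (\<Sum>j=1..N. t j * x (Inr j))) \<partial>\<mu>)"

definition grid :: "nat \<Rightarrow> nat \<Rightarrow> real" where
  "grid N j = real j / real (N + 1)"


text \<open>Derivatives of all orders, one-sided at boundary points of \<open>S\<close> when \<open>S\<close> is a closed interval.\<close>

definition smooth_on :: "real set \<Rightarrow> (real \<Rightarrow> real) \<Rightarrow> bool" where
  "smooth_on S f \<longleftrightarrow> (\<exists>D. (\<forall>x\<in>S. D 0 x = f x) \<and>
     (\<forall>n::nat. \<forall>x\<in>S. (D n has_real_derivative D (Suc n) x) (at x within S)))"

definition test_function :: "(real \<Rightarrow> real) \<Rightarrow> bool" where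
  "test_function \<phi> \<longleftrightarrow> smooth_on UNIV \<phi> \<and>
     (\<exists>a b. 0 < a \<and> b < 1 \<and> (\<forall>x. x \<notin> {a..b} \<longrightarrow> \<phi> x = 0))"

fun satisfies_bc :: "boundary \<Rightarrow> (real \<Rightarrow> real) \<Rightarrow> bool" where
  "satisfies_bc Dirichlet f \<longleftrightarrow> f 0 = 0 \<and> f 1 = 0"
| "satisfies_bc Neumann f \<longleftrightarrow>
     (f has_real_derivative 0) (at 0 within {0..1}) \<and>
     (f has_real_derivative 0) (at 1 within {0..1})"

text \<open>
  \<open>(- \<delta>\<^sup>2 \<partial>\<^sub>x\<^sup>2 + \<alpha>) C(x,y) = \<delta>(x - y)\<close> in the sense of distributions on \<open>(0,1)\<close>, for each source point
  \<open>y\<close> in the open interval. A distributional solution is only determined up to null sets in \<open>x\<close>;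
  asking for the continuous representative gives the boundary conditions their pointwise meaning.
\<close>

definition is_green_function ::
    "boundary \<Rightarrow> real \<Rightarrow> real \<Rightarrow> (real \<Rightarrow> real \<Rightarrow> real) \<Rightarrow> bool" where
  "is_green_function bc \<delta> \<alpha> C \<longleftrightarrow> (\<forall>y\<in>{0<..<1}.
     continuous_on {0..1} (\<lambda>x. C x y) \<and>
     satisfies_bc bc (\<lambda>x. C x y) \<and>
     (\<forall>\<phi>. test_function \<phi> \<longrightarrow>
        integral {0..1} (\<lambda>x. C x y * (- \<delta>\<^sup>2 * deriv (deriv \<phi>) x + \<alpha> * \<phi> x)) = \<phi> y))"

end

theory Submission
  imports Defs "HOL-Probability.Probability" "HOL-Complex_Analysis.Complex_Analysis"
    "HOL-Real_Asymp.Real_Asymp"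
begin

text \<open>
  The Hamiltonian is a positive definite quadratic form, hence homogeneous of degree two. In each
  half space on which a partial derivative has a fixed sign, parametrising by the energy and
  the other coordinates shows that the microcanonical measure is the law of \<open>x / r\<close> with
  \<open>r = sqrt (H x / E)\<close>, where \<open>x\<close> has the canonical law. Under the canonical law \<open>r\<close> tends to \<open>1\<close> in
  mean square, because the Laplace transform of the energy is known exactly from scaling. So
  both characteristic functions have the same limit.

  The canonical one is Gaussian. Translating the integral by \<open>v\<close> computes the Laplace transform of
  the linear functional dual to \<open>v\<close>, and analytic continuation its characteristic function. As \<open>v\<close>
  one takes the samples of \<open>s / \<beta>\<close> and \<open>w / \<beta>\<close>, where \<open>w\<close> solves the continuum boundary value problem
  \<open>- \<delta>\<^sup>2 w'' + \<alpha> w = t\<close>; its dual functional differs from the required one by the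
  consistency error of the difference scheme. Finally \<open>w\<close> is identified with the integral of \<open>C\<close>
  against \<open>t\<close> by testing the equation for \<open>C\<close> with \<open>w\<close> multiplied by a smooth cutoff.
\<close>

subsection \<open>Lebesgue measure on finite products\<close>

text \<open>The statement leaves two objects implicit: the surface measure is a definite
  description, so existence and uniqueness come before any integral over the shell; and the
  covariance is the inverse of an N-dependent matrix. That inverse is never formed. Every vector
  \<open>v\<close> gives a linear functional whose canonical law is known exactly, so taking
  \<open>v\<close> from the continuum solution reduces the problem to consistency of the difference
  scheme, with coercivity in the role of stability. The constants leave just enough room: the
  coercivity constant is of order 1/N and the energy of order N, which costs a factor N^2 in the
  mean square error, while N components with errors of order 1/N^2 contribute N^(-3); the total is
  of order 1/N. Neither comparison of characteristic functions takes a square root: a free \<eta> is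
  kept in the bounds and sent to 0 after N.\<close>

lemma sets_PiM_lborel [simp]: "sets (PiM I (\<lambda>_. lborel :: real measure)) = sets (PiM I (\<lambda>_. borel))"
  by (intro sets_PiM_cong) auto

lemma measurable_PiM_lborel [simp]:
  "measurable (PiM I (\<lambda>_. lborel :: real measure)) M = measurable (PiM I (\<lambda>_. borel)) M"
  by (intro measurable_cong_sets) auto

lemma space_PiM_real [simp]:
  "space (PiM I (\<lambda>_. lborel :: real measure)) = extensional I"
  "space (PiM I (\<lambda>_. borel :: real measure)) = extensional I"
  by (auto simp: space_PiM PiE_def)

interpretation lborel_PiM: product_sigma_finite "\<lambda>_. lborel :: real measure"
  by standard

lemma fun_upd_measurable_PiM:
  assumes "k \<in> I"
  shows "(\<lambda>p. (fst p)(k := snd p)) \<in> measurable (PiM (I - {k}) (\<lambda>_. borel :: real measure) \<Otimes>\<^sub>M borel) (PiM I (\<lambda>_. borel))"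
  using measurable_add_dim[of k "I - {k}" "\<lambda>_. borel :: real measure"] assms
  by (simp add: insert_absorb case_prod_beta)

lemma nn_integral_PiM_remove:
  fixes f :: "('i \<Rightarrow> real) \<Rightarrow> ennreal"
  assumes "finite I" "k \<in> I" "f \<in> borel_measurable (PiM I (\<lambda>_. borel))"
  shows "(\<integral>\<^sup>+x. f x \<partial>PiM I (\<lambda>_. lborel)) =
    (\<integral>\<^sup>+x. \<integral>\<^sup>+y. f (x(k := y)) \<partial>lborel \<partial>PiM (I - {k}) (\<lambda>_. lborel))"
  using lborel_PiM.product_nn_integral_insert[of "I - {k}" k f] assms
  by (simp add: insert_absorb)

text \<open>Used with \<open>t = 0\<close> for dilations and with \<open>c = 1\<close> for
  translations; a common factor \<open>c\<close> keeps the Jacobian a plain power. Fubini reduces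
  each inductive step to the affine substitution on the line.\<close>

lemma nn_integral_PiM_lborel_affine:
  fixes f :: "('i \<Rightarrow> real) \<Rightarrow> ennreal"
  assumes "finite I" "c > 0" "f \<in> borel_measurable (PiM I (\<lambda>_. borel))"
  shows "(\<integral>\<^sup>+x. f x \<partial>PiM I (\<lambda>_. lborel)) =
    ennreal (c ^ card I) * (\<integral>\<^sup>+x. f (\<lambda>i\<in>I. t i + c * x i) \<partial>PiM I (\<lambda>_. lborel))"
  using assms(1,3)
proof (induction I arbitrary: f rule: finite_induct)
  case empty
  then show ?case
    by (simp add: lborel_PiM.nn_integral_empty restrict_def)
next
  case (insert i I)
  have [measurable]: "f \<in> borel_measurable (PiM (insert i I) (\<lambda>_. borel))" by fact
  have upd[measurable]: "(\<lambda>p. (fst p)(i := snd p)) \<in> measurable (PiM I (\<lambda>_. borel :: real measure) \<Otimes>\<^sub>M borel) (PiM (insert i I) (\<lambda>_. borel))"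
    using fun_upd_measurable_PiM[of i "insert i I"] insert.hyps by simp
  have [measurable]: "(\<lambda>p. f ((fst p)(i := snd p))) \<in> borel_measurable (PiM I (\<lambda>_. borel) \<Otimes>\<^sub>M borel)"
    using measurable_compose[OF upd insert.prems] .
  have aff[measurable]: "(\<lambda>x. \<lambda>i\<in>J. t i + c * x i) \<in> measurable (PiM J (\<lambda>_. borel)) (PiM J (\<lambda>_. borel))" for J
    by measurable
  have m1: "(\<lambda>x. \<integral>\<^sup>+y. f (x(i := y)) \<partial>lborel) \<in> borel_measurable (PiM I (\<lambda>_. borel))"
    by (rule sigma_finite_measure.borel_measurable_nn_integral[OF sigma_finite_lborel])
       (simp add: case_prod_beta)
  have "(\<integral>\<^sup>+x. f x \<partial>PiM (insert i I) (\<lambda>_. lborel)) = (\<integral>\<^sup>+x. \<integral>\<^sup>+y. f (x(i := y)) \<partial>lborel \<partial>PiM I (\<lambda>_. lborel))"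
    using insert by (subst lborel_PiM.product_nn_integral_insert) auto
  also have "\<dots> = ennreal (c ^ card I) * (\<integral>\<^sup>+x. \<integral>\<^sup>+y. f ((\<lambda>i\<in>I. t i + c * x i)(i := y)) \<partial>lborel \<partial>PiM I (\<lambda>_. lborel))"
    by (rule insert.IH[OF m1])
  also have "(\<integral>\<^sup>+x. \<integral>\<^sup>+y. f ((\<lambda>i\<in>I. t i + c * x i)(i := y)) \<partial>lborel \<partial>PiM I (\<lambda>_. lborel))
     = (\<integral>\<^sup>+x. ennreal c * (\<integral>\<^sup>+y. f (\<lambda>j\<in>insert i I. t j + c * (x(i := y)) j) \<partial>lborel) \<partial>PiM I (\<lambda>_. lborel))"
  proof (rule nn_integral_cong)
    fix x :: "'i \<Rightarrow> real" assume "x \<in> space (PiM I (\<lambda>_. lborel))"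
    let ?z = "\<lambda>i\<in>I. t i + c * x i"
    have z: "?z \<in> extensional I" by simp
    have "(\<lambda>y. f (?z(i := y))) \<in> borel_measurable borel"
      using measurable_compose[OF measurable_Pair1' [of ?z "PiM I (\<lambda>_. borel)" borel] , of "\<lambda>p. f ((fst p)(i := snd p))" borel] z
      by simp
    then have "(\<integral>\<^sup>+y. f (?z(i := y)) \<partial>lborel) = ennreal c * (\<integral>\<^sup>+y. f (?z(i := t i + c * y)) \<partial>lborel)"
      using assms(2) by (subst nn_integral_real_affine[where c=c and t="t i"]) auto
    also have "(\<lambda>y. ?z(i := t i + c * y)) = (\<lambda>y. \<lambda>j\<in>insert i I. t j + c * (x(i := y)) j)"
      using insert.hyps by (auto simp: fun_eq_iff)
    finally show "(\<integral>\<^sup>+y. f (?z(i := y)) \<partial>lborel) = ennreal c * (\<integral>\<^sup>+y. f (\<lambda>j\<in>insert i I. t j + c * (x(i := y)) j) \<partial>lborel)"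
      by (metis (no_types, lifting))
  qed
  also have "\<dots> = ennreal c * (\<integral>\<^sup>+x. \<integral>\<^sup>+y. f (\<lambda>j\<in>insert i I. t j + c * (x(i := y)) j) \<partial>lborel \<partial>PiM I (\<lambda>_. lborel))"
  proof (rule nn_integral_cmult)
    have "(\<lambda>p. f (\<lambda>j\<in>insert i I. t j + c * ((fst p)(i := snd p)) j)) \<in> borel_measurable (PiM I (\<lambda>_. borel) \<Otimes>\<^sub>M borel)"
      using measurable_compose[OF upd measurable_compose[OF aff insert.prems]] .
    then show "(\<lambda>x. \<integral>\<^sup>+y. f (\<lambda>j\<in>insert i I. t j + c * (x(i := y)) j) \<partial>lborel) \<in> borel_measurable (PiM I (\<lambda>_. lborel))"
      unfolding measurable_PiM_lborel
      by (intro sigma_finite_measure.borel_measurable_nn_integral[OF sigma_finite_lborel])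
         (simp add: case_prod_beta)
  qed
  also have "(\<integral>\<^sup>+x. \<integral>\<^sup>+y. f (\<lambda>j\<in>insert i I. t j + c * (x(i := y)) j) \<partial>lborel \<partial>PiM I (\<lambda>_. lborel)) =
     (\<integral>\<^sup>+x. f (\<lambda>j\<in>insert i I. t j + c * x j) \<partial>PiM (insert i I) (\<lambda>_. lborel))"
    using insert measurable_compose[OF aff insert.prems] by (subst lborel_PiM.product_nn_integral_insert) auto
  also have "ennreal (c ^ card I) * (ennreal c * X) = ennreal (c ^ card (insert i I)) * X" for X
    using insert.hyps assms(2) by (simp add: ennreal_mult mult_ac)
  finally show ?case .
qed

text \<open>The substitution is \<open>e = a * y^2\<close>, with
  \<open>dy = de / (2 * sqrt (a * e))\<close>. The rule applied works on compact intervals, so both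
  sides are exhausted by \<open>{0..n}\<close> and \<open>{0..a * n^2}\<close> and compared by
  monotone convergence.\<close>

lemma nn_integral_substitution_square:
  fixes f :: "real \<Rightarrow> real"
  assumes "a > 0" and [measurable]: "f \<in> borel_measurable borel"
    and nonneg: "\<And>y. f y \<ge> 0" and zero: "\<And>y. y \<le> 0 \<Longrightarrow> f y = 0"
  shows "(\<integral>\<^sup>+y. f y \<partial>lborel) = (\<integral>\<^sup>+e. f (sqrt (e / a)) / (2 * sqrt (a * e)) \<partial>lborel)"
proof -
  define F where "F = (\<lambda>e. f (sqrt (e / a)) / (2 * sqrt (a * e)))"
  have F_nonneg: "F e \<ge> 0" for e
    using assms(1) nonneg zero[of "sqrt (e / a)"]
    by (cases "e \<ge> 0") (auto simp: F_def divide_nonneg_pos divide_le_0_iff)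
  \<comment> \<open>For \<open>e \<le> 0\<close> the value \<open>sqrt (e / a)\<close> is
    nonpositive, where \<open>f\<close> vanishes; the integral over the whole line only sees
    positive \<open>e\<close>.\<close>
  have F_zero: "F e = 0" if "e \<le> 0" for e
    using that assms(1) zero[of "sqrt (e / a)"] by (auto simp: F_def divide_le_0_iff)
  have [measurable]: "F \<in> borel_measurable borel"
    unfolding F_def by measurable
  have subst: "(\<integral>\<^sup>+e. ennreal (F e) * indicator {0..a * (real n)\<^sup>2} e \<partial>lborel) = (\<integral>\<^sup>+y. ennreal (f y) * indicator {0..real n} y \<partial>lborel)" for n
  proof -
    have "(\<integral>\<^sup>+e. ennreal (F e) * indicator {a * 0\<^sup>2..a * (real n)\<^sup>2} e \<partial>lborel)
        = (\<integral>\<^sup>+y. ennreal (F (a * y\<^sup>2) * (2 * a * y)) * indicator {0..real n} y \<partial>lborel)"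
      unfolding nn_integral_set_ennreal
      by (rule nn_integral_substitution)
         (use assms(1) in \<open>auto simp: set_borel_measurable_def intro!: derivative_eq_intros continuous_intros\<close>)
    also have "\<dots> = (\<integral>\<^sup>+y. ennreal (f y) * indicator {0..real n} y \<partial>lborel)"
    proof (rule nn_integral_cong)
      fix y :: real
      have "F (a * y\<^sup>2) * (2 * a * y) = f y" if "y > 0"
      proof -
        have "sqrt (a * (a * y\<^sup>2)) = a * y"
          using that assms(1) by (simp add: real_sqrt_mult power2_eq_square)
        then show ?thesis using that assms(1) by (simp add: F_def)
      qed
      moreover have "f y = 0" if "y \<le> 0" using zero that by simp
      ultimately show "ennreal (F (a * y\<^sup>2) * (2 * a * y)) * indicator {0..real n} y = ennreal (f y) * indicator {0..real n} y"
        by (cases "y > 0"; cases "y = 0") (auto simp: indicator_def F_zero)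
    qed
    finally show ?thesis by simp
  qed
  have "(\<lambda>n. \<integral>\<^sup>+y. ennreal (f y) * indicator {0..real n} y \<partial>lborel) \<longlonglongrightarrow> (\<integral>\<^sup>+y. f y \<partial>lborel)"
  proof (rule nn_integral_LIMSEQ)
    show "incseq (\<lambda>n y. ennreal (f y) * indicator {0..real n} y)"
      by (auto simp: incseq_def le_fun_def indicator_def)
    fix y :: real
    have "eventually (\<lambda>n. ennreal (f y) * indicator {0..real n} y = ennreal (f y)) sequentially"
      using eventually_ge_at_top[of "nat \<lceil>y\<rceil>"]
      by eventually_elim (use zero[of y] in \<open>cases "y \<le> 0"; auto simp: indicator_def; linarith\<close>)
    then show "(\<lambda>n. ennreal (f y) * indicator {0..real n} y) \<longlonglongrightarrow> ennreal (f y)"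
      by (rule tendsto_eventually)
  qed (auto)
  moreover have "(\<lambda>n. \<integral>\<^sup>+e. ennreal (F e) * indicator {0..a * (real n)\<^sup>2} e \<partial>lborel) \<longlonglongrightarrow> (\<integral>\<^sup>+y. F y \<partial>lborel)"
  proof (rule nn_integral_LIMSEQ)
    have "a * (real n)\<^sup>2 \<le> a * (real m)\<^sup>2" if "n \<le> m" for n m
      using that assms(1) by simp
    then show "incseq (\<lambda>n e. ennreal (F e) * indicator {0..a * (real n)\<^sup>2} e)"
      by (auto simp: incseq_def le_fun_def indicator_def intro: order_trans)
    fix e :: real
    have "filterlim (\<lambda>n. a * (real n)\<^sup>2) at_top sequentially"
      using assms(1)
      by (intro filterlim_tendsto_pos_mult_at_top[OF tendsto_const] filterlim_pow_at_top filterlim_real_sequentially) auto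
    then have "eventually (\<lambda>n. a * (real n)\<^sup>2 \<ge> e) sequentially"
      by (simp add: filterlim_at_top)
    then have "eventually (\<lambda>n. ennreal (F e) * indicator {0..a * (real n)\<^sup>2} e = ennreal (F e)) sequentially"
      by eventually_elim (use F_zero[of e] in \<open>cases "e \<le> 0"; auto simp: indicator_def\<close>)
    then show "(\<lambda>n. ennreal (F e) * indicator {0..a * (real n)\<^sup>2} e) \<longlonglongrightarrow> ennreal (F e)"
      by (rule tendsto_eventually)
  qed (auto)
  ultimately have "(\<integral>\<^sup>+y. f y \<partial>lborel) = (\<integral>\<^sup>+y. F y \<partial>lborel)"
    unfolding subst by (rule LIMSEQ_unique)
  then show ?thesis by (simp add: F_def)
qed

text \<open>\<open>m\<close> is the vertex of the parabola \<open>e = h + a * (y - m)^2\<close> and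
  \<open>s\<close> selects one of its two branches, on which the energy can replace \<open>y\<close>
  as coordinate.\<close>

lemma nn_integral_substitution_complete_square:
  fixes f :: "real \<Rightarrow> real"
  assumes "a > 0" and [measurable]: "f \<in> borel_measurable borel" and "s = 1 \<or> s = -1"
    and nonneg: "\<And>y. f y \<ge> 0" and zero: "\<And>y. s * (y - m) \<le> 0 \<Longrightarrow> f y = 0"
  shows "(\<integral>\<^sup>+y. f y \<partial>lborel) = 
    (\<integral>\<^sup>+e. f (m + s * sqrt ((e - h) / a)) / (2 * sqrt (a * (e - h))) \<partial>lborel)"
proof -
  have "(\<integral>\<^sup>+y. f y \<partial>lborel) = (\<integral>\<^sup>+y. f (m + s * y) \<partial>lborel)"
    using assms(3) by (subst nn_integral_real_affine[where c=s and t=m]) auto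
  also have "\<dots> = (\<integral>\<^sup>+e. f (m + s * sqrt (e / a)) / (2 * sqrt (a * e)) \<partial>lborel)"
  proof (subst nn_integral_substitution_square[OF assms(1)])
    fix y :: real assume "y \<le> 0"
    then show "f (m + s * y) = 0" using assms(3) by (intro zero) auto
  qed (use nonneg in auto)
  also have "\<dots> = (\<integral>\<^sup>+e. f (m + s * sqrt ((e - h) / a)) / (2 * sqrt (a * (e - h))) \<partial>lborel)"
    by (subst nn_integral_real_affine[where c=1 and t="-h"]) auto
  finally show ?thesis .
qed

subsection \<open>Positive definite quadratic forms\<close>

definition quadratic_form :: "('i \<Rightarrow> 'i \<Rightarrow> real) \<Rightarrow> 'i set \<Rightarrow> ('i \<Rightarrow> real) \<Rightarrow> real" where
  "quadratic_form A I x = (\<Sum>i\<in>I. \<Sum>j\<in>I. A i j * x i * x j)"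

text \<open>The coercivity constant is a parameter because its dependence on the dimension enters
  the final error bound. Dimension at least two keeps \<open>card I - 2\<close>, the radial exponent
  in polar coordinates, a true difference of naturals.\<close>

locale pos_quadratic_form =
  fixes I :: "'i set" and A :: "'i \<Rightarrow> 'i \<Rightarrow> real" and c :: real
  assumes finite_I: "finite I" and sym: "A i j = A j i" and c_pos: "c > 0"
    and coercive: "quadratic_form A I x \<ge> c * (\<Sum>i\<in>I. (x i)\<^sup>2)"
    and card_I: "card I \<ge> 2"
begin

abbreviation "H \<equiv> quadratic_form A I"
abbreviation "L \<equiv> PiM I (\<lambda>_. lborel :: real measure)"
abbreviation "BI \<equiv> PiM I (\<lambda>_. borel :: real measure)"

definition bil :: "('i \<Rightarrow> real) \<Rightarrow> ('i \<Rightarrow> real) \<Rightarrow> real" where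
  "bil x y = (\<Sum>i\<in>I. \<Sum>j\<in>I. A i j * x i * y j)"

definition grad :: "'i \<Rightarrow> ('i \<Rightarrow> real) \<Rightarrow> real" where
  "grad i x = 2 * (\<Sum>j\<in>I. A i j * x j)"

text \<open>With the other coordinates fixed, the form is a parabola in coordinate \<open>k\<close>;
  \<open>vertex\<close> is its minimiser and \<open>profile\<close> its minimum. Neither depends on
  \<open>x k\<close>, so both live on the product over \<open>I - {k}\<close>.\<close>

definition vertex :: "'i \<Rightarrow> ('i \<Rightarrow> real) \<Rightarrow> real" where
  "vertex k x = - (\<Sum>j\<in>I - {k}. A k j * x j) / A k k"

definition profile :: "'i \<Rightarrow> ('i \<Rightarrow> real) \<Rightarrow> real" where
  "profile k x = H (x(k := vertex k x))"

lemma H_measurable [measurable]: "H \<in> borel_measurable BI"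
  unfolding quadratic_form_def by measurable

lemma grad_measurable [measurable]: "grad i \<in> borel_measurable BI"
  unfolding grad_def by measurable

lemma vertex_measurable [measurable]: "vertex k \<in> borel_measurable (PiM (I - {k}) (\<lambda>_. borel))"
  unfolding vertex_def by measurable

lemma H_nonneg: "H x \<ge> 0"
  by (rule order_trans[OF mult_nonneg_nonneg coercive]) (use c_pos in \<open>auto intro: sum_nonneg\<close>)

lemma H_eq_0: "H x = 0 \<Longrightarrow> i \<in> I \<Longrightarrow> x i = 0"
proof -
  assume "H x = 0" "i \<in> I"
  then have "c * (\<Sum>i\<in>I. (x i)\<^sup>2) \<le> 0" using coercive[of x] by simp
  then have "(\<Sum>i\<in>I. (x i)\<^sup>2) \<le> 0" using c_pos by (simp add: mult_le_0_iff)
  then have "(\<Sum>i\<in>I. (x i)\<^sup>2) = 0" by (intro antisym sum_nonneg) auto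
  then show "x i = 0" using \<open>i \<in> I\<close> finite_I by (subst (asm) sum_nonneg_eq_0_iff) auto
qed

lemma diag_pos: "k \<in> I \<Longrightarrow> A k k > 0"
proof -
  assume k: "k \<in> I"
  let ?e = "\<lambda>i. if i = k then 1 else (0::real)"
  have "H ?e = (\<Sum>i\<in>I. \<Sum>j\<in>I. if j = k then (if i = k then A k k else 0) else 0)"
    unfolding quadratic_form_def by (intro sum.cong refl) auto
  also have "\<dots> = A k k"
    using k finite_I by simp
  finally have "H ?e = A k k" .
  moreover have "(\<Sum>i\<in>I. (?e i)\<^sup>2) = (\<Sum>i\<in>I. if i = k then 1 else 0)"
    by (intro sum.cong refl) auto
  then have "(\<Sum>i\<in>I. (?e i)\<^sup>2) = 1" using k finite_I by simp
  ultimately show ?thesis using coercive[of ?e] c_pos by simp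
qed

lemma H_cong: "(\<And>i. i \<in> I \<Longrightarrow> x i = y i) \<Longrightarrow> H x = H y"
  unfolding quadratic_form_def by (intro sum.cong refl) simp

lemma grad_cong: "(\<And>i. i \<in> I \<Longrightarrow> x i = y i) \<Longrightarrow> grad k x = grad k y"
  unfolding grad_def by (intro arg_cong[where f="(*) 2"] sum.cong refl) simp

lemma vertex_cong: "(\<And>i. i \<in> I - {k} \<Longrightarrow> x i = y i) \<Longrightarrow> vertex k x = vertex k y"
  unfolding vertex_def by (intro arg_cong[where f="\<lambda>s. - s / A k k"] sum.cong refl) simp

lemma profile_cong: "(\<And>i. i \<in> I - {k} \<Longrightarrow> x i = y i) \<Longrightarrow> profile k x = profile k y"
  unfolding profile_def using vertex_cong[of k x y] by (intro H_cong) simp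

lemma H_scale: "H (\<lambda>i. l * x i) = l\<^sup>2 * H x"
  unfolding quadratic_form_def by (simp add: sum_distrib_left power2_eq_square mult_ac)

lemma grad_scale: "grad i (\<lambda>i. l * x i) = l * grad i x"
  unfolding grad_def by (simp add: sum_distrib_left mult_ac)

lemma vertex_scale: "vertex k (\<lambda>i. l * x i) = l * vertex k x"
  unfolding vertex_def by (simp add: sum_distrib_left mult_ac)

lemma profile_scale: "profile k (\<lambda>i. l * x i) = l\<^sup>2 * profile k x"
proof -
  have "profile k (\<lambda>i. l * x i) = H (\<lambda>i. l * (x(k := vertex k x)) i)"
    unfolding profile_def vertex_scale by (intro H_cong) simp
  then show ?thesis by (simp only: H_scale profile_def)
qed

lemma profile_nonneg: "profile k x \<ge> 0"
  unfolding profile_def by (rule H_nonneg)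

lemma bil_sym: "bil x y = bil y x"
  unfolding bil_def by (subst sum.swap) (intro sum.cong refl, simp add: sym mult_ac)

lemma H_add: "H (\<lambda>i. x i + y i) = H x + 2 * bil x y + H y"
proof -
  have "H (\<lambda>i. x i + y i) = H x + bil x y + bil y x + H y"
    unfolding quadratic_form_def bil_def by (simp add: algebra_simps sum.distrib)
  then show ?thesis using bil_sym[of x y] by simp
qed

lemma grad_euler: "(\<Sum>i\<in>I. x i * grad i x) = 2 * H x"
  unfolding grad_def quadratic_form_def by (simp add: sum_distrib_left mult_ac)

lemma grad_upd:
  assumes "k \<in> I"
  shows "grad k (x(k := y)) = 2 * A k k * (y - vertex k x)"
proof -
  have "(\<Sum>j\<in>I. A k j * (x(k := y)) j) = A k k * y + (\<Sum>j\<in>I - {k}. A k j * x j)"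
    using assms finite_I by (subst sum.remove[of I k]) auto
  then show ?thesis
    using diag_pos[OF assms] by (simp add: grad_def vertex_def field_simps)
qed

text \<open>Expansion about the vertex: the linear term is \<open>grad k\<close> there, which
  vanishes, and the quadratic coefficient is the diagonal entry.\<close>

lemma H_upd:
  assumes "k \<in> I"
  shows "H (x(k := y)) = A k k * (y - vertex k x)\<^sup>2 + profile k x"
proof -
  let ?v = "x(k := vertex k x)"
  let ?d = "\<lambda>i. if i = k then y - vertex k x else 0"
  have "H (x(k := y)) = H (\<lambda>i. ?v i + ?d i)"
    by (rule H_cong) simp
  also have "\<dots> = H ?v + 2 * bil ?v ?d + H ?d" by (rule H_add)
  also have "2 * bil ?v ?d = grad k ?v * (y - vertex k x)"
  proof -
    have "bil ?v ?d = (\<Sum>i\<in>I. \<Sum>j\<in>I. if j = k then A i k * ?v i * (y - vertex k x) else 0)"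
      unfolding bil_def by (intro sum.cong refl) auto
    also have "\<dots> = (\<Sum>i\<in>I. A i k * ?v i * (y - vertex k x))"
      using assms finite_I by simp
    also have "\<dots> = (\<Sum>i\<in>I. A k i * ?v i) * (y - vertex k x)"
      by (simp add: sum_distrib_right sym[of _ k])
    finally show ?thesis by (simp add: grad_def)
  qed
  also have "grad k ?v = 0" using grad_upd[OF assms, of x "vertex k x"] by simp
  also have "H ?d = A k k * (y - vertex k x)\<^sup>2"
  proof -
    have "H ?d = (\<Sum>i\<in>I. \<Sum>j\<in>I. if j = k then (if i = k then A k k * (y - vertex k x)\<^sup>2 else 0) else 0)"
      unfolding quadratic_form_def by (intro sum.cong refl) (auto simp: power2_eq_square)
    then show ?thesis using assms finite_I by simp
  qed
  finally show ?thesis by (simp add: profile_def fun_upd_def)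
qed

lemma profile_measurable [measurable]:
  assumes "k \<in> I" shows "profile k \<in> borel_measurable (PiM (I - {k}) (\<lambda>_. borel))"
proof -
  have "(\<lambda>x. (x, vertex k x)) \<in> measurable (PiM (I - {k}) (\<lambda>_. borel)) (PiM (I - {k}) (\<lambda>_. borel) \<Otimes>\<^sub>M borel)"
    by measurable
  from measurable_compose[OF measurable_compose[OF this fun_upd_measurable_PiM[OF assms]] H_measurable]
  show ?thesis by (simp add: profile_def[abs_def])
qed

text \<open>Stated along a curve because it serves for coordinate lines, for curves inside a graph
  lying on the shell, and for the moving vertex.\<close>

lemma H_has_derivative_along:
  assumes "\<And>j. j \<in> I \<Longrightarrow> ((\<lambda>t. z t j) has_real_derivative d j) (at t0)"
  shows "((\<lambda>t. H (z t)) has_real_derivative (\<Sum>j\<in>I. grad j (z t0) * d j)) (at t0)"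
proof -
  have "((\<lambda>t. H (z t)) has_real_derivative
      (\<Sum>i\<in>I. \<Sum>j\<in>I. A i j * d i * z t0 j + A i j * z t0 i * d j)) (at t0)"
    unfolding quadratic_form_def
    by (intro DERIV_sum) (auto intro!: derivative_eq_intros assms simp: algebra_simps)
  also have "(\<Sum>i\<in>I. \<Sum>j\<in>I. A i j * d i * z t0 j + A i j * z t0 i * d j) =
     (\<Sum>i\<in>I. \<Sum>j\<in>I. A i j * d i * z t0 j) + (\<Sum>i\<in>I. \<Sum>j\<in>I. A i j * z t0 i * d j)"
    by (simp add: sum.distrib)
  also have "(\<Sum>i\<in>I. \<Sum>j\<in>I. A i j * z t0 i * d j) = (\<Sum>i\<in>I. \<Sum>j\<in>I. A i j * d i * z t0 j)"
    by (subst sum.swap) (intro sum.cong refl, simp add: sym mult_ac)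
  also have "(\<Sum>i\<in>I. \<Sum>j\<in>I. A i j * d i * z t0 j) + (\<Sum>i\<in>I. \<Sum>j\<in>I. A i j * d i * z t0 j) = (\<Sum>j\<in>I. grad j (z t0) * d j)"
    by (simp add: grad_def sum_distrib_left sum_distrib_right mult_ac flip: sum.distrib)
  finally show ?thesis .
qed

lemma partial_deriv_H:
  assumes "i \<in> I" shows "partial_deriv i H x = grad i x"
proof -
  have "((\<lambda>t. H (x(i := t))) has_real_derivative (\<Sum>j\<in>I. grad j (x(i := x i)) * (if j = i then 1 else 0))) (at (x i))"
    by (rule H_has_derivative_along) (auto intro!: derivative_eq_intros)
  also have "(\<Sum>j\<in>I. grad j (x(i := x i)) * (if j = i then 1 else 0)) = grad i x"
    using assms finite_I by (simp add: if_distrib cong: if_cong)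
  finally show ?thesis unfolding partial_deriv_def by (rule DERIV_imp_deriv)
qed

lemma gradient_norm_H: "gradient_norm I H x = sqrt (\<Sum>i\<in>I. (grad i x)\<^sup>2)"
  unfolding gradient_norm_def by (simp add: partial_deriv_H cong: sum.cong)

lemma gradient_norm_measurable [measurable]: "gradient_norm I H \<in> borel_measurable BI"
  unfolding gradient_norm_H[abs_def] by measurable

text \<open>Euler's identity forbids a zero gradient where the form is positive. So the shell is a
  regular hypersurface, covered by graphs over the coordinate hyperplanes.\<close>

lemma ex_grad_nonzero:
  assumes "H x > 0" obtains k where "k \<in> I" "grad k x \<noteq> 0"
proof -
  have "(\<Sum>i\<in>I. x i * grad i x) \<noteq> 0" using grad_euler[of x] assms by simp
  then obtain k where "k \<in> I" "x k * grad k x \<noteq> 0" by (meson sum.neutral)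
  then show ?thesis using that by auto
qed

lemma gradient_norm_pos: "H x > 0 \<Longrightarrow> gradient_norm I H x > 0"
proof -
  assume "H x > 0"
  then obtain k where "k \<in> I" "grad k x \<noteq> 0" by (rule ex_grad_nonzero)
  then have "(\<Sum>i\<in>I. (grad i x)\<^sup>2) > 0"
    using finite_I by (intro sum_pos2[of _ k]) auto
  then show ?thesis by (simp add: gradient_norm_H)
qed

text \<open>The sign of the \<open>k\<close>-th partial derivative tells on which side of the vertex
  the point lies. On that side the energy equation has a single root, so any graph contained in the
  shell coincides there with this one.\<close>

lemma sheet_eq:
  assumes k: "k \<in> I" and s: "s = 1 \<or> s = -1" and H: "H (z(k := y)) = e" and g: "s * grad k (z(k := y)) > 0"
  shows "profile k z < e" "y = vertex k z + s * sqrt ((e - profile k z) / A k k)"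
proof -
  have a: "A k k > 0" by (rule diag_pos[OF k])
  have d: "s * (y - vertex k z) > 0"
    using g a unfolding grad_upd[OF k] by (simp add: mult.left_commute[of s] zero_less_mult_iff)
  have e: "e - profile k z = A k k * (y - vertex k z)\<^sup>2" using H unfolding H_upd[OF k] by simp
  moreover have "(y - vertex k z)\<^sup>2 > 0" using d by auto
  ultimately show "profile k z < e" using a by (metis diff_gt_0_iff_gt mult_pos_pos)
  have "(y - vertex k z)\<^sup>2 = (s * (y - vertex k z))\<^sup>2" using s by (auto simp: power2_eq_square)
  then have "sqrt ((e - profile k z) / A k k) = s * (y - vertex k z)"
    using e a d by (simp add: real_sqrt_unique)
  then show "y = vertex k z + s * sqrt ((e - profile k z) / A k k)" using s by auto
qed

lemma sheet_H:
  assumes k: "k \<in> I" and s: "s = 1 \<or> s = -1" and "profile k z \<le> e"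
  shows "H (z(k := vertex k z + s * sqrt ((e - profile k z) / A k k))) = e"
proof -
  have "(s * sqrt ((e - profile k z) / A k k))\<^sup>2 = (e - profile k z) / A k k"
    using s assms(3) diag_pos[OF k] by (auto simp: power2_eq_square)
  then show ?thesis
    unfolding H_upd[OF k] using diag_pos[OF k] by simp
qed

text \<open>For \<open>s\<close> of modulus 1 the modulus of the right side is the reciprocal of the
  Jacobian of the energy substitution, which thereby becomes \<open>1 / |grad k|\<close>.\<close>

lemma sheet_grad:
  assumes k: "k \<in> I" and "profile k z \<le> e"
  shows "grad k (z(k := vertex k z + s * sqrt ((e - profile k z) / A k k)))
     = s * (2 * sqrt (A k k * (e - profile k z)))"
proof -
  have "A k k * sqrt ((e - profile k z) / A k k) = sqrt (A k k * (e - profile k z))"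
  proof -
    have "A k k * (e - profile k z) = (A k k)\<^sup>2 * ((e - profile k z) / A k k)"
      using diag_pos[OF k] by (simp add: power2_eq_square)
    then show ?thesis using diag_pos[OF k] by (simp only: real_sqrt_mult real_sqrt_abs abs_of_pos)
  qed
  then show ?thesis unfolding grad_upd[OF k] by (simp add: mult_ac)
qed

end

subsection \<open>Polar coordinates adapted to the form\<close>

lemma nn_integral_power_exp_finite:
  assumes "b > 0"
  shows "(\<integral>\<^sup>+y. ennreal (y ^ m * exp (- b * y)) * indicator {0..} y \<partial>lborel) < \<infinity>"
proof -
  have "(\<integral>\<^sup>+y. ennreal (y ^ m * exp (- b * y)) * indicator {0..} y \<partial>lborel)
    = ennreal (1 / b) * (\<integral>\<^sup>+y. ennreal ((y / b) ^ m * exp (- y)) * indicator {0..} (y / b) \<partial>lborel)"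
    using assms by (subst nn_integral_real_affine[where c="1 / b" and t=0]) auto
  also have "(\<integral>\<^sup>+y. ennreal ((y / b) ^ m * exp (- y)) * indicator {0..} (y / b) \<partial>lborel) =
     (\<integral>\<^sup>+y. ennreal ((1 / b) ^ m) * (ennreal (y ^ m * exp (- y)) * indicator {0..} y) \<partial>lborel)"
    using assms by (intro nn_integral_cong)
      (auto simp: indicator_def power_divide zero_le_divide_iff simp flip: ennreal_mult)
  also have "\<dots> = ennreal ((1 / b) ^ m) * ennreal (fact m)"
    by (subst nn_integral_cmult) (auto simp: nn_intergal_power_times_exp_Ici)
  finally show ?thesis
    by (simp add: ennreal_mult_less_top)
qed

locale pos_quadratic_energy = pos_quadratic_form +
  fixes E \<beta> :: real
  assumes E_pos: "E > 0" and \<beta>_pos: "\<beta> > 0"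
begin

text \<open>The radial projection onto the shell. Where the form is 0, division by 0 sends the point
  to 0, off the shell; this concerns a null set only.\<close>

definition nrm :: "('a \<Rightarrow> real) \<Rightarrow> 'a \<Rightarrow> real" where
  "nrm x = (\<lambda>i\<in>I. x i / sqrt (H x / E))"

definition sheet :: "'a \<Rightarrow> real \<Rightarrow> ('a \<Rightarrow> real) \<Rightarrow> 'a \<Rightarrow> real" where
  "sheet k s z = z(k := vertex k z + s * sqrt ((E - profile k z) / A k k))"

text \<open>This is \<open>1 / |grad k|\<close> at the points of the shell above \<open>z\<close>,
  that is, the measure \<open>d\<sigma> / |\<nabla>H|\<close> in the coordinates other than
  \<open>k\<close>; it is set to 0 outside the open shadow of the shell.\<close>

definition sheet_density :: "'a \<Rightarrow> ('a \<Rightarrow> real) \<Rightarrow> real" where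
  "sheet_density k z = (if profile k z < E then 1 / (2 * sqrt (A k k * (E - profile k z))) else 0)"

text \<open>The radial integral. With \<open>l = sqrt (e / E)\<close>, dilating
  \<open>card I - 1\<close> coordinates gives \<open>l ^ (card I - 1)\<close>, and the Jacobian of
  the energy substitution removes one factor \<open>l\<close>.\<close>

definition K :: ennreal where
  "K = (\<integral>\<^sup>+e. ennreal (exp (- \<beta> * e) * sqrt (e / E) ^ (card I - 2)) * indicator {0<..} e \<partial>lborel)"

lemma nrm_measurable [measurable]: "nrm \<in> measurable BI BI"
  unfolding nrm_def[abs_def] by measurable

lemma sheet_measurable: "k \<in> I \<Longrightarrow> sheet k s \<in> measurable (PiM (I - {k}) (\<lambda>_. borel)) BI"
proof -
  assume k: "k \<in> I"
  have [measurable]: "profile k \<in> borel_measurable (PiM (I - {k}) (\<lambda>_. borel))"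
    by (rule profile_measurable[OF k])
  have "(\<lambda>z. (z, vertex k z + s * sqrt ((E - profile k z) / A k k))) \<in> 
      measurable (PiM (I - {k}) (\<lambda>_. borel)) (PiM (I - {k}) (\<lambda>_. borel) \<Otimes>\<^sub>M borel)"
    by measurable
  from measurable_compose[OF this fun_upd_measurable_PiM[OF k]]
  show ?thesis by (simp add: sheet_def[abs_def])
qed

lemma sheet_density_measurable: "k \<in> I \<Longrightarrow> sheet_density k \<in> borel_measurable (PiM (I - {k}) (\<lambda>_. borel))"
proof -
  assume k: "k \<in> I"
  have [measurable]: "profile k \<in> borel_measurable (PiM (I - {k}) (\<lambda>_. borel))"
    by (rule profile_measurable[OF k])
  show ?thesis unfolding sheet_density_def[abs_def] by measurable
qed

lemma sheet_density_nonneg: "k \<in> I \<Longrightarrow> sheet_density k z \<ge> 0"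
  using diag_pos[of k] by (auto simp: sheet_density_def)

lemma nrm_scale:
  assumes "l > 0" "H x = E" "x \<in> extensional I" "\<And>i. i \<in> I \<Longrightarrow> y i = l * x i"
  shows "nrm y = x"
proof -
  have "H y = H (\<lambda>i. l * x i)" using assms(4) by (intro H_cong) simp
  then have "H y / E = l\<^sup>2" using assms(2) E_pos by (simp add: H_scale)
  then have "sqrt (H y / E) = l" using assms(1) by simp
  then show ?thesis
    using assms(1,3,4) by (auto simp: nrm_def fun_eq_iff extensional_def)
qed

lemma H_nrm: "H x > 0 \<Longrightarrow> H (nrm x) = E"
proof -
  assume x: "H x > 0"
  have "H (nrm x) = H (\<lambda>i. (1 / sqrt (H x / E)) * x i)"
    by (rule H_cong) (simp add: nrm_def)
  also have "\<dots> = E" unfolding H_scale using x E_pos by (simp add: power_divide)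
  finally show ?thesis .
qed

lemma grad_nrm: "grad k (nrm x) = grad k x / sqrt (H x / E)"
proof -
  have "grad k (nrm x) = grad k (\<lambda>i. (1 / sqrt (H x / E)) * x i)"
    by (rule grad_cong) (simp add: nrm_def)
  then show ?thesis by (simp only: grad_scale) simp
qed

lemma K_finite: "K < \<infinity>"
proof -
  let ?m = "card I - 2"
  let ?g = "\<lambda>m y. ennreal (y ^ m * exp (- \<beta> * y)) * indicator {0..} y"
  \<comment> \<open>In odd dimension half-integer powers of the energy occur; this bound reduces
    them to Gamma integrals with integer exponent.\<close>
  have *: "sqrt y ^ m \<le> 1 + y ^ m" if "y \<ge> 0" for y :: real and m
  proof (cases "y \<le> 1")
    case True
    then have "sqrt y ^ m \<le> 1" using that by (intro power_le_one) auto
    then show ?thesis using that by (simp add: add_increasing2)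
  next
    case False
    then have "sqrt y \<le> y" using real_sqrt_le_iff[of y "y^2"] by (simp add: power2_eq_square)
    then have "sqrt y ^ m \<le> y ^ m" using that by (intro power_mono) auto
    then show ?thesis by simp
  qed
  have "K \<le> (\<integral>\<^sup>+y. ?g 0 y + ennreal ((1 / E) ^ ?m) * ?g ?m y \<partial>lborel)"
    unfolding K_def
  proof (rule nn_integral_mono)
    fix y :: real
    have "exp (- \<beta> * y) * sqrt (y / E) ^ ?m \<le> exp (- \<beta> * y) * (1 + (y / E) ^ ?m)" if "y > 0"
      using that E_pos by (intro mult_left_mono *) auto
    also have "exp (- \<beta> * y) * (1 + (y / E) ^ ?m) = y ^ 0 * exp (- \<beta> * y) + (1 / E) ^ ?m * (y ^ ?m * exp (- \<beta> * y))"
      by (simp add: algebra_simps power_divide)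
    finally show "ennreal (exp (- \<beta> * y) * sqrt (y / E) ^ ?m) * indicator {0<..} y \<le> ?g 0 y + ennreal ((1 / E) ^ ?m) * ?g ?m y"
      using E_pos by (auto simp: indicator_def simp flip: ennreal_mult ennreal_plus intro!: ennreal_leI)
  qed
  also have "\<dots> = (\<integral>\<^sup>+y. ?g 0 y \<partial>lborel) + ennreal ((1 / E) ^ ?m) * (\<integral>\<^sup>+y. ?g ?m y \<partial>lborel)"
    by (subst nn_integral_add) (auto simp: nn_integral_cmult)
  also have "\<dots> < \<infinity>"
    using nn_integral_power_exp_finite[OF \<beta>_pos, of 0] nn_integral_power_exp_finite[OF \<beta>_pos, of ?m]
    by (simp add: ennreal_mult_less_top)
  finally show ?thesis .
qed

lemma K_nonzero: "K \<noteq> 0"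
proof
  assume "K = 0"
  then have "AE e in lborel. ennreal (exp (- \<beta> * e) * sqrt (e / E) ^ (card I - 2)) * indicator {0<..} e = 0"
    unfolding K_def by (subst (asm) nn_integral_0_iff_AE) auto
  then have "AE e in lborel. e \<notin> {0<..1::real}"
  proof eventually_elim
    case (elim e)
    have "exp (- \<beta> * e) * sqrt (e / E) ^ (card I - 2) > 0" if "e > 0"
      using that E_pos by simp
    with elim show ?case by (auto simp: indicator_def ennreal_eq_0_iff not_le split: if_splits)
  qed
  then have "emeasure lborel {0<..1::real} = 0"
    by (subst (asm) AE_iff_measurable[of "{0<..1}"]) auto
  then show False by simp
qed

text \<open>
  The part of Lebesgue measure on which the coordinate \<open>k\<close> lies on one fixed side of the vertex is
  parametrised by the energy \<open>e\<close> and the remaining coordinates; homogeneity then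
  separates the two.
\<close>

lemma polar_sheet:
  fixes F :: "('a \<Rightarrow> real) \<Rightarrow> real"
  assumes k: "k \<in> I" and s: "s = 1 \<or> s = -1"
    and F[measurable]: "F \<in> borel_measurable BI" and F_nonneg: "\<And>x. F x \<ge> 0"
    and F_zero: "\<And>x. s * grad k x \<le> 0 \<Longrightarrow> F x = 0"
  shows "(\<integral>\<^sup>+x. ennreal (exp (- \<beta> * H x) * F (nrm x)) \<partial>L) =
    K * (\<integral>\<^sup>+z. ennreal (F (sheet k s z) * sheet_density k z) \<partial>PiM (I - {k}) (\<lambda>_. lborel))"
proof -
  let ?J = "I - {k}"
  let ?LJ = "PiM ?J (\<lambda>_. lborel :: real measure)" and ?BJ = "PiM ?J (\<lambda>_. borel :: real measure)"
  define a where "a = A k k"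
  have a: "a > 0" unfolding a_def by (rule diag_pos[OF k])
  define f where "f = (\<lambda>x. exp (- \<beta> * H x) * F (nrm x))"
  have f_meas[measurable]: "f \<in> borel_measurable BI" unfolding f_def by measurable
  have f_nonneg: "f x \<ge> 0" for x using F_nonneg by (simp add: f_def)
  have f_zero: "f (z(k := y)) = 0" if "s * (y - vertex k z) \<le> 0" for z y
  proof -
    have "s * grad k (nrm (z(k := y))) = (2 * a / sqrt (H (z(k := y)) / E)) * (s * (y - vertex k z))"
      unfolding grad_nrm grad_upd[OF k] by (simp add: a_def)
    also have "\<dots> \<le> 0"
      by (rule mult_nonneg_nonpos[OF _ that]) (use a H_nonneg E_pos in auto)
    finally show ?thesis using F_zero by (simp add: f_def)
  qed
  define pt where "pt = (\<lambda>z e. z(k := vertex k z + s * sqrt ((e - profile k z) / a)))"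
  define G where "G = (\<lambda>z e. f (pt z e) / (2 * sqrt (a * (e - profile k z))))"
  have G_zero: "G z e = 0" if "e \<le> profile k z" for z e
  proof -
    have "sqrt ((e - profile k z) / a) \<le> 0" using that a by (simp add: divide_le_0_iff)
    then have "f (pt z e) = 0" unfolding pt_def using s by (intro f_zero) auto
    then show ?thesis by (simp add: G_def)
  qed
  have [measurable]: "profile k \<in> borel_measurable ?BJ" by (rule profile_measurable[OF k])
  have [measurable]: "sheet k s \<in> measurable ?BJ BI" by (rule sheet_measurable[OF k])
  have [measurable]: "sheet_density k \<in> borel_measurable ?BJ" by (rule sheet_density_measurable[OF k])
  have "(\<lambda>p. (fst p, vertex k (fst p) + s * sqrt ((snd p - profile k (fst p)) / a)))
     \<in> measurable (?BJ \<Otimes>\<^sub>M borel) (?BJ \<Otimes>\<^sub>M borel)"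
    by measurable
  from measurable_compose[OF this fun_upd_measurable_PiM[OF k]]
  have [measurable]: "(\<lambda>p. pt (fst p) (snd p)) \<in> measurable (?BJ \<Otimes>\<^sub>M borel) BI"
    by (simp add: pt_def)
  have G_meas: "(\<lambda>p. G (fst p) (snd p)) \<in> borel_measurable (?BJ \<Otimes>\<^sub>M borel)"
    unfolding G_def by measurable
  have G_section: "(\<lambda>z. G z e) \<in> borel_measurable ?BJ" for e
  proof -
    have "(\<lambda>z. (z, e)) \<in> measurable ?BJ (?BJ \<Otimes>\<^sub>M borel)" by measurable
    from measurable_compose[OF this G_meas] show ?thesis by simp
  qed
  define \<Phi> where "\<Phi> = (\<lambda>z. F (sheet k s z) * sheet_density k z)"
  have [measurable]: "\<Phi> \<in> borel_measurable ?BJ" unfolding \<Phi>_def by measurable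
  have \<Phi>_nonneg: "\<Phi> z \<ge> 0" for z
    unfolding \<Phi>_def using F_nonneg sheet_density_nonneg[OF k] by simp

  have level: "(\<integral>\<^sup>+z. ennreal (G z e) \<partial>?LJ) =
      (ennreal (exp (- \<beta> * e) * sqrt (e / E) ^ (card I - 2)) * indicator {0<..} e) * (\<integral>\<^sup>+z. ennreal (\<Phi> z) \<partial>?LJ)" for e
  proof (cases "e > 0")
    case False
    then have "G z e = 0" for z using profile_nonneg[of k z] by (intro G_zero) linarith
    then show ?thesis using False by simp
  next
    case True
    \<comment> \<open>Dilation by \<open>l\<close> carries the level \<open>E\<close> to the level
      \<open>e\<close>. As \<open>profile\<close> scales with \<open>l\<^sup>2\<close>, the
      condition \<open>profile < e\<close> becomes \<open>profile < E\<close>, whatever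
      \<open>e\<close> is.\<close>
    define l where "l = sqrt (e / E)"
    have l: "l > 0" using True E_pos by (simp add: l_def)
    have e: "e = l\<^sup>2 * E" using True E_pos by (simp add: l_def)
    have card: "card ?J = Suc (card I - 2)" using k finite_I card_I by simp
    have "(\<integral>\<^sup>+z. ennreal (G z e) \<partial>?LJ) = ennreal (l ^ card ?J) *
        (\<integral>\<^sup>+z. ennreal (G (\<lambda>i\<in>?J. 0 + l * z i) e) \<partial>?LJ)"
      using finite_I l G_section by (intro nn_integral_PiM_lborel_affine) auto
    also have "(\<integral>\<^sup>+z. ennreal (G (\<lambda>i\<in>?J. 0 + l * z i) e) \<partial>?LJ) =
        (\<integral>\<^sup>+z. ennreal (exp (- \<beta> * e) / l) * ennreal (\<Phi> z) \<partial>?LJ)"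
    proof (rule nn_integral_cong)
      fix z :: "'a \<Rightarrow> real" assume "z \<in> space ?LJ"
      then have z: "z \<in> extensional ?J" by simp
      let ?z = "\<lambda>i\<in>?J. 0 + l * z i"
      have v: "vertex k ?z = l * vertex k z"
        unfolding vertex_scale[symmetric] by (rule vertex_cong) simp
      have p: "profile k ?z = l\<^sup>2 * profile k z"
        unfolding profile_scale[symmetric] by (rule profile_cong) simp
      have "G ?z e = exp (- \<beta> * e) / l * \<Phi> z"
      proof (cases "profile k z < E")
        case False
        then have "e \<le> profile k ?z" unfolding p e by (simp add: mult_left_mono)
        then show ?thesis using False by (simp add: G_zero \<Phi>_def sheet_density_def)
      next
        case True
        have ep: "e - profile k ?z = l\<^sup>2 * (E - profile k z)"
          by (simp only: p e right_diff_distrib)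
        have sh_H: "H (sheet k s z) = E"
          unfolding sheet_def using True by (intro sheet_H k s) simp
        have sh_ext: "sheet k s z \<in> extensional I"
          using z k by (auto simp: sheet_def extensional_def)
        have "sqrt (l\<^sup>2 * (E - profile k z) / a) = sqrt (l\<^sup>2 * ((E - profile k z) / a))" by simp
        also have "\<dots> = l * sqrt ((E - profile k z) / a)"
          using l by (simp only: real_sqrt_mult real_sqrt_abs abs_of_pos)
        finally have pt_eq: "pt ?z e i = l * sheet k s z i" if "i \<in> I" for i
          using that unfolding pt_def ep v sheet_def a_def by (simp add: distrib_left)
        have "nrm (pt ?z e) = sheet k s z"
          using nrm_scale[OF l sh_H sh_ext pt_eq] by simp
        moreover have "H (pt ?z e) = e"
        proof -
          have "H (pt ?z e) = H (\<lambda>i. l * sheet k s z i)" by (rule H_cong) (rule pt_eq)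
          then show ?thesis by (simp add: H_scale sh_H e)
        qed
        moreover have "sqrt (a * (e - profile k ?z)) = l * sqrt (a * (E - profile k z))"
          using l unfolding ep by (simp add: real_sqrt_mult)
        ultimately show ?thesis
          using True by (simp add: G_def f_def \<Phi>_def sheet_density_def a_def)
      qed
      then show "ennreal (G ?z e) = ennreal (exp (- \<beta> * e) / l) * ennreal (\<Phi> z)"
        using l \<Phi>_nonneg by (simp flip: ennreal_mult)
    qed
    also have "\<dots> = ennreal (exp (- \<beta> * e) / l) * (\<integral>\<^sup>+z. ennreal (\<Phi> z) \<partial>?LJ)"
      by (rule nn_integral_cmult) simp
    also have "ennreal (l ^ card ?J) * (ennreal (exp (- \<beta> * e) / l) * X) =
      (ennreal (exp (- \<beta> * e) * sqrt (e / E) ^ (card I - 2)) * indicator {0<..} e) * X" for X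
      using l True unfolding card mult.assoc[symmetric] l_def[symmetric]
      by (simp add: field_simps flip: ennreal_mult)
    finally show ?thesis .
  qed

  have "(\<integral>\<^sup>+x. ennreal (f x) \<partial>L) = (\<integral>\<^sup>+z. \<integral>\<^sup>+y. ennreal (f (z(k := y))) \<partial>lborel \<partial>?LJ)"
    using finite_I k by (intro nn_integral_PiM_remove) auto
  also have "\<dots> = (\<integral>\<^sup>+z. \<integral>\<^sup>+e. ennreal (G z e) \<partial>lborel \<partial>?LJ)"
  proof (rule nn_integral_cong)
    fix z :: "'a \<Rightarrow> real" assume "z \<in> space ?LJ"
    then have "(\<lambda>y. (z, y)) \<in> measurable borel (?BJ \<Otimes>\<^sub>M borel)" by simp
    from measurable_compose[OF measurable_compose[OF this fun_upd_measurable_PiM[OF k]] f_meas]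
    have "(\<lambda>y. f (z(k := y))) \<in> borel_measurable borel" by simp
    from nn_integral_substitution_complete_square[OF a this s f_nonneg f_zero]
    show "(\<integral>\<^sup>+y. ennreal (f (z(k := y))) \<partial>lborel) = (\<integral>\<^sup>+e. ennreal (G z e) \<partial>lborel)"
      unfolding G_def pt_def by simp
  qed
  also have "\<dots> = (\<integral>\<^sup>+e. \<integral>\<^sup>+z. ennreal (G z e) \<partial>?LJ \<partial>lborel)"
  proof -
    interpret J: sigma_finite_measure ?LJ
      by (rule lborel_PiM.sigma_finite) (use finite_I in auto)
    interpret pair_sigma_finite ?LJ lborel ..
    have "sets (?LJ \<Otimes>\<^sub>M lborel) = sets (?BJ \<Otimes>\<^sub>M borel)"
      by (intro sets_pair_measure_cong) auto
    then have "(\<lambda>(z, e). ennreal (G z e)) \<in> borel_measurable (?LJ \<Otimes>\<^sub>M lborel)"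
      using G_meas by (simp add: case_prod_beta cong: measurable_cong_sets)
    then show ?thesis by (rule Fubini'[symmetric])
  qed
  also have "\<dots> = (\<integral>\<^sup>+e. (ennreal (exp (- \<beta> * e) * sqrt (e / E) ^ (card I - 2)) * indicator {0<..} e) *
     (\<integral>\<^sup>+z. ennreal (\<Phi> z) \<partial>?LJ) \<partial>lborel)"
    by (intro nn_integral_cong level)
  also have "\<dots> = K * (\<integral>\<^sup>+z. ennreal (\<Phi> z) \<partial>?LJ)"
    unfolding K_def by (rule nn_integral_multc) auto
  finally show ?thesis by (simp add: f_def \<Phi>_def)
qed

end

subsection \<open>The surface measure of the energy shell\<close>

context pos_quadratic_energy
begin

abbreviation "S \<equiv> energy_shell I H E"

definition gibbs :: "('a \<Rightarrow> real) measure" where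
  "gibbs = density L (\<lambda>x. ennreal (exp (- \<beta> * H x)))"

text \<open>Projecting the Gibbs weight radially yields \<open>K\<close> times
  \<open>d\<sigma> / |\<nabla>H|\<close>; the density \<open>|\<nabla>H| / K\<close> undoes both
  factors. Existence of the surface measure is thus obtained without gluing local pieces.\<close>

definition sigma :: "('a \<Rightarrow> real) measure" where
  "sigma = density (distr gibbs BI nrm) (\<lambda>x. ennreal (gradient_norm I H x) / K)"

lemma sets_gibbs [simp]: "sets gibbs = sets BI"
  by (simp add: gibbs_def)

lemma space_gibbs [simp]: "space gibbs = extensional I"
  by (simp add: gibbs_def)

lemma measurable_gibbs [simp]: "measurable gibbs M = measurable BI M"
  by (intro measurable_cong_sets) auto

lemma sets_sigma [simp]: "sets sigma = sets BI"
  by (simp add: sigma_def)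

lemma shell_sets [measurable]: "S \<in> sets BI"
proof -
  have "S = H -` {E} \<inter> space BI" by (auto simp: energy_shell_def)
  then show ?thesis by (simp only: measurable_sets[OF H_measurable] borel_singleton sets.empty_sets)
qed

lemma AE_H_pos: "AE x in L. H x > 0"
proof -
  let ?z = "\<lambda>i\<in>I. 0 :: real"
  obtain i where i: "i \<in> I" using card_I by fastforce
  have z: "{?z} = PiE I (\<lambda>i. {0})" by (auto simp: PiE_def extensional_def fun_eq_iff)
  have "emeasure L {?z} = (\<Prod>i\<in>I. emeasure lborel {0::real})"
    unfolding z using finite_I by (subst lborel_PiM.emeasure_PiM) auto
  also have "\<dots> = 0" using i finite_I by (auto simp: card_gt_0_iff)
  finally have "emeasure L {?z} = 0" .
  moreover have "{?z} \<in> sets L" unfolding z using finite_I by (intro sets_PiM_I_finite) auto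
  ultimately have "AE x in L. x \<noteq> ?z"
    by (intro AE_I[of _ _ "{?z}"]) auto
  moreover have "AE x in L. x \<in> extensional I"
    by (rule AE_I2) simp
  ultimately show ?thesis
  proof eventually_elim
    case (elim x)
    have "\<exists>j\<in>I. x j \<noteq> 0"
    proof (rule ccontr)
      assume "\<not> (\<exists>j\<in>I. x j \<noteq> 0)"
      then have "x = ?z" using elim(2) by (intro extensionalityI[of _ I]) simp_all
      then show False using elim(1) by (rule notE[rotated])
    qed
    then have "H x \<noteq> 0" using H_eq_0 by meson
    then show ?case using H_nonneg[of x] by (simp only: less_le not_False_eq_True simp_thms) 
  qed
qed

lemma AE_nrm_shell: "AE x in L. nrm x \<in> S"
  using AE_H_pos
proof eventually_elim
  case (elim x)
  then show ?case by (simp add: energy_shell_def H_nrm) (simp add: nrm_def)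
qed

lemma AE_distr_shell: "AE x in distr gibbs BI nrm. x \<in> S"
proof (subst AE_distr_iff)
  have "{x \<in> space BI. x \<in> S} = S" by (auto simp: energy_shell_def)
  with shell_sets show "{x \<in> space BI. x \<in> S} \<in> sets BI" by (simp only:)
  show "nrm \<in> measurable gibbs BI" unfolding measurable_gibbs by (rule nrm_measurable)
  show "AE x in gibbs. nrm x \<in> S"
    unfolding gibbs_def using AE_nrm_shell by (subst AE_density) auto
qed

lemma emeasure_sigma:
  assumes [measurable]: "B \<in> sets BI"
  shows "emeasure sigma B = (\<integral>\<^sup>+x. ennreal (exp (- \<beta> * H x) * (gradient_norm I H (nrm x) * indicator B (nrm x))) \<partial>L) / K"
proof -
  have gn: "gradient_norm I H x \<ge> 0" for x by (simp add: gradient_norm_H sum_nonneg)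
  have "emeasure sigma B = (\<integral>\<^sup>+x. ennreal (exp (- \<beta> * H x)) * (ennreal (gradient_norm I H (nrm x)) / K * indicator B (nrm x)) \<partial>L)"
    unfolding sigma_def gibbs_def
    by (subst emeasure_density) (auto simp: nn_integral_distr nn_integral_density)
  also have "\<dots> = (\<integral>\<^sup>+x. ennreal (exp (- \<beta> * H x) * (gradient_norm I H (nrm x) * indicator B (nrm x))) / K \<partial>L)"
    by (intro nn_integral_cong)
      (auto simp: indicator_def ennreal_mult gn divide_ennreal_def mult_ac)
  also have "\<dots> = (\<integral>\<^sup>+x. ennreal (exp (- \<beta> * H x) * (gradient_norm I H (nrm x) * indicator B (nrm x))) \<partial>L) / K"
    by (subst nn_integral_divide) auto
  finally show ?thesis .
qed

text \<open>Implicit differentiation of \<open>H (x', g x') = E\<close> gives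
  \<open>grad i = - grad k * \<partial>\<^sub>i g\<close>. So \<open>grad k = 0\<close> would make
  the whole gradient vanish, against Euler's identity, and
  \<open>sqrt (1 + |\<nabla>g|\<^sup>2) / |\<nabla>H|\<close> is
  \<open>1 / |grad k|\<close>.\<close>

lemma graph_gradient:
  assumes k: "k \<in> I" and g: "C1_on (I - {k}) (open_box (I - {k}) a b) g"
    and sub: "(\<lambda>x. x(k := g x)) ` open_box (I - {k}) a b \<subseteq> S"
    and z: "z \<in> open_box (I - {k}) a b"
  defines "x \<equiv> z(k := g z)"
  shows "grad k x \<noteq> 0"
    "gradient_norm I H x = \<bar>grad k x\<bar> * sqrt (1 + (gradient_norm (I - {k}) g z)\<^sup>2)"
proof -
  let ?J = "I - {k}"
  have rel: "grad i x + grad k x * partial_deriv i g z = 0" if i: "i \<in> ?J" for i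
  proof -
    have "(\<lambda>t. g (z(i := t))) field_differentiable at (z i)"
      using g i z by (auto simp: C1_on_def)
    then have dg: "((\<lambda>t. g (z(i := t))) has_real_derivative partial_deriv i g z) (at (z i))"
      unfolding partial_deriv_def by (simp add: DERIV_deriv_iff_field_differentiable)
    let ?w = "\<lambda>t. (z(i := t))(k := g (z(i := t)))"
    \<comment> \<open>Velocity of the curve that moves coordinate \<open>i\<close> and lets
      coordinate \<open>k\<close> follow the graph.\<close>
    define d where "d = (\<lambda>j. if j = k then partial_deriv i g z else if j = i then 1 else 0 :: real)"
    have "((\<lambda>t. ?w t j) has_real_derivative d j) (at (z i))" for j
    proof (cases "j = k")
      case True
      then show ?thesis using dg by (simp add: d_def)
    next
      case False
      then have w: "?w t j = (if j = i then t else z j)" for t by simp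
      show ?thesis unfolding w using False by (cases "j = i") (simp_all add: d_def)
    qed
    then have D0: "((\<lambda>t. H (?w t)) has_real_derivative (\<Sum>j\<in>I. grad j (?w (z i)) * d j)) (at (z i))"
      by (rule H_has_derivative_along)
    have "grad j (?w (z i)) * d j = (if j = k then grad k x * partial_deriv i g z else 0) + (if j = i then grad i x else 0)" for j
      using i by (simp add: x_def d_def)
    then have "(\<Sum>j\<in>I. grad j (?w (z i)) * d j) = grad i x + grad k x * partial_deriv i g z"
      using i k finite_I by (simp add: sum.distrib)
    with D0 have D: "((\<lambda>t. H (?w t)) has_real_derivative grad i x + grad k x * partial_deriv i g z) (at (z i))"
      by (rule DERIV_cong)
    have "z i \<in> {a i<..<b i}" by (rule PiE_mem[OF z[unfolded open_box_def] i])
    \<comment> \<open>The box is open, so the curve stays on the graph, hence on the shell, for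
      \<open>t\<close> near \<open>z i\<close>: the energy is locally constant along it.\<close>
    then have "eventually (\<lambda>t. t \<in> {a i<..<b i}) (nhds (z i))"
      by (intro eventually_nhds_in_open) auto
    then have "eventually (\<lambda>t. H (?w t) = E) (nhds (z i))"
    proof eventually_elim
      case (elim t)
      then have "z(i := t) \<in> open_box ?J a b"
        using PiE_fun_upd[of t "\<lambda>i. {a i<..<b i}" i z ?J] z i unfolding open_box_def by (simp add: insert_absorb)
      then have "?w t \<in> S" by (rule subsetD[OF sub imageI])
      then show ?case by (simp add: energy_shell_def)
    qed
    then have "((\<lambda>t. H (?w t)) has_real_derivative 0) (at (z i)) = ((\<lambda>t. E) has_real_derivative 0) (at (z i))"
      by (intro DERIV_cong_ev) auto
    then have "((\<lambda>t. H (?w t)) has_real_derivative 0) (at (z i))" by simp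
    from DERIV_unique[OF D this] show ?thesis .
  qed
  have xS: "H x = E" using sub z by (auto simp: x_def energy_shell_def)
  show nz: "grad k x \<noteq> 0"
  proof
    assume 0: "grad k x = 0"
    then have "grad i x = 0" if "i \<in> I" for i using rel[of i] that by (cases "i = k") auto
    then have "2 * H x = 0" using grad_euler[of x] by simp
    then show False using xS E_pos by simp
  qed
  have "(\<Sum>i\<in>I. (grad i x)\<^sup>2) = (grad k x)\<^sup>2 + (\<Sum>i\<in>?J. (grad k x)\<^sup>2 * (partial_deriv i g z)\<^sup>2)"
  proof -
    have "(\<Sum>i\<in>?J. (grad i x)\<^sup>2) = (\<Sum>i\<in>?J. (grad k x)\<^sup>2 * (partial_deriv i g z)\<^sup>2)"
    proof (rule sum.cong[OF refl])
      fix i assume "i \<in> ?J"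
      then have "grad i x = - (grad k x * partial_deriv i g z)" using rel by (simp add: eq_neg_iff_add_eq_0)
      then show "(grad i x)\<^sup>2 = (grad k x)\<^sup>2 * (partial_deriv i g z)\<^sup>2" by (simp add: power_mult_distrib)
    qed
    then show ?thesis using k finite_I by (simp add: sum.remove)
  qed
  also have "\<dots> = (grad k x)\<^sup>2 * (1 + (gradient_norm ?J g z)\<^sup>2)"
    by (simp add: gradient_norm_def sum_nonneg distrib_left sum_distrib_left)
  finally show "gradient_norm I H x = \<bar>grad k x\<bar> * sqrt (1 + (gradient_norm ?J g z)\<^sup>2)"
    by (simp add: gradient_norm_H real_sqrt_mult)
qed

text \<open>The graph \<open>g\<close> is arbitrary, whereas \<open>polar_sheet\<close> handles one
  side of the vertex. As \<open>grad k\<close> never vanishes on the graph, a Borel piece splits by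
  its sign, and each half lies on one explicit sheet.\<close>

lemma is_surface_measure_sigma: "is_surface_measure I S sigma"
  unfolding is_surface_measure_def
proof (intro conjI ballI allI impI)
  show "sets sigma = sets BI" by simp
  show "AE x in sigma. x \<in> S"
    unfolding sigma_def using AE_distr_shell by (subst AE_density) auto
  fix k a b g B
  assume k: "k \<in> I" and g: "C1_on (I - {k}) (open_box (I - {k}) a b) g"
    and sub: "(\<lambda>x. x(k := g x)) ` open_box (I - {k}) a b \<subseteq> S"
    and B: "B \<in> sets sigma" "B \<subseteq> (\<lambda>x. x(k := g x)) ` open_box (I - {k}) a b"
  let ?J = "I - {k}"
  let ?LJ = "PiM ?J (\<lambda>_. lborel :: real measure)" and ?BJ = "PiM ?J (\<lambda>_. borel :: real measure)"
  let ?U = "open_box ?J a b"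
  have [measurable]: "B \<in> sets BI" using B by simp
  define Bs where "Bs = (\<lambda>s::real. {x \<in> B. s * grad k x > 0})"
  have Bs_eq: "Bs s = B \<inter> {x \<in> space BI. s * grad k x > 0}" for s
    using sets.sets_into_space[OF \<open>B \<in> sets BI\<close>] by (auto simp: Bs_def)
  have [measurable]: "Bs s \<in> sets BI" for s
    unfolding Bs_eq by measurable
  define F where "F = (\<lambda>s x. gradient_norm I H x * indicator (Bs s) x :: real)"
  have F_meas[measurable]: "F s \<in> borel_measurable BI" for s unfolding F_def by measurable
  have gn: "gradient_norm I H x \<ge> 0" for x by (simp add: gradient_norm_H sum_nonneg)
  have F_nonneg: "F s x \<ge> 0" for s x using gn by (simp add: F_def)
  have polar: "(\<integral>\<^sup>+x. ennreal (exp (- \<beta> * H x) * F s (nrm x)) \<partial>L) =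
      K * (\<integral>\<^sup>+z. ennreal (F s (sheet k s z) * sheet_density k z) \<partial>?LJ)" if "s = 1 \<or> s = -1" for s
    by (rule polar_sheet[OF k that F_meas F_nonneg]) (auto simp: F_def Bs_def)
  have B_nonzero: "grad k x \<noteq> 0" if "x \<in> B" for x
    using that B(2) graph_gradient(1)[OF k g sub] by auto
  have B_split: "indicator B x = (indicator (Bs 1) x + indicator (Bs (-1)) x :: real)" for x
    using B_nonzero[of x] by (auto simp: Bs_def indicator_def)
  have [measurable]: "sheet k s \<in> measurable ?BJ BI" for s by (rule sheet_measurable[OF k])
  have [measurable]: "sheet_density k \<in> borel_measurable ?BJ" by (rule sheet_density_measurable[OF k])
  have dens: "ennreal (F s (sheet k s z) * sheet_density k z) =
      ennreal (sqrt (1 + (gradient_norm ?J g z)\<^sup>2)) * indicator {z \<in> ?U. z(k := g z) \<in> Bs s} z"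
    if s: "s = 1 \<or> s = -1" and z: "z \<in> extensional ?J" for s z
  proof (cases "z \<in> ?U \<and> z(k := g z) \<in> Bs s")
    case True
    then have zU: "z \<in> ?U" and zB: "z(k := g z) \<in> Bs s" by auto
    then have "H (z(k := g z)) = E" using sub by (auto simp: energy_shell_def)
    moreover have "s * grad k (z(k := g z)) > 0" using zB by (simp add: Bs_def)
    ultimately have p: "profile k z < E" and gz: "g z = vertex k z + s * sqrt ((E - profile k z) / A k k)"
      using sheet_eq[OF k s] by blast+
    have sh: "sheet k s z = z(k := g z)" by (simp add: sheet_def gz)
    have gr: "\<bar>grad k (sheet k s z)\<bar> = 2 * sqrt (A k k * (E - profile k z))"
      using sheet_grad[OF k, of z E s] p s diag_pos[OF k] by (auto simp: sheet_def abs_mult)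
    have pos: "A k k * (E - profile k z) > 0" using p diag_pos[OF k] by simp
    have "F s (sheet k s z) * sheet_density k z = sqrt (1 + (gradient_norm ?J g z)\<^sup>2)"
      using graph_gradient(2)[OF k g sub zU] zB p gr pos diag_pos[OF k]
      by (simp add: F_def sheet_density_def sh)
    then show ?thesis using True by simp
  next
    case False
    \<comment> \<open>If the sheet point over \<open>z\<close> were in \<open>B\<close>, it would be
      a graph point over some \<open>w\<close>; agreement off \<open>k\<close> forces
      \<open>w = z\<close>, so the graph passes through it.\<close>
    have "F s (sheet k s z) * sheet_density k z = 0"
    proof (rule ccontr)
      assume nz: "F s (sheet k s z) * sheet_density k z \<noteq> 0"
      then have "sheet k s z \<in> Bs s" by (auto simp: F_def indicator_def split: if_splits)
      then have "sheet k s z \<in> B" by (simp add: Bs_def)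
      then obtain w where w: "w \<in> ?U" "sheet k s z = w(k := g w)" using B(2) by blast
      have "w = z"
      proof
        fix i show "w i = z i"
        proof (cases "i \<in> ?J")
          case True
          then show ?thesis using fun_cong[OF w(2), of i] by (simp add: sheet_def)
        next
          case False
          then show ?thesis using z w(1) by (auto simp: open_box_def PiE_def extensional_def)
        qed
      qed
      then show False using False w \<open>sheet k s z \<in> Bs s\<close> by auto
    qed
    then show ?thesis using False by auto
  qed
  have "emeasure sigma B = (\<integral>\<^sup>+x. ennreal (exp (- \<beta> * H x) * F 1 (nrm x)) + ennreal (exp (- \<beta> * H x) * F (-1) (nrm x)) \<partial>L) / K"
    unfolding emeasure_sigma[OF \<open>B \<in> sets BI\<close>] B_split
    by (intro arg_cong[where f="\<lambda>x. x / K"] nn_integral_cong)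
       (simp add: F_def distrib_left gn flip: ennreal_plus)
  also have "(\<integral>\<^sup>+x. ennreal (exp (- \<beta> * H x) * F 1 (nrm x)) + ennreal (exp (- \<beta> * H x) * F (-1) (nrm x)) \<partial>L) =
     K * ((\<integral>\<^sup>+z. ennreal (F 1 (sheet k 1 z) * sheet_density k z) \<partial>?LJ) + (\<integral>\<^sup>+z. ennreal (F (-1) (sheet k (-1) z) * sheet_density k z) \<partial>?LJ))"
    using polar[of 1] polar[of "-1"] by (subst nn_integral_add) (auto simp: distrib_left)
  \<comment> \<open>Cancelling \<open>K\<close> in \<open>ennreal\<close> uses that it is neither 0
    nor infinite.\<close>
  also have "\<dots> / K = (\<integral>\<^sup>+z. ennreal (F 1 (sheet k 1 z) * sheet_density k z) \<partial>?LJ) + (\<integral>\<^sup>+z. ennreal (F (-1) (sheet k (-1) z) * sheet_density k z) \<partial>?LJ)"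
    using K_finite K_nonzero by (simp add: ennreal_mult_divide_eq mult.commute[of K])
  also have "\<dots> = (\<integral>\<^sup>+z. ennreal (F 1 (sheet k 1 z) * sheet_density k z) + ennreal (F (-1) (sheet k (-1) z) * sheet_density k z) \<partial>?LJ)"
    by (rule nn_integral_add[symmetric]) auto
  also have "\<dots> = (\<integral>\<^sup>+z. ennreal (sqrt (1 + (gradient_norm ?J g z)\<^sup>2)) * indicator {z \<in> ?U. z(k := g z) \<in> B} z \<partial>?LJ)"
  proof (rule nn_integral_cong)
    fix z assume "z \<in> space ?LJ"
    then have z: "z \<in> extensional ?J" by simp
    have "indicator {z \<in> ?U. z(k := g z) \<in> B} z = (indicator {z \<in> ?U. z(k := g z) \<in> Bs 1} z + indicator {z \<in> ?U. z(k := g z) \<in> Bs (-1)} z :: ennreal)"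
      using B_nonzero[of "z(k := g z)"] by (auto simp: Bs_def indicator_def)
    then show "ennreal (F 1 (sheet k 1 z) * sheet_density k z) + ennreal (F (-1) (sheet k (-1) z) * sheet_density k z) =
       ennreal (sqrt (1 + (gradient_norm ?J g z)\<^sup>2)) * indicator {z \<in> ?U. z(k := g z) \<in> B} z"
      using dens[OF _ z, of 1] dens[OF _ z, of "-1"] by (simp add: distrib_left)
  qed
  finally show "emeasure sigma B = (\<integral>\<^sup>+z. ennreal (sqrt (1 + (gradient_norm ?J g z)\<^sup>2)) * indicator {z \<in> ?U. z(k := g z) \<in> B} z \<partial>?LJ)" .
qed

end

section \<open>Uniqueness of the surface measure\<close>

text \<open>Agreement on all measurable subsets of each piece passes to smaller pieces, so the
  enumerated cover is made disjoint and the contributions are summed.\<close>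

lemma measure_eqI_countable_cover:
  assumes sets: "sets M = sets N" and count: "countable \<P>" and P: "\<P> \<subseteq> sets M"
    and M: "AE x in M. x \<in> \<Union>\<P>" and N: "AE x in N. x \<in> \<Union>\<P>"
    and eq: "\<And>P B. P \<in> \<P> \<Longrightarrow> B \<in> sets M \<Longrightarrow> B \<subseteq> P \<Longrightarrow> emeasure M B = emeasure N B"
  shows "M = N"
proof (rule measure_eqI)
  fix B assume B: "B \<in> sets M"
  \<comment> \<open>Adding the empty set makes the family nonempty, so that it can be enumerated by
    \<open>nat\<close>.\<close>
  define f where "f = from_nat_into (insert {} \<P>)"
  have ran: "range f = insert {} \<P>"
    unfolding f_def using count by (intro range_from_nat_into) auto
  then have f_sets: "range f \<subseteq> sets M" using P by auto
  let ?D = "\<lambda>n. B \<inter> disjointed f n"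
  have D_sets: "range ?D \<subseteq> sets M"
    using sets.range_disjointed_sets[OF f_sets] B by auto
  have disj: "disjoint_family ?D"
    using disjoint_family_disjointed[of f] by (auto simp: disjoint_family_on_def)
  have UD: "(\<Union>n. ?D n) = B \<inter> \<Union>\<P>"
  proof -
    have "(\<Union>n. ?D n) = B \<inter> (\<Union>n. disjointed f n)" by auto
    also have "(\<Union>n. disjointed f n) = \<Union>(range f)" by (rule UN_disjointed_eq)
    also have "\<dots> = \<Union>\<P>" unfolding ran by simp
    finally show ?thesis .
  qed
  have UD_sets: "B \<inter> \<Union>\<P> \<in> sets M" unfolding UD[symmetric] by (rule sets.countable_UN[OF D_sets])
  have D_eq: "emeasure M (?D n) = emeasure N (?D n)" for n
  proof -
    have "?D n \<subseteq> f n" using disjointed_subset[of f n] by auto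
    moreover have "f n \<in> insert {} \<P>" using ran by auto
    moreover have "?D n \<in> sets M" using D_sets by auto
    ultimately show ?thesis using eq[of "f n" "?D n"] by auto
  qed
  have "emeasure M B = emeasure M (B \<inter> \<Union>\<P>)"
    using M B UD_sets by (intro emeasure_eq_AE) auto
  also have "\<dots> = (\<Sum>n. emeasure M (?D n))"
    unfolding UD[symmetric] by (rule suminf_emeasure[OF D_sets disj, symmetric])
  also have "\<dots> = (\<Sum>n. emeasure N (?D n))" by (simp only: D_eq)
  also have "\<dots> = emeasure N (B \<inter> \<Union>\<P>)"
    unfolding UD[symmetric] using D_sets sets by (intro suminf_emeasure disj) auto
  also have "\<dots> = emeasure N B"
    using N B UD_sets sets by (intro emeasure_eq_AE) auto
  finally show "emeasure M B = emeasure N B" .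
qed (rule sets)

lemma continuous_on_coordinate [continuous_intros]:
  "continuous_on U (\<lambda>x :: 'i \<Rightarrow> real. x i)"
  by (rule continuous_on_subset[OF continuous_on_product_coordinates]) simp

lemma open_boxD:
  assumes "z \<in> open_box J a b"
  shows "i \<in> J \<Longrightarrow> a i < z i" "i \<in> J \<Longrightarrow> z i < b i" "i \<notin> J \<Longrightarrow> z i = undefined"
  using PiE_mem[OF assms[unfolded open_box_def], of i] PiE_arb[OF assms[unfolded open_box_def], of i] by auto

lemma restrict_fun_upd_same:
  assumes "x \<in> extensional I" shows "(restrict x (I - {k}))(k := x k) = x"
proof
  fix i show "((restrict x (I - {k}))(k := x k)) i = x i"
    using assms by (cases "i = k"; cases "i \<in> I") (simp_all add: extensional_def)
qed

text \<open>Rational corners make the later cover of the shell countable. Openness refers to the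
  full function space; outside \<open>J\<close> all points of a box share the value
  \<open>undefined\<close>.\<close>

lemma rational_open_box:
  fixes U :: "('i \<Rightarrow> real) set"
  assumes "open U" "x \<in> U" "x \<in> extensional J"
  obtains a b where "a \<in> PiE J (\<lambda>_. \<rat>)" "b \<in> PiE J (\<lambda>_. \<rat>)" "x \<in> open_box J a b" "open_box J a b \<subseteq> U"
proof -
  have "openin (product_topology (\<lambda>_. euclidean) UNIV) U"
    using assms(1) by (simp add: open_fun_def)
  from product_topology_open_contains_basis[OF this assms(2)]
  obtain X where X: "x \<in> (\<Pi>\<^sub>E i\<in>UNIV. X i)" "\<And>i. open (X i)" "(\<Pi>\<^sub>E i\<in>UNIV. X i) \<subseteq> U"
    by auto
  have "\<exists>a\<in>\<rat>. \<exists>b\<in>\<rat>. x i \<in> {a<..<b} \<and> {a<..<b} \<subseteq> X i" for i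
  proof -
    have "x i \<in> X i" using X(1) by auto
    then obtain e where e: "e > 0" "ball (x i) e \<subseteq> X i"
      using X(2)[of i] open_contains_ball by blast
    obtain a where a: "a \<in> \<rat>" "x i - e < a" "a < x i" using Rats_dense_in_real[of "x i - e" "x i"] e by auto
    obtain b where b: "b \<in> \<rat>" "x i < b" "b < x i + e" using Rats_dense_in_real[of "x i" "x i + e"] e by auto
    have "{a<..<b} \<subseteq> ball (x i) e" using a b by (auto simp: dist_real_def)
    then show ?thesis using a b e by (intro bexI[of _ a] bexI[of _ b]) auto
  qed
  then obtain a b where ab: "\<And>i. a i \<in> \<rat>" "\<And>i. b i \<in> \<rat>" "\<And>i. x i \<in> {a i<..<b i}" "\<And>i. {a i<..<b i} \<subseteq> X i"
    by metis
  have box: "open_box J (restrict a J) (restrict b J) = open_box J a b"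
    unfolding open_box_def by (intro PiE_cong) simp
  have "open_box J a b \<subseteq> U"
  proof
    fix y assume y: "y \<in> open_box J a b"
    have "y i \<in> X i" for i
    proof (cases "i \<in> J")
      case True
      then show ?thesis using y ab(4)[of i] by (auto simp: open_box_def)
    next
      case False
      then have "y i = x i" using y assms(3) by (simp add: open_box_def PiE_def extensional_def)
      then show ?thesis using X(1) by auto
    qed
    then show "y \<in> U" using X(3) by auto
  qed
  moreover have "x \<in> open_box J a b" using ab(3) assms(3) by (auto simp: open_box_def PiE_def)
  ultimately show ?thesis using ab(1,2) by (intro that[of "restrict a J" "restrict b J"]) (auto simp: box)
qed

context pos_quadratic_energy
begin

lemma continuous_on_vertex: "continuous_on U (vertex k)"
  unfolding vertex_def[abs_def] divide_inverse by (intro continuous_intros)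

lemma continuous_on_vertex_upd: "continuous_on U (\<lambda>x. (x(k := vertex k x)) i)"
  using continuous_on_vertex continuous_on_coordinate by (cases "i = k") auto

lemma continuous_on_profile: "continuous_on U (profile k)"
  unfolding profile_def[abs_def] quadratic_form_def
  by (intro continuous_intros continuous_on_vertex_upd)

lemma sheet_partial_deriv:
  assumes k: "k \<in> I" and i: "i \<in> I - {k}" and z: "profile k z < E"
  shows "((\<lambda>t. vertex k (z(i := t)) + s * sqrt ((E - profile k (z(i := t))) / A k k)) has_real_derivative
    - A k i / A k k - s * (grad i (z(k := vertex k z)) / A k k / (2 * sqrt ((E - profile k z) / A k k)))) (at (z i))"
proof -
  have a: "A k k > 0" by (rule diag_pos[OF k])
  have dv: "((\<lambda>t. vertex k (z(i := t))) has_real_derivative - A k i / A k k) (at (z i))"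
  proof -
    have "((\<lambda>t. vertex k (z(i := t))) has_real_derivative - (\<Sum>j\<in>I - {k}. A k j * (if j = i then 1 else 0)) / A k k) (at (z i))"
      unfolding vertex_def by (intro DERIV_cdivide DERIV_minus DERIV_sum DERIV_cmult) auto
    also have "(\<Sum>j\<in>I - {k}. A k j * (if j = i then 1 else 0)) = (\<Sum>j\<in>I - {k}. if j = i then A k i else 0)"
      by (intro sum.cong refl) auto
    also have "\<dots> = A k i" using i finite_I by simp
    finally show ?thesis .
  qed
  \<comment> \<open>Envelope argument: moving \<open>z i\<close> also moves the vertex, but in
    direction \<open>k\<close>, where the derivative of the form vanishes at the vertex.\<close>
  have dp: "((\<lambda>t. profile k (z(i := t))) has_real_derivative grad i (z(k := vertex k z))) (at (z i))"
  proof -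
    let ?w = "\<lambda>t. (z(i := t))(k := vertex k (z(i := t)))"
    have "((\<lambda>t. H (?w t)) has_real_derivative
        (\<Sum>j\<in>I. grad j (?w (z i)) * (if j = k then - A k i / A k k else if j = i then 1 else 0))) (at (z i))"
    proof (rule H_has_derivative_along)
      fix j assume "j \<in> I"
      show "((\<lambda>t. ?w t j) has_real_derivative (if j = k then - A k i / A k k else if j = i then 1 else 0)) (at (z i))"
      proof (cases "j = k")
        case True
        then show ?thesis using dv by (simp only: fun_upd_same if_True simp_thms)
      next
        case False
        then have w: "?w t j = (if j = i then t else z j)" for t by simp
        show ?thesis unfolding w using False by (cases "j = i") simp_all
      qed
    qed
    also have "?w (z i) = z(k := vertex k z)" by simp
    also have "(\<Sum>j\<in>I. grad j (z(k := vertex k z)) * (if j = k then - A k i / A k k else if j = i then 1 else 0)) =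
      (\<Sum>j\<in>I. if j = i then grad i (z(k := vertex k z)) else 0)"
      using i k grad_upd[OF k, of z "vertex k z"] by (intro sum.cong refl) auto
    also have "\<dots> = grad i (z(k := vertex k z))" using i finite_I by simp
    finally show ?thesis unfolding profile_def .
  qed
  have "(E - profile k z) / A k k > 0" using z a by simp
  then have "((\<lambda>t. sqrt ((E - profile k (z(i := t))) / A k k)) has_real_derivative
     (0 - grad i (z(k := vertex k z))) / A k k * (inverse (sqrt ((E - profile k z) / A k k)) / 2)) (at (z i))"
    using DERIV_chain2[OF DERIV_real_sqrt DERIV_cdivide[OF DERIV_diff[OF DERIV_const dp]], of E "A k k"]
    by (simp add: mult.commute)
  from DERIV_add[OF dv DERIV_cmult[OF this, of s]]
  show ?thesis by (rule DERIV_cong) (simp add: field_simps)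
qed

lemma C1_on_sheet:
  assumes k: "k \<in> I" and U: "U \<subseteq> {z. profile k z < E}"
  shows "C1_on (I - {k}) U (\<lambda>z. vertex k z + s * sqrt ((E - profile k z) / A k k))"
proof -
  have a: "A k k > 0" by (rule diag_pos[OF k])
  have cs: "continuous_on U (\<lambda>z. sqrt ((E - profile k z) / A k k))"
    unfolding divide_inverse by (intro continuous_intros continuous_on_profile)
  have "continuous_on U (\<lambda>z. vertex k z + s * sqrt ((E - profile k z) / A k k))"
    by (intro continuous_intros cs continuous_on_vertex)
  moreover have "(\<lambda>t. vertex k (z(i := t)) + s * sqrt ((E - profile k (z(i := t))) / A k k)) field_differentiable at (z i)"
    if "i \<in> I - {k}" "z \<in> U" for i z
    using sheet_partial_deriv[OF k that(1)] U that(2) unfolding field_differentiable_def by blast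
  moreover have "continuous_on U (partial_deriv i (\<lambda>z. vertex k z + s * sqrt ((E - profile k z) / A k k)))"
    if i: "i \<in> I - {k}" for i
  proof -
    have "continuous_on U (\<lambda>z. - A k i / A k k - s * (grad i (z(k := vertex k z)) / A k k / (2 * sqrt ((E - profile k z) / A k k))))"
      unfolding grad_def using a U
      by (intro continuous_intros cs continuous_on_vertex_upd) auto
    moreover have "partial_deriv i (\<lambda>z. vertex k z + s * sqrt ((E - profile k z) / A k k)) z =
       - A k i / A k k - s * (grad i (z(k := vertex k z)) / A k k / (2 * sqrt ((E - profile k z) / A k k)))"
      if "z \<in> U" for z
      unfolding partial_deriv_def using sheet_partial_deriv[OF k i] U that
      by (intro DERIV_imp_deriv) auto
    ultimately show ?thesis by (simp cong: continuous_on_cong)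
  qed
  ultimately show ?thesis unfolding C1_on_def by blast
qed

text \<open>The sheet is inverted by restriction, so its image is cut out by coordinate bounds, the
  energy equation and the sign of \<open>grad k\<close>, all of them visibly Borel
  conditions.\<close>

lemma sheet_image_sets:
  assumes k: "k \<in> I" and s: "s = 1 \<or> s = -1" and U: "open_box (I - {k}) a b \<subseteq> {z. profile k z < E}"
  shows "sheet k s ` open_box (I - {k}) a b \<in> sets BI"
proof -
  let ?J = "I - {k}"
  have "sheet k s ` open_box ?J a b = {x \<in> space BI. (\<forall>i\<in>?J. a i < x i \<and> x i < b i) \<and> H x = E \<and> s * grad k x > 0}"
    (is "_ = ?R")
  proof (intro equalityI subsetI)
    fix x assume "x \<in> sheet k s ` open_box ?J a b"
    then obtain z where z: "z \<in> open_box ?J a b" "x = sheet k s z" by blast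
    have p: "profile k z < E" using U z by auto
    have "A k k * (E - profile k z) > 0" using p diag_pos[OF k] by simp
    then have "s * grad k x > 0"
      unfolding z sheet_def using sheet_grad[OF k, of z E s] p s by auto
    moreover have "H x = E" unfolding z sheet_def using p by (intro sheet_H k s) simp
    moreover have "\<forall>i\<in>?J. a i < x i \<and> x i < b i" using open_boxD(1,2)[OF z(1)] by (simp add: z(2) sheet_def)
    moreover have "x \<in> extensional I" using open_boxD(3)[OF z(1)] k by (simp add: z(2) sheet_def extensional_def)
    ultimately show "x \<in> ?R" by simp
  next
    fix x assume x: "x \<in> ?R"
    let ?z = "restrict x ?J"
    have ext: "x \<in> extensional I" using x by simp
    have upd: "?z(k := x k) = x" by (rule restrict_fun_upd_same[OF ext])
    have "x k = vertex k ?z + s * sqrt ((E - profile k ?z) / A k k)"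
      by (rule sheet_eq(2)[OF k s]) (use x in \<open>simp_all only: upd mem_Collect_eq\<close>)
    then have "sheet k s ?z = x" unfolding sheet_def using upd by simp
    moreover have "?z \<in> open_box ?J a b" using x by (auto simp: open_box_def)
    ultimately show "x \<in> sheet k s ` open_box ?J a b" by (metis imageI)
  qed
  also have "?R = {x \<in> space BI. \<forall>i\<in>?J. a i < x i \<and> x i < b i} \<inter> {x \<in> space BI. 0 < s * grad k x} \<inter> S"
    by (auto simp: energy_shell_def)
  also have "\<dots> \<in> sets BI"
  proof (intro sets.Int shell_sets)
    show "{x \<in> space BI. \<forall>i\<in>?J. a i < x i \<and> x i < b i} \<in> sets BI"
    proof (intro sets.sets_Collect_finite_All)
      fix i assume "i \<in> ?J"
      then have [measurable]: "(\<lambda>x. x i) \<in> borel_measurable BI"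
        by (intro measurable_component_singleton) auto
      show "{x \<in> space BI. a i < x i \<and> x i < b i} \<in> sets BI" by measurable
    qed (use finite_I in simp)
    show "{x \<in> space BI. 0 < s * grad k x} \<in> sets BI" by measurable
  qed
  finally show ?thesis .
qed

text \<open>On every Borel subset of a sheet over a box the definition prescribes the value of a
  surface measure. The sheets over rational boxes are countably many, and they cover the shell
  because some partial derivative is nonzero at each of its points.\<close>

lemma surface_measure_unique:
  assumes "is_surface_measure I S \<mu>" shows "\<mu> = sigma"
proof -
  define Idx where "Idx = {(k, s, a, b). k \<in> I \<and> s \<in> {1, -1 :: real} \<and> a \<in> PiE (I - {k}) (\<lambda>_. \<rat>) \<and> b \<in> PiE (I - {k}) (\<lambda>_. \<rat>)
     \<and> open_box (I - {k}) a b \<subseteq> {z. profile k z < E}}"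
  define patch where "patch = (\<lambda>(k, s, a, b). sheet k s ` open_box (I - {k}) a b)"
  have "Idx \<subseteq> (SIGMA k:I. {1, -1} \<times> (PiE (I - {k}) (\<lambda>_. \<rat>) \<times> PiE (I - {k}) (\<lambda>_. \<rat>)))"
    by (auto simp: Idx_def)
  moreover have "countable (SIGMA k:I. {1, -1 :: real} \<times> (PiE (I - {k}) (\<lambda>_. \<rat> :: real set) \<times> PiE (I - {k}) (\<lambda>_. \<rat> :: real set)))"
    using finite_I by (intro countable_SIGMA countable_PiE countable_rat countable_finite) auto
  ultimately have "countable Idx" by (rule countable_subset)
  have cover: "S \<subseteq> \<Union>(patch ` Idx)"
  proof
    fix x assume "x \<in> S"
    then have ext: "x \<in> extensional I" and Hx: "H x = E" by (auto simp: energy_shell_def)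
    from Hx E_pos have "H x > 0" by simp
    then obtain k where k: "k \<in> I" "grad k x \<noteq> 0" by (rule ex_grad_nonzero)
    define s :: real where "s = (if grad k x > 0 then 1 else -1)"
    have s: "s = 1 \<or> s = -1" "s * grad k x > 0" using k(2) by (auto simp: s_def)
    let ?z = "restrict x (I - {k})"
    have upd: "?z(k := x k) = x" by (rule restrict_fun_upd_same[OF ext])
    have "H (?z(k := x k)) = E" "s * grad k (?z(k := x k)) > 0" using Hx s(2) by (simp_all only: upd)
    note zE = sheet_eq[OF k(1) s(1) this]
    have p: "profile k ?z < E" by (rule zE(1))
    have sh: "sheet k s ?z = x" unfolding sheet_def zE(2)[symmetric] by (rule upd)
    have "open {z. profile k z < E}"
      using continuous_on_profile[of UNIV k] by (intro open_Collect_less) auto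
    then obtain a b where ab: "a \<in> PiE (I - {k}) (\<lambda>_. \<rat>)" "b \<in> PiE (I - {k}) (\<lambda>_. \<rat>)"
        "?z \<in> open_box (I - {k}) a b" "open_box (I - {k}) a b \<subseteq> {z. profile k z < E}"
      using rational_open_box[of "{z. profile k z < E}" ?z "I - {k}"] p by auto
    have "(k, s, a, b) \<in> Idx" using k s ab by (auto simp: Idx_def)
    moreover have "x \<in> patch (k, s, a, b)" using ab(3) sh unfolding patch_def by (simp add: rev_image_eqI)
    ultimately show "x \<in> \<Union>(patch ` Idx)" by blast
  qed
  have \<sigma>: "is_surface_measure I S sigma" by (rule is_surface_measure_sigma)
  have sets: "sets \<mu> = sets BI" using assms by (simp add: is_surface_measure_def)
  show ?thesis
  proof (rule measure_eqI_countable_cover)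
    show "sets \<mu> = sets sigma" using sets by simp
    show "countable (patch ` Idx)" using \<open>countable Idx\<close> by simp
    show "patch ` Idx \<subseteq> sets \<mu>" unfolding sets using sheet_image_sets by (auto simp: Idx_def patch_def)
    have "AE x in \<mu>. x \<in> S" using assms by (simp add: is_surface_measure_def)
    then show "AE x in \<mu>. x \<in> \<Union>(patch ` Idx)" by eventually_elim (use cover in blast)
    have "AE x in sigma. x \<in> S" using \<sigma> by (simp add: is_surface_measure_def)
    then show "AE x in sigma. x \<in> \<Union>(patch ` Idx)" by eventually_elim (use cover in blast)
  next
    fix P B assume P: "P \<in> patch ` Idx" and B: "B \<in> sets \<mu>" "B \<subseteq> P"
    then obtain k s a b where k: "k \<in> I" and s: "s = 1 \<or> s = -1" and U: "open_box (I - {k}) a b \<subseteq> {z. profile k z < E}"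
      and P_eq: "P = sheet k s ` open_box (I - {k}) a b"
      by (auto simp: Idx_def patch_def)
    define g where "g = (\<lambda>z. vertex k z + s * sqrt ((E - profile k z) / A k k))"
    have g: "C1_on (I - {k}) (open_box (I - {k}) a b) g"
      unfolding g_def by (rule C1_on_sheet[OF k U])
    have P': "P = (\<lambda>x. x(k := g x)) ` open_box (I - {k}) a b"
      unfolding P_eq by (simp add: sheet_def[abs_def] g_def)
    have sub: "(\<lambda>x. x(k := g x)) ` open_box (I - {k}) a b \<subseteq> S"
    proof (rule image_subsetI)
      fix z assume z: "z \<in> open_box (I - {k}) a b"
      then have "H (z(k := g z)) = E" unfolding g_def using U by (intro sheet_H k s) auto
      moreover have "z(k := g z) \<in> extensional I" using open_boxD(3)[OF z] k by (simp add: extensional_def)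
      ultimately show "z(k := g z) \<in> S" by (simp add: energy_shell_def)
    qed
    have "emeasure \<nu> B = (\<integral>\<^sup>+x. ennreal (sqrt (1 + (gradient_norm (I - {k}) g x)\<^sup>2)) *
            indicator {x \<in> open_box (I - {k}) a b. x(k := g x) \<in> B} x \<partial>PiM (I - {k}) (\<lambda>_. lborel))"
      if \<nu>: "is_surface_measure I S \<nu>" for \<nu>
    proof -
      have "B \<in> sets \<nu>" using \<nu> B sets by (simp add: is_surface_measure_def)
      with \<nu> k g sub B(2) P' show ?thesis unfolding is_surface_measure_def by blast
    qed
    from this[OF assms] this[OF \<sigma>] show "emeasure \<mu> B = emeasure sigma B" by simp
  qed
qed

lemma surface_measure_eq: "surface_measure I S = sigma"
  unfolding surface_measure_def
  by (rule the_equality[of "is_surface_measure I S", OF is_surface_measure_sigma surface_measure_unique])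

end

section \<open>Normalisation, and the microcanonical measure as an image measure\<close>

context pos_quadratic_form
begin

lemma partition_function_finite:
  assumes "b > 0"
  shows "(\<integral>\<^sup>+x. ennreal (exp (- b * H x)) \<partial>L) < \<infinity>"
proof -
  \<comment> \<open>Chosen so that \<open>1 / (2 * \<sigma>\<^sup>2) = b * c\<close>: coercivity
    then bounds the Gibbs weight by a product of centred normal densities, up to constants.\<close>
  define \<sigma> where "\<sigma> = sqrt (1 / (2 * b * c))"
  have \<sigma>: "\<sigma> > 0" "2 * \<sigma>\<^sup>2 = 1 / (b * c)" using assms c_pos by (auto simp: \<sigma>_def)
  define D where "D = sqrt (2 * pi * \<sigma>\<^sup>2)"
  have D: "D > 0" using \<sigma> by (simp add: D_def)
  have gauss: "exp (- (b * c) * y\<^sup>2) = D * normal_density 0 \<sigma> y" for y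
    using D \<sigma> assms c_pos by (simp add: normal_density_def D_def field_simps)
  have "(\<integral>\<^sup>+x. ennreal (exp (- b * H x)) \<partial>L) \<le> (\<integral>\<^sup>+x. (\<Prod>i\<in>I. ennreal (exp (- (b * c) * (x i)\<^sup>2))) \<partial>L)"
  proof (rule nn_integral_mono)
    fix x
    have "b * (c * (\<Sum>i\<in>I. (x i)\<^sup>2)) \<le> b * H x" using coercive[of x] assms by simp
    then have "exp (- b * H x) \<le> exp (\<Sum>i\<in>I. - (b * c) * (x i)\<^sup>2)"
      by (simp add: sum_distrib_left sum_negf mult_ac)
    also have "\<dots> = (\<Prod>i\<in>I. exp (- (b * c) * (x i)\<^sup>2))" using finite_I by (rule exp_sum)
    finally show "ennreal (exp (- b * H x)) \<le> (\<Prod>i\<in>I. ennreal (exp (- (b * c) * (x i)\<^sup>2)))"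
      by (subst prod_ennreal) (auto intro: ennreal_leI)
  qed
  also have "\<dots> = (\<Prod>i\<in>I. \<integral>\<^sup>+y. ennreal (exp (- (b * c) * y\<^sup>2)) \<partial>lborel)"
    using finite_I by (intro lborel_PiM.product_nn_integral_prod) auto
  also have "(\<integral>\<^sup>+y. ennreal (exp (- (b * c) * y\<^sup>2)) \<partial>lborel) = ennreal D"
  proof -
    have "(\<integral>\<^sup>+y. ennreal (normal_density 0 \<sigma> y) \<partial>lborel) = 1"
      using \<sigma> by (subst nn_integral_eq_integral) auto
    then show ?thesis
      unfolding gauss using D by (simp add: ennreal_mult nn_integral_cmult)
  qed
  also have "(\<Prod>i\<in>I. ennreal D) < \<infinity>"
    using D by (simp add: ennreal_power)
  finally show ?thesis .
qed

lemma partition_function_pos: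
  "(\<integral>\<^sup>+x. ennreal (exp (- b * H x)) \<partial>L) > 0"
proof -
  have "(\<integral>\<^sup>+x. ennreal (exp (- b * H x)) \<partial>L) \<noteq> 0"
  proof
    assume "(\<integral>\<^sup>+x. ennreal (exp (- b * H x)) \<partial>L) = 0"
    then have "AE x in L. False" by (subst (asm) nn_integral_0_iff_AE) (auto simp: ennreal_eq_0_iff not_le[symmetric])
    then have "emeasure L (space L) = 0" by (simp add: AE_iff_null_sets ae_filter_eq_bot_iff trivial_limit_def[symmetric])
    moreover have "emeasure L (space L) \<noteq> 0"
      using lborel_PiM.emeasure_PiM[OF finite_I, of "\<lambda>_. UNIV"] finite_I by (simp add: PiE_UNIV_domain PiE_def prod_ennreal)
    ultimately show False by simp
  qed
  then show ?thesis by (simp add: zero_less_iff_neq_zero)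
qed

end

context pos_quadratic_energy
begin

abbreviation "Zpart \<equiv> (\<integral>\<^sup>+x. ennreal (exp (- \<beta> * H x)) \<partial>L)"

lemma emeasure_gibbs_space: "emeasure gibbs (extensional I) = Zpart"
proof -
  have "emeasure gibbs (space L) = (\<integral>\<^sup>+x. ennreal (exp (- \<beta> * H x)) * indicator (space L) x \<partial>L)"
    unfolding gibbs_def by (rule emeasure_density) (simp, rule sets.top)
  also have "\<dots> = Zpart" by (intro nn_integral_cong) simp
  finally show ?thesis by simp
qed

lemma canonical_measure_eq: "canonical_measure I H \<beta> = density gibbs (\<lambda>_. 1 / Zpart)"
proof -
  have "canonical_measure I H \<beta> = density L (\<lambda>x. ennreal (exp (- \<beta> * H x)) * (1 / Zpart))"
    by (simp add: canonical_measure_def Let_def divide_ennreal_def)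
  also have "\<dots> = density gibbs (\<lambda>_. 1 / Zpart)"
    unfolding gibbs_def by (rule density_density_eq[symmetric]) simp_all
  finally show ?thesis .
qed

lemma prob_space_canonical: "prob_space (canonical_measure I H \<beta>)"
proof (rule prob_spaceI)
  have "emeasure (density gibbs (\<lambda>_. 1 / Zpart)) (space gibbs) = 1 / Zpart * emeasure gibbs (space gibbs)"
    by (rule emeasure_density_const) (rule sets.top)
  then have "emeasure (canonical_measure I H \<beta>) (space (canonical_measure I H \<beta>)) = 1 / Zpart * Zpart"
    by (simp add: canonical_measure_eq emeasure_gibbs_space)
  also have "\<dots> = 1"
    using partition_function_finite[OF \<beta>_pos] partition_function_pos[of \<beta>]
    by (simp add: ennreal_divide_times ennreal_divide_self less_top[symmetric])
  finally show "emeasure (canonical_measure I H \<beta>) (space (canonical_measure I H \<beta>)) = 1" .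
qed

text \<open>The weight \<open>1 / |\<nabla>H|\<close> cancels the factor \<open>|\<nabla>H|\<close>
  built into \<open>sigma\<close>. What remains is the projected Gibbs measure divided by
  \<open>K\<close>, and \<open>K\<close> drops out on normalising.\<close>

lemma microcanonical_eq_distr: "microcanonical_measure I H E = distr (canonical_measure I H \<beta>) BI nrm"
proof -
  let ?D = "distr gibbs BI nrm" and ?gn = "gradient_norm I H"
  let ?w = "\<lambda>x. ennreal (?gn x) / K"
  have Zpart: "Zpart \<noteq> 0" "Zpart \<noteq> \<top>"
    using partition_function_finite[OF \<beta>_pos] partition_function_pos[of \<beta>] by auto
  have K: "K \<noteq> 0" "K \<noteq> \<top>" using K_nonzero K_finite by auto
  have w: "?w x * ennreal (1 / ?gn x) = 1 / K" if "x \<in> S" for x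
  proof -
    have "H x > 0" using that E_pos by (simp add: energy_shell_def)
    then have "?gn x > 0" by (rule gradient_norm_pos)
    then have "ennreal (?gn x) * ennreal (1 / ?gn x) = 1" by (simp flip: ennreal_mult)
    then show ?thesis by (simp add: divide_ennreal_def mult_ac flip: mult.assoc)
  qed
  define c where "c = (\<integral>\<^sup>+x. ennreal (1 / ?gn x) \<partial>sigma)"
  have "c = (\<integral>\<^sup>+x. ?w x * ennreal (1 / ?gn x) \<partial>?D)"
    unfolding c_def sigma_def by (subst nn_integral_density) auto
  also have "\<dots> = (\<integral>\<^sup>+x. 1 / K \<partial>?D)"
  proof (rule nn_integral_cong_AE)
    show "AE x in ?D. ?w x * ennreal (1 / ?gn x) = 1 / K"
      using AE_distr_shell by eventually_elim (rule w)
  qed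
  also have "\<dots> = 1 / K * emeasure gibbs (space gibbs)"
  proof -
    have "nrm -` space BI \<inter> space gibbs = space gibbs" by (auto simp: nrm_def)
    then have "emeasure ?D (space BI) = emeasure gibbs (space gibbs)"
      by (subst emeasure_distr) (simp_all only: measurable_gibbs nrm_measurable sets.top)
    then show ?thesis by simp
  qed
  also have "emeasure gibbs (space gibbs) = Zpart"
    by (simp add: emeasure_gibbs_space)
  finally have c: "c = 1 / K * Zpart" .
  have "microcanonical_measure I H E = density sigma (\<lambda>x. ennreal (1 / ?gn x) / c)"
    by (simp add: microcanonical_measure_def surface_measure_eq Let_def c_def)
  also have "\<dots> = density ?D (\<lambda>x. ?w x * (ennreal (1 / ?gn x) / c))"
    unfolding sigma_def by (rule density_density_eq) auto
  also have "\<dots> = density ?D (\<lambda>_. 1 / Zpart)"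
  proof (rule density_cong)
    show "AE x in ?D. ?w x * (ennreal (1 / ?gn x) / c) = 1 / Zpart"
      using AE_distr_shell
    proof eventually_elim
      case (elim x)
      have "?w x * (ennreal (1 / ?gn x) / c) = (1 / K) / c"
        using w[OF elim] by (simp add: ennreal_times_divide)
      also have "\<dots> = 1 / Zpart"
        using Zpart K unfolding c
        by (cases K; cases Zpart) (auto simp: divide_ennreal ennreal_1[symmetric] simp flip: ennreal_mult simp del: ennreal_1)
      finally show ?case .
    qed
  qed auto
  also have "\<dots> = distr (density gibbs (\<lambda>_. 1 / Zpart)) BI nrm"
    by (rule density_distr) auto
  finally show ?thesis by (simp only: canonical_measure_eq)
qed

end

subsection \<open>Gaussian estimates\<close>

lemma exp_ge_partial_sum:
  fixes y :: real
  assumes "y \<ge> 0"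
  shows "(\<Sum>k<n. y ^ k / fact k) \<le> exp y"
proof -
  have "summable (\<lambda>k. y ^ k / fact k)"
    using summable_exp[of y] by (simp add: divide_inverse mult.commute)
  then have "(\<Sum>k<n. y ^ k / fact k) \<le> (\<Sum>k. y ^ k / fact k)"
    by (rule sum_le_suminf) (use assms in auto)
  also have "\<dots> = exp y" by (simp add: exp_def divide_inverse mult.commute)
  finally show ?thesis .
qed

lemma (in prob_space) integrable_exp_of_nn_integral:
  assumes Y[measurable]: "Y \<in> borel_measurable M"
    and mgf: "(\<integral>\<^sup>+x. ennreal (exp (z * Y x)) \<partial>M) = ennreal m" and "m \<ge> 0"
  shows "integrable M (\<lambda>x. exp (z * Y x))" "expectation (\<lambda>x. exp (z * Y x)) = m"
proof -
  show 1: "integrable M (\<lambda>x. exp (z * Y x))"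
    by (rule integrableI_nonneg) (auto simp: mgf)
  show "expectation (\<lambda>x. exp (z * Y x)) = m"
    using assms by (subst integral_eq_nn_integral) auto
qed

text \<open>
  The complex Laplace transform is entire, so it is determined by its values on the real axis.
\<close>

lemma (in prob_space) gaussian_char_of_mgf:
  assumes Y[measurable]: "Y \<in> borel_measurable M"
    and mgf: "\<And>z :: real. (\<integral>\<^sup>+x. ennreal (exp (z * Y x)) \<partial>M) = ennreal (exp (c * z\<^sup>2))"
  shows "(\<integral>x. iexp (Y x) \<partial>M) = complex_of_real (exp (- c))"
proof -
  note exp_int = integrable_exp_of_nn_integral[OF Y mgf, simplified]
  define F where "F = (\<lambda>z :: complex. \<integral>x. exp (z * complex_of_real (Y x)) \<partial>M)"
  \<comment> \<open>Exponential moments of both signs give one of the modulus, which dominates all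
    terms and partial sums of the series of \<open>exp (z * Y)\<close> for complex
    \<open>z\<close>.\<close>
  have exp_abs: "integrable M (\<lambda>x. exp (r * \<bar>Y x\<bar>))" if "r \<ge> 0" for r
  proof (rule Bochner_Integration.integrable_bound)
    show "integrable M (\<lambda>x. exp (r * Y x) + exp (- r * Y x))"
      by (intro Bochner_Integration.integrable_add exp_int)
    show "AE x in M. norm (exp (r * \<bar>Y x\<bar>)) \<le> norm (exp (r * Y x) + exp (- r * Y x))"
    proof (rule AE_I2)
      fix x
      have "exp (r * \<bar>Y x\<bar>) \<le> exp (r * Y x) + exp (- r * Y x)"
        by (cases "Y x \<ge> 0") (simp_all add: add_increasing add_increasing2)
      also have "\<dots> \<le> \<bar>exp (r * Y x) + exp (- r * Y x)\<bar>" by (rule abs_ge_self)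
      finally show "norm (exp (r * \<bar>Y x\<bar>)) \<le> norm (exp (r * Y x) + exp (- r * Y x))"
        by (simp only: real_norm_def abs_exp_cancel)
    qed
  qed measurable
  \<comment> \<open>Integrating the exponential series term by term exhibits \<open>F\<close> as a
    power series in the moments; this yields holomorphy without differentiating under the
    integral.\<close>
  have sums: "(\<lambda>n. complex_of_real (expectation (\<lambda>x. Y x ^ n) / fact n) * (z - 0) ^ n) sums F z" for z
  proof -
    let ?f = "\<lambda>n x. z ^ n / fact n * complex_of_real (Y x) ^ n"
    have norm_f: "norm (?f n x) = (norm z * \<bar>Y x\<bar>) ^ n / fact n" for n x
      by (simp add: norm_mult norm_divide norm_power power_mult_distrib)
    have le_exp: "(norm z * \<bar>Y x\<bar>) ^ n / fact n \<le> exp (norm z * \<bar>Y x\<bar>)" for n x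
    proof -
      have "(\<Sum>k<Suc n. (norm z * \<bar>Y x\<bar>) ^ k / fact k) \<le> exp (norm z * \<bar>Y x\<bar>)"
        by (rule exp_ge_partial_sum) simp
      moreover have "(norm z * \<bar>Y x\<bar>) ^ n / fact n \<le> (\<Sum>k<Suc n. (norm z * \<bar>Y x\<bar>) ^ k / fact k)"
        by (rule member_le_sum) auto
      ultimately show ?thesis by linarith
    qed
    have int: "integrable M (?f n)" for n
    proof (rule Bochner_Integration.integrable_bound[OF exp_abs[of "norm z"]])
      show "AE x in M. norm (?f n x) \<le> norm (exp (norm z * \<bar>Y x\<bar>))"
        by (rule AE_I2) (simp only: norm_f real_norm_def abs_exp_cancel le_exp)
    qed auto
    have "(\<lambda>n. \<integral>x. ?f n x \<partial>M) sums (\<integral>x. (\<Sum>n. ?f n x) \<partial>M)"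
    proof (rule sums_integral)
      show "AE x in M. summable (\<lambda>n. norm (?f n x))"
        unfolding norm_f using summable_exp[of "norm z * \<bar>Y _\<bar>"] by (auto simp: divide_inverse mult.commute)
      show "summable (\<lambda>n. \<integral>x. norm (?f n x) \<partial>M)"
      proof (rule summableI_nonneg_bounded)
        fix n
        have "(\<Sum>i<n. \<integral>x. norm (?f i x) \<partial>M) = (\<integral>x. (\<Sum>i<n. norm (?f i x)) \<partial>M)"
          by (rule Bochner_Integration.integral_sum[symmetric]) (intro integrable_norm int)
        also have "\<dots> \<le> (\<integral>x. exp (norm z * \<bar>Y x\<bar>) \<partial>M)"
        proof (rule integral_mono)
          show "integrable M (\<lambda>x. \<Sum>i<n. norm (?f i x))"
            by (intro Bochner_Integration.integrable_sum integrable_norm int)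
          show "integrable M (\<lambda>x. exp (norm z * \<bar>Y x\<bar>))" by (rule exp_abs) simp
          show "(\<Sum>i<n. norm (?f i x)) \<le> exp (norm z * \<bar>Y x\<bar>)" for x
            unfolding norm_f by (rule exp_ge_partial_sum) simp
        qed
        finally show "(\<Sum>i<n. \<integral>x. norm (?f i x) \<partial>M) \<le> (\<integral>x. exp (norm z * \<bar>Y x\<bar>) \<partial>M)" .
      qed auto
    qed (rule int)
    moreover have "(\<Sum>n. ?f n x) = exp (z * complex_of_real (Y x))" for x
      by (simp add: exp_def power_mult_distrib scaleR_conv_of_real divide_inverse mult_ac)
    moreover have "(\<integral>x. ?f n x \<partial>M) = complex_of_real (expectation (\<lambda>x. Y x ^ n) / fact n) * (z - 0) ^ n" for n
    proof -
      have "(\<integral>x. ?f n x \<partial>M) = z ^ n / fact n * (\<integral>x. complex_of_real (Y x ^ n) \<partial>M)"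
        by (simp flip: of_real_power)
      then show ?thesis by (simp only: integral_complex_of_real) simp
    qed
    ultimately show ?thesis by (simp only: F_def)
  qed
  have holo: "F holomorphic_on ball 0 2"
    by (rule power_series_holomorphic) (rule sums)
  have F_real: "F (complex_of_real z) = exp (complex_of_real c * (complex_of_real z)\<^sup>2)" for z
  proof -
    have "F (complex_of_real z) = (\<integral>x. complex_of_real (exp (z * Y x)) \<partial>M)"
      by (simp add: F_def flip: of_real_mult exp_of_real)
    also have "\<dots> = complex_of_real (exp (c * z\<^sup>2))"
      by (simp only: integral_complex_of_real exp_int(2))
    finally show ?thesis by (simp flip: exp_of_real)
  qed
  \<comment> \<open>Agreement on the real segment from 0 to 1, which accumulates at 0, extends to
    the disc; radius 2 puts \<open>\<i>\<close> inside it.\<close>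
  have "F \<i> - exp (complex_of_real c * \<i>\<^sup>2) = 0"
  proof (rule analytic_continuation[of "\<lambda>z. F z - exp (complex_of_real c * z\<^sup>2)" "ball 0 2" "complex_of_real ` {0<..<1}" 0 \<i>])
    show "(\<lambda>z. F z - exp (complex_of_real c * z\<^sup>2)) holomorphic_on ball 0 2"
      by (intro holomorphic_intros holo)
    show "complex_of_real ` {0<..<1} \<subseteq> ball 0 2" by auto
    show "0 islimpt complex_of_real ` {0<..<1}"
      unfolding islimpt_approachable
    proof (intro allI impI)
      fix e :: real assume "e > 0"
      then show "\<exists>x'\<in>complex_of_real ` {0<..<1}. x' \<noteq> 0 \<and> dist x' 0 < e"
        by (intro bexI[of _ "complex_of_real (min (e / 2) (1 / 2))"]) auto
    qed
  qed (auto simp: F_real)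
  then show ?thesis by (simp add: F_def flip: exp_of_real)
qed

lemma norm_exp_i_diff_le: "norm (iexp a - iexp b) \<le> \<bar>a - b\<bar>"
proof -
  have "iexp a - iexp b =
      iexp b * (iexp (a - b) - 1)"
    by (simp add: algebra_simps flip: exp_add)
  then have "norm (iexp a - iexp b) = norm (iexp (a - b) - 1)"
    by (simp add: norm_mult)
  also have "\<dots> \<le> \<bar>a - b\<bar>" using iexp_approx1[of "a - b" 0] by simp
  finally show ?thesis .
qed

lemma square_le_exp_add: "u\<^sup>2 \<le> 2 * (exp u + exp (- u))" for u :: real
proof -
  have "u\<^sup>2 \<le> 2 * exp \<bar>u\<bar>" using exp_lower_Taylor_quadratic[of "\<bar>u\<bar>"] by simp
  also have "\<dots> \<le> 2 * (exp u + exp (- u))"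
    by (cases "u \<ge> 0") (simp_all add: add_increasing add_increasing2)
  finally show ?thesis .
qed

text \<open>
  Comes from \<open>u\<^sup>2 \<le> 2 (exp u + exp (- u))\<close> at \<open>u = (\<beta> H - N) / sqrt N\<close>, whose exponential moments under
  the canonical measure are exact.
\<close>

definition energy_fluctuation :: "nat \<Rightarrow> real" where
  "energy_fluctuation N = 2 / real N *
    (exp (- sqrt (real N)) / (1 - 1 / sqrt (real N)) ^ N + exp (sqrt (real N)) / (1 + 1 / sqrt (real N)) ^ N)"

text \<open>The power \<open>-N\<close> of \<open>1 - 1 / sqrt N\<close> is
  \<open>exp (sqrt N + 1/2 + o(1))\<close>, and that of \<open>1 + 1 / sqrt N\<close> is
  \<open>exp (- sqrt N + 1/2 + o(1))\<close>. So both summands tend to \<open>exp (1/2)\<close>, and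
  the factor \<open>2 / N\<close> decides.\<close>

lemma energy_fluctuation_tendsto_0: "energy_fluctuation \<longlonglongrightarrow> 0"
proof -
  have "(\<lambda>N. 2 / real N * (exp (- sqrt (real N)) / (1 - 1 / sqrt (real N)) powr real N +
      exp (sqrt (real N)) / (1 + 1 / sqrt (real N)) powr real N)) \<longlonglongrightarrow> 0"
    by real_asymp
  \<comment> \<open>\<open>powr\<close> stands in for the power with variable exponent; the two
    agree for a positive base, which for \<open>1 - 1 / sqrt N\<close> begins at
    \<open>N = 2\<close>.\<close>
  moreover have "eventually (\<lambda>N. 2 / real N * (exp (- sqrt (real N)) / (1 - 1 / sqrt (real N)) powr real N +
      exp (sqrt (real N)) / (1 + 1 / sqrt (real N)) powr real N) = energy_fluctuation N) sequentially"
    using eventually_ge_at_top[of "2 :: nat"]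
  proof eventually_elim
    case (elim N)
    then have "1 / sqrt (real N) < 1" by simp
    then have "1 - 1 / sqrt (real N) > 0" by simp
    moreover have "1 + 1 / sqrt (real N) > 0" by (simp add: add_pos_nonneg)
    ultimately show ?case by (simp only: powr_realpow energy_fluctuation_def)
  qed
  ultimately show ?thesis by (rule Lim_transform_eventually)
qed

section \<open>Laplace transforms under the canonical measure\<close>

context pos_quadratic_energy
begin

abbreviation "can \<equiv> canonical_measure I H \<beta>"

lemma sets_canonical [simp]: "sets can = sets BI"
  by (simp add: canonical_measure_eq)

lemma measurable_canonical [simp]: "measurable can M = measurable BI M"
  by (intro measurable_cong_sets) auto

lemma nn_integral_canonical:
  assumes f[measurable]: "f \<in> borel_measurable BI"
  shows "(\<integral>\<^sup>+x. f x \<partial>can) = 1 / Zpart * (\<integral>\<^sup>+x. ennreal (exp (- \<beta> * H x)) * f x \<partial>L)"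
proof -
  have "(\<integral>\<^sup>+x. f x \<partial>can) = (\<integral>\<^sup>+x. 1 / Zpart * f x \<partial>gibbs)"
    unfolding canonical_measure_eq by (rule nn_integral_density) auto
  also have "\<dots> = 1 / Zpart * (\<integral>\<^sup>+x. f x \<partial>gibbs)"
    by (rule nn_integral_cmult) simp
  also have "(\<integral>\<^sup>+x. f x \<partial>gibbs) = (\<integral>\<^sup>+x. ennreal (exp (- \<beta> * H x)) * f x \<partial>L)"
    unfolding gibbs_def by (rule nn_integral_density) auto
  finally show ?thesis .
qed

lemma Zpart_cancel: "1 / Zpart * (ennreal a * Zpart) = ennreal a"
  using partition_function_finite[OF \<beta>_pos] partition_function_pos[of \<beta>]
  by (simp add: ennreal_divide_times ennreal_divide_self less_top[symmetric] mult.left_commute)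

lemma AE_canonical_H_pos: "AE x in can. H x > 0"
proof -
  have "AE x in gibbs. H x > 0" unfolding gibbs_def using AE_H_pos by (subst AE_density) auto
  then show ?thesis unfolding canonical_measure_eq by (subst AE_density) auto
qed

lemma bil_measurable_left [measurable]: "(\<lambda>x. bil x v) \<in> borel_measurable BI"
  unfolding bil_def by measurable

text \<open>For functionals of the shape \<open>bil x v\<close> completing the square requires no
  inverse of \<open>A\<close>: the translation by \<open>z * v\<close> absorbs the linear term, and
  the variance is read off as a multiple of \<open>H v\<close>.\<close>

lemma canonical_laplace_linear:
  "(\<integral>\<^sup>+x. ennreal (exp (z * (2 * \<beta> * bil x v))) \<partial>can) = ennreal (exp (\<beta> * H v * z\<^sup>2))"
proof -
  have lin: "bil (\<lambda>i. x i + z * v i) v = bil x v + z * H v" for x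
    by (simp add: bil_def quadratic_form_def algebra_simps sum.distrib sum_distrib_left)
  have lin2: "bil x (\<lambda>i. z * v i) = z * bil x v" for x
    by (simp add: bil_def algebra_simps sum_distrib_left)
  have shift: "- \<beta> * H y + z * (2 * \<beta> * bil y v) = - \<beta> * H x + \<beta> * H v * z\<^sup>2"
    if y: "y = (\<lambda>i\<in>I. z * v i + 1 * x i)" for x y
  proof -
    have "H y = H (\<lambda>i. x i + z * v i)" unfolding y by (rule H_cong) (simp add: add.commute)
    also have "\<dots> = H x + 2 * (z * bil x v) + z\<^sup>2 * H v"
      by (simp only: H_add H_scale lin2)
    finally have Hy: "H y = H x + 2 * (z * bil x v) + z\<^sup>2 * H v" .
    have "bil y v = bil (\<lambda>i. x i + z * v i) v"
      unfolding y bil_def by (intro sum.cong refl) (simp add: add.commute)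
    then have By: "bil y v = bil x v + z * H v" by (simp only: lin)
    show ?thesis unfolding Hy By by (simp add: algebra_simps power2_eq_square)
  qed
  have "(\<integral>\<^sup>+x. ennreal (exp (- \<beta> * H x)) * ennreal (exp (z * (2 * \<beta> * bil x v))) \<partial>L)
      = (\<integral>\<^sup>+x. ennreal (exp (- \<beta> * H x + z * (2 * \<beta> * bil x v))) \<partial>L)"
    by (simp only: exp_add ennreal_mult[OF exp_ge_zero exp_ge_zero])
  also have "\<dots> = ennreal (1 ^ card I) * (\<integral>\<^sup>+x. ennreal (exp (- \<beta> * H (\<lambda>i\<in>I. z * v i + 1 * x i) +
      z * (2 * \<beta> * bil (\<lambda>i\<in>I. z * v i + 1 * x i) v))) \<partial>L)"
    using finite_I by (intro nn_integral_PiM_lborel_affine) auto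
  also have "\<dots> = (\<integral>\<^sup>+x. ennreal (exp (- \<beta> * H x + \<beta> * H v * z\<^sup>2)) \<partial>L)"
    by (simp only: shift[OF refl], simp only: power_one ennreal_1 mult_1_left)
  also have "\<dots> = (\<integral>\<^sup>+x. ennreal (exp (\<beta> * H v * z\<^sup>2)) * ennreal (exp (- \<beta> * H x)) \<partial>L)"
    by (simp only: exp_add ennreal_mult[OF exp_ge_zero exp_ge_zero] mult.commute[of "ennreal (exp (\<beta> * H v * z\<^sup>2))"])
  also have "\<dots> = ennreal (exp (\<beta> * H v * z\<^sup>2)) * Zpart"
    by (rule nn_integral_cmult) auto
  finally have eq: "(\<integral>\<^sup>+x. ennreal (exp (- \<beta> * H x)) * ennreal (exp (z * (2 * \<beta> * bil x v))) \<partial>L) =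
      ennreal (exp (\<beta> * H v * z\<^sup>2)) * Zpart" .
  have m: "(\<lambda>x. ennreal (exp (z * (2 * \<beta> * bil x v)))) \<in> borel_measurable BI" by measurable
  show ?thesis by (simp only: nn_integral_canonical[OF m] eq Zpart_cancel)
qed

text \<open>Writing the exponent as \<open>\<beta> - \<beta> * l\<^sup>2\<close> makes the tilted
  weight the Gibbs weight at \<open>l * x\<close>, so only the Jacobian \<open>l ^ card I\<close>
  survives. Values \<open>l < 1\<close> give the moments with positive exponent.\<close>

lemma canonical_laplace_energy:
  assumes l: "l > 0"
  shows "(\<integral>\<^sup>+x. ennreal (exp ((\<beta> - \<beta> * l\<^sup>2) * H x)) \<partial>can) = ennreal (1 / l ^ card I)"
proof -
  let ?Zl = "\<integral>\<^sup>+x. ennreal (exp (- (\<beta> * l\<^sup>2) * H x)) \<partial>L"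
  have "H (\<lambda>i\<in>I. 0 + l * x i) = l\<^sup>2 * H x" for x
    unfolding H_scale[symmetric] by (rule H_cong) simp
  then have "Zpart = ennreal (l ^ card I) * ?Zl"
    using nn_integral_PiM_lborel_affine[of I l "\<lambda>x. ennreal (exp (- \<beta> * H x))" "\<lambda>_. 0"] finite_I l
    by (simp add: mult.assoc)
  then have "ennreal (1 / l ^ card I) * Zpart = ennreal (1 / l ^ card I * l ^ card I) * ?Zl"
    using l by (simp add: ennreal_mult mult.assoc del: times_divide_eq_left)
  then have Zl: "?Zl = ennreal (1 / l ^ card I) * Zpart" using l by simp
  have "(\<integral>\<^sup>+x. ennreal (exp (- \<beta> * H x)) * ennreal (exp ((\<beta> - \<beta> * l\<^sup>2) * H x)) \<partial>L) = ?Zl"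
    by (intro nn_integral_cong) (simp add: algebra_simps flip: ennreal_mult exp_add)
  note eq = this[unfolded Zl]
  have m: "(\<lambda>x. ennreal (exp ((\<beta> - \<beta> * l\<^sup>2) * H x))) \<in> borel_measurable BI" by measurable
  show ?thesis by (simp only: nn_integral_canonical[OF m] eq Zpart_cancel)
qed

end

lemma (in prob_space) norm_integral_diff_le:
  fixes f g :: "'a \<Rightarrow> complex"
  assumes [measurable]: "f \<in> borel_measurable M" "g \<in> borel_measurable M"
    and f: "\<And>x. norm (f x) \<le> 1" and g: "\<And>x. norm (g x) \<le> 1"
    and h: "AE x in M. norm (f x - g x) \<le> h x" and hb: "(\<integral>\<^sup>+x. ennreal (h x) \<partial>M) \<le> ennreal b" and b: "b \<ge> 0"
  shows "norm ((\<integral>x. f x \<partial>M) - (\<integral>x. g x \<partial>M)) \<le> b"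
proof -
  have int: "integrable M f" "integrable M g"
    using f g by (auto intro!: integrable_const_bound[of _ 1])
  have "ennreal (norm (\<integral>x. f x - g x \<partial>M)) \<le> (\<integral>\<^sup>+x. norm (f x - g x) \<partial>M)"
    by (rule integral_norm_bound_ennreal) (intro Bochner_Integration.integrable_diff int)
  also have "\<dots> \<le> (\<integral>\<^sup>+x. ennreal (h x) \<partial>M)"
    using h by (intro nn_integral_mono_AE) (auto intro: ennreal_leI)
  also note hb
  finally have "norm (\<integral>x. f x - g x \<partial>M) \<le> b" using b by simp
  then show ?thesis using int by simp
qed

lemma energy_fluctuation_nonneg: "N \<ge> 2 \<Longrightarrow> energy_fluctuation N \<ge> 0"
  unfolding energy_fluctuation_def
  by (intro mult_nonneg_nonneg add_nonneg_nonneg divide_nonneg_nonneg zero_le_power) auto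

section \<open>Error bounds for the two characteristic functions\<close>

context pos_quadratic_energy
begin

text \<open>\<open>y\<close> is the functional wanted, \<open>\<beta> * grad i v\<close> are the
  coefficients of the one whose law is known. Cauchy-Schwarz and coercivity bound the squared
  difference at \<open>x\<close> by \<open>residual_sq / c * H x\<close>;
  \<open>residual_bound\<close> inserts a bound for the mean energy.\<close>

definition residual_sq :: "('a \<Rightarrow> real) \<Rightarrow> ('a \<Rightarrow> real) \<Rightarrow> real" where
  "residual_sq y v = (\<Sum>i\<in>I. (y i - \<beta> * grad i v)\<^sup>2)"

definition residual_bound :: "nat \<Rightarrow> ('a \<Rightarrow> real) \<Rightarrow> ('a \<Rightarrow> real) \<Rightarrow> real" where
  "residual_bound N y v = residual_sq y v / c * (E * (2 + energy_fluctuation N))"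

lemma bil_eq_grad: "2 * \<beta> * bil x v = (\<Sum>i\<in>I. \<beta> * grad i v * x i)"
  by (simp add: bil_def grad_def sum_distrib_left sum_distrib_right mult_ac)

context
  fixes N :: nat
  assumes N: "N \<ge> 2" "card I = 2 * N" and E: "E = real N / \<beta>"
begin

text \<open>In dimension \<open>2 * N\<close> equipartition makes \<open>N / \<beta>\<close> the
  canonical mean energy, which is why \<open>H x / E\<close> concentrates at 1.\<close>

lemma nn_integral_energy_fluctuation:
  shows "(\<integral>\<^sup>+x. ennreal ((H x / E - 1)\<^sup>2) \<partial>can) \<le> ennreal (energy_fluctuation N)"
proof -
  define n where "n = sqrt (real N)"
  have n: "n > 1" "n\<^sup>2 = real N" using N by (auto simp: n_def)
  have half: "(\<integral>\<^sup>+x. ennreal (exp (\<sigma> * (\<beta> * H x / n))) \<partial>can) = ennreal (1 / (1 - \<sigma> / n) ^ N)"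
    if \<sigma>: "\<sigma> = 1 \<or> \<sigma> = -1" for \<sigma> :: real
  proof -
    \<comment> \<open>Here \<open>N \<ge> 2\<close> enters: the exponential moment with
      \<open>\<sigma> = 1\<close> is finite only for \<open>n > 1\<close>.\<close>
    have pos: "1 - \<sigma> / n > 0" using n \<sigma> by (auto simp: add_pos_pos)
    have l2: "(sqrt (1 - \<sigma> / n))\<^sup>2 = 1 - \<sigma> / n" using pos by simp
    have "(sqrt (1 - \<sigma> / n)) ^ card I = (1 - \<sigma> / n) ^ N" by (simp only: N(2) power_mult l2)
    moreover have "(\<beta> - \<beta> * (1 - \<sigma> / n)) * H x = \<sigma> * (\<beta> * H x / n)" for x by (simp add: algebra_simps)
    ultimately show ?thesis
      using canonical_laplace_energy[of "sqrt (1 - \<sigma> / n)"] pos by (simp only: l2 real_sqrt_gt_zero)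
  qed
  have pt: "(H x / E - 1)\<^sup>2 \<le> 2 / real N * exp (- n) * exp (1 * (\<beta> * H x / n)) + 2 / real N * exp n * exp (- 1 * (\<beta> * H x / n))" for x
  proof -
    define u where "u = \<beta> * H x / n - n"
    have "H x / E - 1 = u / n"
      using n \<beta>_pos N by (simp add: E u_def field_simps flip: n(2)) (simp add: power2_eq_square)
    then have "(H x / E - 1)\<^sup>2 = u\<^sup>2 / real N" by (simp add: power_divide n(2))
    also have "\<dots> \<le> 2 * (exp u + exp (- u)) / real N"
      by (intro divide_right_mono square_le_exp_add) simp
    also have "\<dots> = 2 / real N * exp (- n) * exp (1 * (\<beta> * H x / n)) + 2 / real N * exp n * exp (- 1 * (\<beta> * H x / n))"
    proof -
      have "exp u = exp (- n) * exp (1 * (\<beta> * H x / n))" "exp (- u) = exp n * exp (- 1 * (\<beta> * H x / n))"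
        unfolding u_def exp_add[symmetric] by simp_all
      then show ?thesis by (simp add: add_divide_distrib distrib_left)
    qed
    finally show ?thesis .
  qed
  have "(\<integral>\<^sup>+x. ennreal ((H x / E - 1)\<^sup>2) \<partial>can) \<le>
    (\<integral>\<^sup>+x. ennreal (2 / real N * exp (- n)) * ennreal (exp (1 * (\<beta> * H x / n))) +
      ennreal (2 / real N * exp n) * ennreal (exp (- 1 * (\<beta> * H x / n))) \<partial>can)"
  proof (rule nn_integral_mono)
    fix x
    have "ennreal ((H x / E - 1)\<^sup>2) \<le> ennreal (2 / real N * exp (- n) * exp (1 * (\<beta> * H x / n)) + 2 / real N * exp n * exp (- 1 * (\<beta> * H x / n)))"
      by (rule ennreal_leI[OF pt])
    also have "\<dots> = ennreal (2 / real N * exp (- n)) * ennreal (exp (1 * (\<beta> * H x / n))) +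
      ennreal (2 / real N * exp n) * ennreal (exp (- 1 * (\<beta> * H x / n)))"
      by (simp flip: ennreal_mult ennreal_plus)
    finally show "ennreal ((H x / E - 1)\<^sup>2) \<le> \<dots>" .
  qed
  also have "\<dots> = ennreal (2 / real N * exp (- n)) * ennreal (1 / (1 - 1 / n) ^ N) +
      ennreal (2 / real N * exp n) * ennreal (1 / (1 - (- 1) / n) ^ N)"
  proof -
    have "(\<integral>\<^sup>+x. ennreal a * ennreal (exp (\<sigma> * (\<beta> * H x / n))) \<partial>can) = ennreal a * ennreal (1 / (1 - \<sigma> / n) ^ N)"
      if "\<sigma> = 1 \<or> \<sigma> = -1" for a \<sigma>
      by (subst nn_integral_cmult, simp) (simp only: half[OF that])
    from this[of 1] this[of "-1"] show ?thesis
      by (subst nn_integral_add) (simp, simp, simp only: simp_thms)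
  qed
  also have "\<dots> = ennreal (energy_fluctuation N)"
    using n by (simp add: energy_fluctuation_def n_def[symmetric] distrib_left flip: ennreal_mult ennreal_plus)
  finally show ?thesis .
qed

lemma nn_integral_energy:
  shows "(\<integral>\<^sup>+x. ennreal (H x) \<partial>can) \<le> ennreal (E * (2 + energy_fluctuation N))"
proof -
  interpret prob_space can by (rule prob_space_canonical)
  note q = energy_fluctuation_nonneg[OF N(1)]
  have "(\<integral>\<^sup>+x. ennreal (H x) \<partial>can) \<le> (\<integral>\<^sup>+x. ennreal (2 * E) + ennreal E * ennreal ((H x / E - 1)\<^sup>2) \<partial>can)"
  proof (rule nn_integral_mono)
    fix x
    \<comment> \<open>Bounds the first moment by the mean square deviation already
      estimated.\<close>
    have "t \<le> 2 + (t - 1)\<^sup>2" for t :: real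
      using zero_le_power2[of "t - 3 / 2"] by (simp add: power2_eq_square algebra_simps)
    from this[of "H x / E"] have "E * (H x / E) \<le> E * (2 + (H x / E - 1)\<^sup>2)"
      using E_pos by (intro mult_left_mono) auto
    then have "H x \<le> 2 * E + E * (H x / E - 1)\<^sup>2" using E_pos by (simp add: distrib_left)
    then show "ennreal (H x) \<le> ennreal (2 * E) + ennreal E * ennreal ((H x / E - 1)\<^sup>2)"
      using E_pos by (simp add: ennreal_leI flip: ennreal_mult ennreal_plus)
  qed
  also have "\<dots> = ennreal (2 * E) + ennreal E * (\<integral>\<^sup>+x. ennreal ((H x / E - 1)\<^sup>2) \<partial>can)"
    by (subst nn_integral_add) (simp_all add: nn_integral_cmult emeasure_space_1)
  also have "\<dots> \<le> ennreal (2 * E) + ennreal E * ennreal (energy_fluctuation N)"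
    by (intro add_left_mono mult_left_mono nn_integral_energy_fluctuation) simp
  also have "\<dots> = ennreal (E * (2 + energy_fluctuation N))"
    using E_pos q by (simp add: algebra_simps flip: ennreal_mult ennreal_plus)
  finally show ?thesis .
qed

lemma nn_integral_residual:
  shows "(\<integral>\<^sup>+x. ennreal (((\<Sum>i\<in>I. y i * x i) - 2 * \<beta> * bil x v)\<^sup>2) \<partial>can) \<le> ennreal (residual_bound N y v)"
proof -
  note q = energy_fluctuation_nonneg[OF N(1)]
  have r: "residual_sq y v / c \<ge> 0" using c_pos by (simp add: residual_sq_def sum_nonneg)
  have "(\<integral>\<^sup>+x. ennreal (((\<Sum>i\<in>I. y i * x i) - 2 * \<beta> * bil x v)\<^sup>2) \<partial>can) \<le> (\<integral>\<^sup>+x. ennreal (residual_sq y v / c) * ennreal (H x) \<partial>can)"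
  proof (rule nn_integral_mono)
    fix x
    have "((\<Sum>i\<in>I. y i * x i) - 2 * \<beta> * bil x v) = (\<Sum>i\<in>I. (y i - \<beta> * grad i v) * x i)"
      unfolding bil_eq_grad by (simp add: algebra_simps sum_subtractf)
    then have "((\<Sum>i\<in>I. y i * x i) - 2 * \<beta> * bil x v)\<^sup>2 \<le> residual_sq y v * (\<Sum>i\<in>I. (x i)\<^sup>2)"
      using Cauchy_Schwarz_ineq_sum[of "\<lambda>i. y i - \<beta> * grad i v" x I] by (simp add: residual_sq_def)
    also have "\<dots> \<le> residual_sq y v * (H x / c)"
      using coercive[of x] c_pos by (intro mult_left_mono) (auto simp: residual_sq_def sum_nonneg field_simps)
    finally have "((\<Sum>i\<in>I. y i * x i) - 2 * \<beta> * bil x v)\<^sup>2 \<le> residual_sq y v / c * H x" by simp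
    then show "ennreal (((\<Sum>i\<in>I. y i * x i) - 2 * \<beta> * bil x v)\<^sup>2) \<le> ennreal (residual_sq y v / c) * ennreal (H x)"
      using r H_nonneg by (subst ennreal_mult[symmetric]) (auto intro: ennreal_leI)
  qed
  also have "\<dots> = ennreal (residual_sq y v / c) * (\<integral>\<^sup>+x. ennreal (H x) \<partial>can)"
    by (rule nn_integral_cmult) simp
  also have "\<dots> \<le> ennreal (residual_sq y v / c) * ennreal (E * (2 + energy_fluctuation N))"
    by (intro mult_left_mono nn_integral_energy) simp
  also have "\<dots> = ennreal (residual_bound N y v)"
    using r E_pos q by (simp add: residual_bound_def flip: ennreal_mult)
  finally show ?thesis .
qed

lemma residual_bound_nonneg: "residual_bound N y v \<ge> 0"
  unfolding residual_bound_def residual_sq_def using c_pos E_pos energy_fluctuation_nonneg[OF N(1)]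
  by (intro mult_nonneg_nonneg add_nonneg_nonneg divide_nonneg_nonneg sum_nonneg) auto

text \<open>\<open>residual_bound\<close> controls a mean square, whereas characteristic functions
  differ by at most a mean modulus; \<open>r \<le> \<eta> + r\<^sup>2 / \<eta>\<close> converts one
  into the other.\<close>

lemma canonical_char_approx:
  assumes \<eta>: "\<eta> > 0"
  shows "norm ((\<integral>x. iexp (\<Sum>i\<in>I. y i * x i) \<partial>can) - complex_of_real (exp (- (\<beta> * H v))))
    \<le> \<eta> + residual_bound N y v / \<eta>"
proof -
  interpret prob_space can by (rule prob_space_canonical)
  let ?Y = "\<lambda>x. \<Sum>i\<in>I. y i * x i" and ?Z = "\<lambda>x. 2 * \<beta> * bil x v"
  have Y[measurable]: "?Y \<in> borel_measurable BI" by measurable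
  have Y0: "?Z \<in> borel_measurable can" unfolding measurable_canonical by measurable
  have "(\<integral>x. iexp (?Z x) \<partial>can) = complex_of_real (exp (- (\<beta> * H v)))"
    by (rule gaussian_char_of_mgf[OF Y0 canonical_laplace_linear])
  moreover have "norm ((\<integral>x. iexp (?Y x) \<partial>can) - (\<integral>x. iexp (?Z x) \<partial>can)) \<le> \<eta> + residual_bound N y v / \<eta>"
  proof (rule norm_integral_diff_le)
    let ?h = "\<lambda>x. \<eta> + 1 / \<eta> * (?Y x - ?Z x)\<^sup>2"
    show "AE x in can. norm (iexp (?Y x) - iexp (?Z x)) \<le> ?h x"
    proof (rule AE_I2)
      fix x
      have "r \<le> \<eta> + 1 / \<eta> * r\<^sup>2" for r :: real
      proof (cases "r \<le> \<eta>")
        case False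
        then have "r * \<eta> \<le> r * r" using \<eta> by (intro mult_left_mono) auto
        then have "r \<le> 1 / \<eta> * r\<^sup>2" using \<eta> by (simp add: field_simps power2_eq_square)
        then show ?thesis using \<eta> by simp
      qed (use \<eta> in \<open>simp add: add_increasing2\<close>)
      from this[of "\<bar>?Y x - ?Z x\<bar>"] norm_exp_i_diff_le[of "?Y x" "?Z x"]
      show "norm (iexp (?Y x) - iexp (?Z x)) \<le> ?h x" by simp
    qed
    have "(\<integral>\<^sup>+x. ennreal (?h x) \<partial>can) = (\<integral>\<^sup>+x. ennreal \<eta> + ennreal (1 / \<eta>) * ennreal ((?Y x - ?Z x)\<^sup>2) \<partial>can)"
      using \<eta> by (intro nn_integral_cong) (simp flip: ennreal_mult ennreal_plus)
    also have "\<dots> = ennreal \<eta> + ennreal (1 / \<eta>) * (\<integral>\<^sup>+x. ennreal ((?Y x - ?Z x)\<^sup>2) \<partial>can)"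
      using Y0 by (subst nn_integral_add) (simp_all add: nn_integral_cmult emeasure_space_1)
    also have "\<dots> \<le> ennreal \<eta> + ennreal (1 / \<eta>) * ennreal (residual_bound N y v)"
      by (intro add_left_mono mult_left_mono nn_integral_residual) simp
    also have "\<dots> = ennreal (\<eta> + residual_bound N y v / \<eta>)"
      using \<eta> residual_bound_nonneg by (simp flip: ennreal_mult ennreal_plus)
    finally show "(\<integral>\<^sup>+x. ennreal (?h x) \<partial>can) \<le> ennreal (\<eta> + residual_bound N y v / \<eta>)" .
    show "(\<lambda>x. iexp (?Y x)) \<in> borel_measurable can"
      unfolding measurable_canonical by measurable
    show "(\<lambda>x. iexp (?Z x)) \<in> borel_measurable can"
      unfolding measurable_canonical by measurable
  qed (use \<eta> residual_bound_nonneg in auto)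
  ultimately show ?thesis by simp
qed

text \<open>Rescaling by \<open>1 / r\<close> changes the functional \<open>Y\<close> by
  \<open>Y * (1 / r - 1)\<close>, so its second moment must stay bounded. The 8 collects twice
  \<open>2 * (exp + exp)\<close>, both exponential moments being
  \<open>exp (\<beta> * H v)\<close>.\<close>

lemma nn_integral_linear_square:
  shows "(\<integral>\<^sup>+x. ennreal ((\<Sum>i\<in>I. y i * x i)\<^sup>2) \<partial>can) \<le> ennreal (8 * exp (\<beta> * H v) + 2 * residual_bound N y v)"
proof -
  let ?Y = "\<lambda>x. \<Sum>i\<in>I. y i * x i" and ?Z = "\<lambda>x. 2 * \<beta> * bil x v"
  have Y0[measurable]: "?Z \<in> borel_measurable BI" by measurable
  have "(\<integral>\<^sup>+x. ennreal ((?Y x)\<^sup>2) \<partial>can) \<le> (\<integral>\<^sup>+x. (4 * ennreal (exp (1 * ?Z x)) + 4 * ennreal (exp (- 1 * ?Z x))) +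
      2 * ennreal ((?Y x - ?Z x)\<^sup>2) \<partial>can)"
  proof (rule nn_integral_mono)
    fix x
    have "(a + b)\<^sup>2 \<le> 2 * a\<^sup>2 + 2 * b\<^sup>2" for a b :: real
      using zero_le_power2[of "a - b"] by (simp add: power2_eq_square algebra_simps)
    from this[of "?Z x" "?Y x - ?Z x"] have "(?Y x)\<^sup>2 \<le> 2 * (?Z x)\<^sup>2 + 2 * (?Y x - ?Z x)\<^sup>2" by simp
    also have "\<dots> \<le> 2 * (2 * (exp (?Z x) + exp (- ?Z x))) + 2 * (?Y x - ?Z x)\<^sup>2"
      by (intro add_right_mono mult_left_mono square_le_exp_add) simp
    finally have "(?Y x)\<^sup>2 \<le> (4 * exp (1 * ?Z x) + 4 * exp (- 1 * ?Z x)) + 2 * (?Y x - ?Z x)\<^sup>2" by simp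
    then have "ennreal ((?Y x)\<^sup>2) \<le> ennreal ((4 * exp (1 * ?Z x) + 4 * exp (- 1 * ?Z x)) + 2 * (?Y x - ?Z x)\<^sup>2)"
      by (rule ennreal_leI)
    also have "\<dots> = (4 * ennreal (exp (1 * ?Z x)) + 4 * ennreal (exp (- 1 * ?Z x))) + 2 * ennreal ((?Y x - ?Z x)\<^sup>2)"
      by (simp add: ennreal_plus ennreal_mult add_nonneg_nonneg)
    finally show "ennreal ((?Y x)\<^sup>2) \<le> \<dots>" .
  qed
  also have "\<dots> = (4 * (\<integral>\<^sup>+x. ennreal (exp (1 * ?Z x)) \<partial>can) + 4 * (\<integral>\<^sup>+x. ennreal (exp (- 1 * ?Z x)) \<partial>can)) +
      2 * (\<integral>\<^sup>+x. ennreal ((?Y x - ?Z x)\<^sup>2) \<partial>can)"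
    by (simp add: nn_integral_add nn_integral_cmult)
  also have "\<dots> = (4 * ennreal (exp (\<beta> * H v)) + 4 * ennreal (exp (\<beta> * H v))) + 2 * (\<integral>\<^sup>+x. ennreal ((?Y x - ?Z x)\<^sup>2) \<partial>can)"
    by (simp only: canonical_laplace_linear) simp
  also have "\<dots> \<le> (4 * ennreal (exp (\<beta> * H v)) + 4 * ennreal (exp (\<beta> * H v))) + 2 * ennreal (residual_bound N y v)"
    by (intro add_left_mono mult_left_mono nn_integral_residual) simp
  also have "\<dots> = ennreal (8 * exp (\<beta> * H v) + 2 * residual_bound N y v)"
    using residual_bound_nonneg by (simp add: ennreal_plus ennreal_mult flip: distrib_right)
  finally show ?thesis .
qed

text \<open>
  The energy concentrates, so rescaling a canonical sample to the energy shell barely changes it.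
\<close>

lemma microcanonical_char_approx:
  assumes \<eta>: "\<eta> > 0"
  shows "norm ((\<integral>x. iexp (\<Sum>i\<in>I. y i * x i) \<partial>microcanonical_measure I H E) -
      (\<integral>x. iexp (\<Sum>i\<in>I. y i * x i) \<partial>can))
    \<le> \<eta> * (8 * exp (\<beta> * H v) + 2 * residual_bound N y v) + (1 / \<eta> + 8) * energy_fluctuation N"
proof -
  interpret prob_space can by (rule prob_space_canonical)
  let ?Y = "\<lambda>x. \<Sum>i\<in>I. y i * x i"
  note q = energy_fluctuation_nonneg[OF N(1)]
  have Y[measurable]: "?Y \<in> borel_measurable BI" by measurable
  have e[measurable]: "(\<lambda>x. iexp (?Y x)) \<in> borel_measurable BI" by measurable
  have "(\<integral>x. iexp (?Y x) \<partial>microcanonical_measure I H E) = (\<integral>x. iexp (?Y (nrm x)) \<partial>can)"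
    unfolding microcanonical_eq_distr by (rule integral_distr) (simp_all only: measurable_canonical nrm_measurable e)
  moreover have "norm ((\<integral>x. iexp (?Y (nrm x)) \<partial>can) - (\<integral>x. iexp (?Y x) \<partial>can))
      \<le> \<eta> * (8 * exp (\<beta> * H v) + 2 * residual_bound N y v) + (1 / \<eta> + 8) * energy_fluctuation N"
  proof (rule norm_integral_diff_le)
    let ?h = "\<lambda>x. \<eta> * (?Y x)\<^sup>2 + (1 / \<eta> + 8) * (H x / E - 1)\<^sup>2"
    show "AE x in can. norm (iexp (?Y (nrm x)) - iexp (?Y x)) \<le> ?h x"
      using AE_canonical_H_pos
    proof eventually_elim
      case (elim x)
      define r where "r = sqrt (H x / E)"
      have r: "r > 0" "r\<^sup>2 = H x / E" using elim E_pos by (auto simp: r_def)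
      have Yn: "?Y (nrm x) = ?Y x / r"
        by (simp add: nrm_def r_def sum_divide_distrib)
      \<comment> \<open>Passes from the radius to the energy:
        \<open>r\<^sup>2 - 1 = (r - 1) * (r + 1)\<close>, and the second factor is at least
        1.\<close>
      have "(r - 1)\<^sup>2 \<le> (r\<^sup>2 - 1)\<^sup>2"
      proof -
        have "(r\<^sup>2 - 1)\<^sup>2 = (r - 1)\<^sup>2 * (r + 1)\<^sup>2" by (simp add: power2_eq_square algebra_simps)
        moreover have "1 \<le> (r + 1)\<^sup>2" using r by (intro one_le_power) simp
        ultimately show ?thesis using mult_left_mono[of 1 "(r + 1)\<^sup>2" "(r - 1)\<^sup>2"] by simp
      qed
      then have d: "(r - 1)\<^sup>2 \<le> (H x / E - 1)\<^sup>2" by (simp add: r)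
      show "norm (iexp (?Y (nrm x)) - iexp (?Y x)) \<le> ?h x"
      \<comment> \<open>For \<open>r \<ge> 1/2\<close> the factor \<open>1 / r\<close> is at most 2.
        For smaller \<open>r\<close> the trivial bound 2 is at most
        \<open>8 * (r - 1)\<^sup>2\<close>, the source of the 8.\<close>
      proof (cases "r \<ge> 1 / 2")
        case True
        have "norm (iexp (?Y (nrm x)) - iexp (?Y x)) \<le> \<bar>?Y x / r - ?Y x\<bar>"
          unfolding Yn[symmetric] by (rule norm_exp_i_diff_le)
        also have "\<dots> = \<bar>?Y x\<bar> * \<bar>r - 1\<bar> * (1 / r)"
        proof -
          have "t / r - t = - (t * (r - 1) * (1 / r))" for t using r by (simp add: field_simps)
          then show ?thesis using r by (simp only: abs_minus_cancel abs_mult) simp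
        qed
        also have "\<dots> \<le> \<bar>?Y x\<bar> * \<bar>r - 1\<bar> * 2"
          using True r by (intro mult_left_mono) (auto simp: field_simps)
        also have "\<dots> \<le> \<eta> * (?Y x)\<^sup>2 + 1 / \<eta> * (r - 1)\<^sup>2"
        proof -
          have "0 \<le> (\<eta> * \<bar>?Y x\<bar> - \<bar>r - 1\<bar>)\<^sup>2 / \<eta>" using \<eta> by simp
          also have "\<dots> = \<eta> * \<bar>?Y x\<bar>\<^sup>2 + 1 / \<eta> * \<bar>r - 1\<bar>\<^sup>2 - \<bar>?Y x\<bar> * \<bar>r - 1\<bar> * 2"
            using \<eta> by (simp only: power2_diff) (simp add: field_simps power2_eq_square)
          finally show ?thesis by simp
        qed
        also have "\<dots> \<le> \<eta> * (?Y x)\<^sup>2 + (1 / \<eta> + 8) * (H x / E - 1)\<^sup>2"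
          using d \<eta> by (intro add_left_mono mult_mono) auto
        finally show ?thesis .
      next
        case False
        have "norm (iexp (?Y (nrm x)) - iexp (?Y x)) \<le> 1 + 1"
          by (rule order_trans[OF norm_triangle_ineq4]) simp
        also have "\<dots> \<le> 8 * (r - 1)\<^sup>2"
        proof -
          have "(1 / 2)\<^sup>2 \<le> (1 - r)\<^sup>2" using False by (intro power_mono) auto
          then show ?thesis by (simp add: power2_commute power_divide)
        qed
        also have "\<dots> \<le> (1 / \<eta> + 8) * (H x / E - 1)\<^sup>2" using d \<eta> by (intro mult_mono) auto
        also have "\<dots> \<le> ?h x" using \<eta> by simp
        finally show ?thesis .
      qed
    qed
    have "(\<integral>\<^sup>+x. ennreal (?h x) \<partial>can) = (\<integral>\<^sup>+x. ennreal \<eta> * ennreal ((?Y x)\<^sup>2) + ennreal (1 / \<eta> + 8) * ennreal ((H x / E - 1)\<^sup>2) \<partial>can)"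
      using \<eta> by (intro nn_integral_cong) (simp flip: ennreal_mult ennreal_plus)
    also have "\<dots> = ennreal \<eta> * (\<integral>\<^sup>+x. ennreal ((?Y x)\<^sup>2) \<partial>can) + ennreal (1 / \<eta> + 8) * (\<integral>\<^sup>+x. ennreal ((H x / E - 1)\<^sup>2) \<partial>can)"
      by (subst nn_integral_add) (simp_all add: nn_integral_cmult)
    also have "\<dots> \<le> ennreal \<eta> * ennreal (8 * exp (\<beta> * H v) + 2 * residual_bound N y v) + ennreal (1 / \<eta> + 8) * ennreal (energy_fluctuation N)"
      by (intro add_mono mult_left_mono nn_integral_linear_square nn_integral_energy_fluctuation) simp_all
    also have "\<dots> = ennreal (\<eta> * (8 * exp (\<beta> * H v) + 2 * residual_bound N y v) + (1 / \<eta> + 8) * energy_fluctuation N)"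
      using \<eta> q residual_bound_nonneg by (simp flip: ennreal_mult ennreal_plus)
    finally show "(\<integral>\<^sup>+x. ennreal (?h x) \<partial>can) \<le> ennreal (\<eta> * (8 * exp (\<beta> * H v) + 2 * residual_bound N y v) + (1 / \<eta> + 8) * energy_fluctuation N)" .
    show "(\<lambda>x. iexp (?Y (nrm x))) \<in> borel_measurable can"
      unfolding measurable_canonical by (rule measurable_compose[OF nrm_measurable e])
  qed (use \<eta> q residual_bound_nonneg in \<open>auto intro!: add_nonneg_nonneg mult_nonneg_nonneg\<close>)
  ultimately show ?thesis by simp
qed

end

end

subsection \<open>Smooth cutoff functions\<close>

text \<open>A smooth function is carried as the sequence of all its derivatives, index 0 being the
  function itself. This is the sequence belonging to a product.\<close>

definition leibniz :: "(nat \<Rightarrow> real \<Rightarrow> real) \<Rightarrow> (nat \<Rightarrow> real \<Rightarrow> real) \<Rightarrow> nat \<Rightarrow> real \<Rightarrow> real" where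
  "leibniz F G n x = (\<Sum>k\<le>n. real (n choose k) * F k x * G (n - k) x)"

lemma leibniz_has_derivative:
  assumes F: "\<And>n. (F n has_real_derivative F (Suc n) x) (at x within S)"
    and G: "\<And>n. (G n has_real_derivative G (Suc n) x) (at x within S)"
  shows "(leibniz F G n has_real_derivative leibniz F G (Suc n) x) (at x within S)"
proof -
  let ?a = "\<lambda>k. F k x * G (Suc n - k) x"
  have "(leibniz F G n has_real_derivative
      (\<Sum>k\<le>n. real (n choose k) * F (Suc k) x * G (n - k) x + real (n choose k) * F k x * G (Suc (n - k)) x)) (at x within S)"
    unfolding leibniz_def
    by (intro DERIV_sum) (auto intro!: derivative_eq_intros F G simp: algebra_simps)
  also have "(\<Sum>k\<le>n. real (n choose k) * F (Suc k) x * G (n - k) x + real (n choose k) * F k x * G (Suc (n - k)) x)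
     = (\<Sum>k\<le>n. real (n choose k) * ?a (Suc k)) + (\<Sum>k\<le>n. real (n choose k) * ?a k)"
    by (simp add: sum.distrib Suc_diff_le mult.assoc)
  also have "(\<Sum>k\<le>n. real (n choose k) * ?a k) = ?a 0 + (\<Sum>k\<le>n. real (n choose Suc k) * ?a (Suc k))"
  proof -
    have "(\<Sum>k\<le>n. real (n choose k) * ?a k) = (\<Sum>k\<le>Suc n. real (n choose k) * ?a k)" by simp
    also have "\<dots> = ?a 0 + (\<Sum>k\<le>n. real (n choose Suc k) * ?a (Suc k))"
      by (subst sum.atMost_Suc_shift) simp
    finally show ?thesis .
  qed
  also have "(\<Sum>k\<le>n. real (n choose k) * ?a (Suc k)) + (?a 0 + (\<Sum>k\<le>n. real (n choose Suc k) * ?a (Suc k)))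
     = ?a 0 + (\<Sum>k\<le>n. real (Suc n choose Suc k) * ?a (Suc k))"
    by (simp add: sum.distrib[symmetric] distrib_right[symmetric] add.commute)
  also have "\<dots> = leibniz F G (Suc n) x"
    unfolding leibniz_def by (subst sum.atMost_Suc_shift) (simp add: mult.assoc)
  finally show ?thesis .
qed

text \<open>Differentiating \<open>p (1/x) * exp (- 1/x)\<close> replaces \<open>p\<close> by
  \<open>y\<^sup>2 * (p - p')\<close> in the variable \<open>y = 1/x\<close>.\<close>

fun flat_poly :: "nat \<Rightarrow> real poly" where
  "flat_poly 0 = 1"
| "flat_poly (Suc n) = [:0, 0, 1:] * (flat_poly n - pderiv (flat_poly n))"

text \<open>The derivatives of the function that is \<open>exp (- 1 / x)\<close> for \<open>x > 0\<close> and \<open>0\<close> otherwise.\<close>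

definition flat :: "nat \<Rightarrow> real \<Rightarrow> real" where
  "flat n x = (if x > 0 then poly (flat_poly n) (1 / x) * exp (- (1 / x)) else 0)"

lemma poly_times_exp_minus_tendsto_0:
  "((\<lambda>y. poly p y * exp (- y)) \<longlongrightarrow> (0 :: real)) at_top"
proof -
  have "((\<lambda>y. \<Sum>i\<le>degree p. coeff p i * (y ^ i / exp y)) \<longlongrightarrow> (\<Sum>i\<le>degree p. coeff p i * 0)) at_top"
    by (intro tendsto_intros tendsto_power_div_exp_0)
  then show ?thesis
    by (simp add: poly_altdef sum_distrib_right exp_minus divide_inverse mult.assoc)
qed

lemma flat_has_derivative: "(flat n has_real_derivative flat (Suc n) x) (at x)"
proof (cases x "0 :: real" rule: linorder_cases)
  case greater
  have "((\<lambda>x. poly (flat_poly n) (1 / x) * exp (- (1 / x))) has_real_derivative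
      poly (pderiv (flat_poly n)) (1 / x) * (- (1 / x\<^sup>2)) * exp (- (1 / x)) +
      poly (flat_poly n) (1 / x) * (exp (- (1 / x)) * (1 / x\<^sup>2))) (at x)"
    using greater
    by (auto intro!: derivative_eq_intros DERIV_chain2[OF poly_DERIV] simp: power2_eq_square divide_simps)
  also have "poly (pderiv (flat_poly n)) (1 / x) * (- (1 / x\<^sup>2)) * exp (- (1 / x)) +
      poly (flat_poly n) (1 / x) * (exp (- (1 / x)) * (1 / x\<^sup>2)) = flat (Suc n) x"
    using greater by (simp add: flat_def algebra_simps power2_eq_square)
  finally show ?thesis
    by (rule has_field_derivative_transform_within_open[of _ _ _ "{0<..}"])
       (use greater in \<open>auto simp: flat_def\<close>)
next
  case less
  have "((\<lambda>x. 0 :: real) has_real_derivative 0) (at x)" by simp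
  then have "(flat n has_real_derivative 0) (at x)"
    by (rule has_field_derivative_transform_within_open[of _ _ _ "{..<0}"])
       (use less in \<open>auto simp: flat_def\<close>)
  then show ?thesis using less by (simp add: flat_def)
next
  case equal
  have "((\<lambda>h. flat n h / h) \<longlongrightarrow> 0) (at_right 0)"
  proof -
    \<comment> \<open>With \<open>y = 1 / h\<close> the right-hand difference quotient at 0 is
      \<open>y * p y * exp (- y)\<close>.\<close>
    have "((\<lambda>y. poly ([:0, 1:] * flat_poly n) y * exp (- y)) \<longlongrightarrow> 0) at_top"
      by (rule poly_times_exp_minus_tendsto_0)
    then have "((\<lambda>h. poly ([:0, 1:] * flat_poly n) (inverse h) * exp (- inverse h)) \<longlongrightarrow> 0) (at_right (0 :: real))"
      by (rule filterlim_compose[OF _ filterlim_inverse_at_top_right])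
    then show ?thesis
      by (rule Lim_transform_eventually)
         (auto simp: eventually_at_right_less flat_def divide_inverse mult_ac
            intro!: eventually_mono[OF eventually_at_right_less])
  qed
  moreover have "((\<lambda>h. flat n h / h) \<longlongrightarrow> 0) (at_left 0)"
    by (rule Lim_transform_eventually[OF tendsto_const])
       (auto simp: eventually_at_left_field flat_def intro!: exI[of _ "-1"])
  ultimately have "((\<lambda>h. flat n h / h) \<longlongrightarrow> 0) (at 0)"
    by (simp add: filterlim_split_at)
  moreover have "flat m 0 = 0" for m by (simp add: flat_def)
  ultimately show ?thesis
    using equal unfolding DERIV_def by simp
qed

lemma flat_chain:
  assumes "(g has_real_derivative c) (at x)"
  shows "((\<lambda>x. flat n (g x)) has_real_derivative flat (Suc n) (g x) * c) (at x)"
  by (rule DERIV_chain2[OF flat_has_derivative assms])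

text \<open>The factors have their zeros on \<open>x \<le> 1\<close> and on
  \<open>x \<ge> 2\<close>, so the product lives on the interval between; the signs come from the
  inner derivative of \<open>2 - x\<close>.\<close>

definition bump :: "nat \<Rightarrow> real \<Rightarrow> real" where
  "bump = leibniz (\<lambda>n x. flat n (x - 1)) (\<lambda>n x. (-1) ^ n * flat n (2 - x))"

lemma bump_has_derivative: "(bump n has_real_derivative bump (Suc n) x) (at x)"
  unfolding bump_def
proof (rule leibniz_has_derivative)
  fix n
  show "((\<lambda>x. flat n (x - 1)) has_real_derivative flat (Suc n) (x - 1)) (at x)"
    using flat_chain[OF DERIV_diff[OF DERIV_ident DERIV_const], where n=n] by simp
  have "((\<lambda>x. flat n (2 - x)) has_real_derivative flat (Suc n) (2 - x) * (-1)) (at x)"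
    by (rule flat_chain) (auto intro!: derivative_eq_intros)
  from DERIV_cmult[OF this, of "(-1) ^ n"]
  show "((\<lambda>x. (-1) ^ n * flat n (2 - x)) has_real_derivative (-1) ^ Suc n * flat (Suc n) (2 - x)) (at x)"
    by simp
qed

lemma bump_eq_0: "x \<le> 1 \<or> x \<ge> 2 \<Longrightarrow> bump n x = 0"
  by (auto simp: bump_def leibniz_def flat_def)

lemma bump_pos: "1 < x \<Longrightarrow> x < 2 \<Longrightarrow> bump 0 x > 0"
  by (simp add: bump_def leibniz_def flat_def)

lemma bump_continuous: "continuous_on U (bump n)"
  using bump_has_derivative by (intro DERIV_continuous_on) (rule DERIV_subset, auto)

definition bump_integral :: "real \<Rightarrow> real" where
  "bump_integral x = integral {0..x} (bump 0)"

lemma bump_integral_less_1: "x \<le> 1 \<Longrightarrow> bump_integral x = 0"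
  unfolding bump_integral_def by (intro integral_unique has_integral_is_0) (auto simp: bump_eq_0)

lemma bump_integral_has_derivative: "(bump_integral has_real_derivative bump 0 x) (at x)"
proof (cases "x > 0")
  case True
  have "((\<lambda>u. integral {0..u} (bump 0)) has_real_derivative bump 0 x) (at x within {0..x + 1})"
    using True by (intro integral_has_real_derivative bump_continuous) auto
  then have "((\<lambda>u. integral {0..u} (bump 0)) has_real_derivative bump 0 x) (at x)"
    using True by (subst (asm) at_within_interior) auto
  then show ?thesis by (simp add: bump_integral_def[abs_def])
next
  case False
  have "((\<lambda>_. 0) has_real_derivative 0) (at x)" by simp
  then have "(bump_integral has_real_derivative 0) (at x)"
    by (rule has_field_derivative_transform_within_open[of _ _ _ "{..<1}"])
       (use False bump_integral_less_1 in auto)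
  then show ?thesis using False by (simp add: bump_eq_0)
qed

text \<open>Index 0 is the normalised primitive of the bump, passing from 0 to 1 between 1 and 2;
  the higher indices are its derivatives.\<close>

definition cutoff :: "nat \<Rightarrow> real \<Rightarrow> real" where
  "cutoff n x = (case n of 0 \<Rightarrow> bump_integral x | Suc m \<Rightarrow> bump m x) / bump_integral 2"

lemma cutoff_has_derivative: "(cutoff n has_real_derivative cutoff (Suc n) x) (at x)"
  unfolding cutoff_def[abs_def] 
  by (cases n) (auto intro!: DERIV_cdivide bump_integral_has_derivative bump_has_derivative)

lemma bump_integral_2_pos: "bump_integral 2 > 0"
proof -
  have "bump_integral 1 < bump_integral 2"
    by (rule DERIV_pos_imp_increasing_open)
       (use bump_integral_has_derivative bump_pos in \<open>force intro: DERIV_isCont continuous_at_imp_continuous_on\<close>)+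
  then show ?thesis using bump_integral_less_1[of 1] by simp
qed

lemma cutoff_eq_0: "x \<le> 1 \<Longrightarrow> cutoff n x = 0"
  by (cases n) (auto simp: cutoff_def bump_integral_less_1 bump_eq_0)

lemma cutoff_eq_1: "x \<ge> 2 \<Longrightarrow> cutoff 0 x = 1"
proof -
  assume x: "x \<ge> 2"
  have "bump_integral x = bump_integral 2"
  proof (cases "x = 2")
    case False
    then have "2 < x" using x by simp
    show ?thesis
    proof (rule DERIV_isconst2[OF \<open>2 < x\<close>])
      show "continuous_on {2..x} bump_integral"
        using bump_integral_has_derivative by (intro continuous_at_imp_continuous_on ballI DERIV_isCont)
      show "(bump_integral has_real_derivative 0) (at y)" if "2 < y" for y
        using bump_integral_has_derivative[of y] bump_eq_0[of y 0] that by simp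
    qed (use \<open>2 < x\<close> in simp_all)
  qed simp
  then show ?thesis using bump_integral_2_pos by (simp add: cutoff_def)
qed

lemma cutoff_Suc_eq_0: "x \<ge> 2 \<Longrightarrow> cutoff (Suc n) x = 0"
  by (simp add: cutoff_def bump_eq_0)

lemma cutoff_continuous: "continuous_on U (cutoff n)"
  using cutoff_has_derivative by (intro DERIV_continuous_on) (rule DERIV_subset, auto)

lemma cutoff_bounded: obtains B where "B > 0" "\<And>x. \<bar>cutoff (Suc n) x\<bar> \<le> B"
proof -
  have "compact (cutoff (Suc n) ` {1..2})"
    by (intro compact_continuous_image cutoff_continuous) auto
  then obtain B where B: "B > 0" "\<And>x. x \<in> {1..2} \<Longrightarrow> \<bar>cutoff (Suc n) x\<bar> \<le> B"
    by (auto dest!: compact_imp_bounded simp: bounded_pos)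
  have "\<bar>cutoff (Suc n) x\<bar> \<le> B" for x
    using B cutoff_eq_0[of x "Suc n"] cutoff_Suc_eq_0[of x n] by (cases "x \<le> 1"; cases "x \<ge> 2") auto
  with B(1) show ?thesis using that by blast
qed

section \<open>Functions given with all their derivatives\<close>

definition derivs_on :: "real set \<Rightarrow> (nat \<Rightarrow> real \<Rightarrow> real) \<Rightarrow> bool" where
  "derivs_on S D \<longleftrightarrow> (\<forall>n. \<forall>x\<in>S. (D n has_real_derivative D (Suc n) x) (at x within S))"

lemma derivs_onD: "derivs_on S D \<Longrightarrow> x \<in> S \<Longrightarrow> (D n has_real_derivative D (Suc n) x) (at x within S)"
  by (simp add: derivs_on_def)

lemma derivs_on_continuous: "derivs_on S D \<Longrightarrow> continuous_on S (D n)"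
  by (intro DERIV_continuous_on) (auto dest: derivs_onD)

lemma derivs_on_bounded:
  assumes "derivs_on {0..1} D"
  obtains M where "M > 0" "\<And>x. x \<in> {0..1} \<Longrightarrow> \<bar>D n x\<bar> \<le> M"
proof -
  have "compact (D n ` {0..1})"
    by (intro compact_continuous_image derivs_on_continuous[OF assms]) auto
  then show ?thesis using that by (auto dest!: compact_imp_bounded simp: bounded_pos)
qed

fun boundary_values :: "boundary \<Rightarrow> (nat \<Rightarrow> real \<Rightarrow> real) \<Rightarrow> bool" where
  "boundary_values Dirichlet W \<longleftrightarrow> W 0 0 = 0 \<and> W 0 1 = 0"
| "boundary_values Neumann W \<longleftrightarrow> W 1 0 = 0 \<and> W 1 1 = 0"

subsection \<open>The boundary value problem\<close>

text \<open>Variation of constants with the exponentials of rate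
  \<open>k = sqrt \<alpha> / \<delta>\<close>. Because \<open>\<alpha> > 0\<close>, neither boundary
  condition admits a zero mode, which shows as \<open>sinh k \<noteq> 0\<close>.\<close>

lemma ex_ode_solution:
  fixes \<delta> \<alpha> :: real
  assumes "\<delta> > 0" "\<alpha> > 0" and D: "derivs_on {0..1} D"
  obtains W where "derivs_on {0..1} W" "\<And>x. - \<delta>\<^sup>2 * W 2 x + \<alpha> * W 0 x = D 0 x" "boundary_values bc W"
proof -
  define k where "k = sqrt \<alpha> / \<delta>"
  have k: "k > 0" "k\<^sup>2 * \<delta>\<^sup>2 = \<alpha>" using assms by (auto simp: k_def power_divide)
  define P where "P = (\<lambda>x. integral {0..x} (\<lambda>y. exp (- k * y) * D 0 y))"
  define Q where "Q = (\<lambda>x. integral {0..x} (\<lambda>y. exp (k * y) * D 0 y))"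
  have dP: "(P has_real_derivative exp (- k * x) * D 0 x) (at x within {0..1})" if "x \<in> {0..1}" for x
    unfolding P_def using that
    by (intro integral_has_real_derivative continuous_intros derivs_on_continuous[OF D]) auto
  have dQ: "(Q has_real_derivative exp (k * x) * D 0 x) (at x within {0..1})" if "x \<in> {0..1}" for x
    unfolding Q_def using that
    by (intro integral_has_real_derivative continuous_intros derivs_on_continuous[OF D]) auto
  \<comment> \<open>The term \<open>- 2 * k * c * D 0 x\<close> produced by differentiating
    \<open>w1\<close> must equal \<open>- D 0 x / \<delta>\<^sup>2\<close>.\<close>
  define c where "c = 1 / (2 * \<delta>\<^sup>2 * k)"
  have c: "2 * k * c = 1 / \<delta>\<^sup>2" using k by (simp add: c_def)
  define w where "w = (\<lambda>a b x. c * (exp (- k * x) * Q x - exp (k * x) * P x) + a * cosh (k * x) + b * sinh (k * x))"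
  define w1 where "w1 = (\<lambda>a b x. - k * c * (exp (k * x) * P x + exp (- k * x) * Q x) + a * k * sinh (k * x) + b * k * cosh (k * x))"
  have ee: "exp (k * x) * exp (- k * x) = 1" "exp (- k * x) * exp (k * x) = 1" for x
    by (simp_all flip: exp_add)
  have ex: "((\<lambda>x. exp (k * x)) has_real_derivative k * exp (k * x)) (at x within {0..1})"
    "((\<lambda>x. exp (- k * x)) has_real_derivative - k * exp (- k * x)) (at x within {0..1})"
    "((\<lambda>x. sinh (k * x)) has_real_derivative k * cosh (k * x)) (at x within {0..1})"
    "((\<lambda>x. cosh (k * x)) has_real_derivative k * sinh (k * x)) (at x within {0..1})" for x
    by (auto intro!: derivative_eq_intros)
  have dEP: "((\<lambda>x. exp (k * x) * P x) has_real_derivative k * (exp (k * x) * P x) + D 0 x) (at x within {0..1})"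
    and dEQ: "((\<lambda>x. exp (- k * x) * Q x) has_real_derivative - k * (exp (- k * x) * Q x) + D 0 x) (at x within {0..1})"
    if x: "x \<in> {0..1}" for x
  proof -
    have 1: "exp (- k * x) * D 0 x * exp (k * x) = D 0 x * (exp (- k * x) * exp (k * x))"
      "exp (k * x) * D 0 x * exp (- k * x) = D 0 x * (exp (k * x) * exp (- k * x))"
      by (simp_all only: mult_ac)
    show "((\<lambda>x. exp (k * x) * P x) has_real_derivative k * (exp (k * x) * P x) + D 0 x) (at x within {0..1})"
      by (rule DERIV_cong[OF DERIV_mult[OF ex(1) dP[OF x]]]) (simp only: 1 ee mult_1_right mult.assoc[of k] mult.assoc[of "- k"])
    show "((\<lambda>x. exp (- k * x) * Q x) has_real_derivative - k * (exp (- k * x) * Q x) + D 0 x) (at x within {0..1})"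
      by (rule DERIV_cong[OF DERIV_mult[OF ex(2) dQ[OF x]]]) (simp only: 1 ee mult_1_right mult.assoc[of k] mult.assoc[of "- k"])
  qed
  have dw: "(w a b has_real_derivative w1 a b x) (at x within {0..1})" if x: "x \<in> {0..1}" for a b x
    unfolding w_def
    by (rule DERIV_cong[OF DERIV_add[OF DERIV_add[OF DERIV_cmult[OF DERIV_diff[OF dEQ[OF x] dEP[OF x]]] DERIV_cmult[OF ex(4)]] DERIV_cmult[OF ex(3)]]])
       (simp add: w1_def algebra_simps)
  have dw1: "(w1 a b has_real_derivative k\<^sup>2 * w a b x - D 0 x / \<delta>\<^sup>2) (at x within {0..1})" if x: "x \<in> {0..1}" for a b x
  proof -
    have "D 0 x / \<delta>\<^sup>2 = 2 * k * c * D 0 x" using c by simp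
    then show ?thesis
    unfolding w1_def
    by (intro DERIV_cong[OF DERIV_add[OF DERIV_add[OF DERIV_cmult[OF DERIV_add[OF dEP[OF x] dEQ[OF x]]] DERIV_cmult[OF ex(3)]] DERIV_cmult[OF ex(4)]]])
       (simp add: w_def algebra_simps power2_eq_square)
  qed
  \<comment> \<open>At 0 both \<open>P\<close> and \<open>Q\<close> vanish, so omitting
    \<open>cosh\<close> (Dirichlet) or \<open>sinh\<close> (Neumann) settles the left end; the other
    coefficient is solved for at 1.\<close>
  have "\<exists>a b. boundary_values bc (\<lambda>n. if n = 0 then w a b else w1 a b)"
  proof (cases bc)
    case Dirichlet
    have "sinh k \<noteq> 0" using k by simp
    then show ?thesis using Dirichlet
      by (intro exI[of _ 0] exI[of _ "- w 0 0 1 / sinh k"]) (simp add: w_def P_def Q_def)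
  next
    case Neumann
    have "sinh k \<noteq> 0" using k by simp
    then show ?thesis using Neumann k
      by (intro exI[of _ "- w1 0 0 1 / (k * sinh k)"] exI[of _ 0]) (simp add: w1_def P_def Q_def)
  qed
  then obtain a b where bv: "boundary_values bc (\<lambda>n. if n = 0 then w a b else w1 a b)" by blast
  \<comment> \<open>The equation itself yields the higher derivatives: index \<open>n + 2\<close> is
    \<open>k\<^sup>2\<close> times index \<open>n\<close> minus
    \<open>D n / \<delta>\<^sup>2\<close>. Pairs of consecutive derivatives turn this into a
    primitive recursion.\<close>
  define W where "W = rec_nat (w a b, w1 a b) (\<lambda>n p. (snd p, \<lambda>x. k\<^sup>2 * fst p x - D n x / \<delta>\<^sup>2))"
  have W0: "fst (W 0) = w a b" "snd (W 0) = w1 a b" and WS: "fst (W (Suc n)) = snd (W n)"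
    "snd (W (Suc n)) = (\<lambda>x. k\<^sup>2 * fst (W n) x - D n x / \<delta>\<^sup>2)" for n
    by (simp_all add: W_def)
  have der: "(fst (W n) has_real_derivative snd (W n) x) (at x within {0..1}) \<and>
      (snd (W n) has_real_derivative snd (W (Suc n)) x) (at x within {0..1})" if x: "x \<in> {0..1}" for n x
  proof (induction n)
    case 0
    show ?case using dw[OF x] dw1[OF x] by (simp add: W0 WS)
  next
    case (Suc n)
    then have "(snd (W (Suc n)) has_real_derivative k\<^sup>2 * snd (W n) x - D (Suc n) x / \<delta>\<^sup>2) (at x within {0..1})"
      unfolding WS(2)[of n] by (intro DERIV_diff DERIV_cmult DERIV_cdivide derivs_onD[OF D x]) auto
    with Suc show ?case by (simp add: WS)
  qed
  show ?thesis
  proof (rule that[of "\<lambda>n. fst (W n)"])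
    show "derivs_on {0..1} (\<lambda>n. fst (W n))" using der by (simp add: derivs_on_def WS)
    show "- \<delta>\<^sup>2 * fst (W 2) x + \<alpha> * fst (W 0) x = D 0 x" for x
      using k assms by (simp add: numeral_2_eq_2 W0 WS field_simps)
    show "boundary_values bc (\<lambda>n. fst (W n))"
      using bv by (cases bc) (simp_all add: W0 WS)
  qed
qed

subsection \<open>Boundary layers of the cutoff\<close>

lemma integral_reflect_unit:
  fixes f :: "real \<Rightarrow> real"
  shows "integral {0..1} (\<lambda>x. f (1 - x)) = integral {0..1} f"
proof -
  have "integral {-1..0} (\<lambda>x. f (1 - - x)) = integral {0..1} (\<lambda>x. f (1 - x))"
    using Henstock_Kurzweil_Integration.integral_reflect_real[of 1 0 "\<lambda>x. f (1 - x)"] by (simp only: minus_zero)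
  then have "integral {0..1} (\<lambda>x. f (1 - x)) = integral {-1..0} (\<lambda>x. f (x + 1))"
    by (simp only: diff_minus_eq_add add.commute[of 1])
  also have "\<dots> = integral {0..1} f"
    using integral_shift_real_ivl[of 0 1 1 f] by simp
  finally show ?thesis .
qed

text \<open>What is left of \<open>(\<chi> W)''\<close> besides \<open>\<chi> W''\<close>, with
  \<open>\<chi>\<close> the cutoff at scale \<open>e\<close>: the terms
  \<open>2 \<chi>' W' + \<chi>'' W\<close>, concentrated on \<open>{e..2 * e}\<close>.\<close>

definition layer :: "real \<Rightarrow> real \<Rightarrow> (nat \<Rightarrow> real \<Rightarrow> real) \<Rightarrow> real \<Rightarrow> real" where
  "layer e x W y = 2 * (cutoff 1 (x / e) / e) * W 1 y + cutoff 2 (x / e) / e\<^sup>2 * W 0 y"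

lemma cutoff_scaled_has_derivative:
  assumes "e > 0"
  shows "((\<lambda>x. cutoff n (x / e) / e ^ n) has_real_derivative cutoff (Suc n) (x / e) / e ^ Suc n) (at x within S)"
proof -
  have "((\<lambda>x. cutoff n (x / e)) has_real_derivative cutoff (Suc n) (x / e) * (1 / e)) (at x within S)"
    using assms by (intro DERIV_chain2[OF cutoff_has_derivative]) (auto intro!: derivative_eq_intros)
  from DERIV_cdivide[OF this, of "e ^ n"] show ?thesis using assms by (simp add: field_simps)
qed

lemma layer_eq_0: "e > 0 \<Longrightarrow> x \<le> e \<or> x \<ge> 2 * e \<Longrightarrow> layer e x W y = 0"
  using cutoff_eq_0[of "x / e"] cutoff_Suc_eq_0[of "x / e" 0] cutoff_Suc_eq_0[of "x / e" 1]
  by (auto simp: layer_def numeral_2_eq_2 field_simps)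

lemma layer_continuous:
  assumes "derivs_on {0..1} W" "e > 0"
  shows "continuous_on {0..1} (\<lambda>x. layer e x W x)"
  unfolding layer_def using assms
  by (intro continuous_intros derivs_on_continuous[OF assms(1)] continuous_on_compose2[OF cutoff_continuous[of UNIV]]) auto

text \<open>
  The weight \<open>g\<close> is the deviation of a solution from its boundary value \<open>g0\<close>; the two
  hypotheses are what either boundary condition provides.
\<close>

lemma layer_integral_tendsto_0:
  assumes W: "derivs_on {0..1} W" and g: "continuous_on {0..1} g"
    and small: "\<And>\<eta>. \<eta> > 0 \<Longrightarrow> \<exists>r>0. \<forall>x. 0 < x \<and> x < r \<longrightarrow> \<bar>g x\<bar> * (\<bar>W 0 x\<bar> + x * \<bar>W 1 x\<bar>) \<le> \<eta> * x"
    and g0: "g0 = 0 \<or> W 1 0 = 0"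
  shows "((\<lambda>e. integral {0..1} (\<lambda>x. (g0 + g x) * layer e x W x)) \<longlongrightarrow> 0) (at_right 0)"
proof -
  obtain B1 where B1: "B1 > 0" "\<And>x. \<bar>cutoff 1 x\<bar> \<le> B1" using cutoff_bounded[of 0] by (metis One_nat_def)
  obtain B2 where B2: "B2 > 0" "\<And>x. \<bar>cutoff 2 x\<bar> \<le> B2" using cutoff_bounded[of 1] by (metis Suc_1)
  define B where "B = B1 + B2"
  have B: "B > 0" "\<bar>cutoff 1 x\<bar> \<le> B" "\<bar>cutoff 2 x\<bar> \<le> B" for x
    using B1 B2 B1(2)[of x] B2(2)[of x] unfolding B_def by linarith+
  obtain M where M: "M > 0" "\<And>x. x \<in> {0..1} \<Longrightarrow> \<bar>W 2 x\<bar> \<le> M" using derivs_on_bounded[OF W] by blast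
  \<comment> \<open>A layer has width \<open>e\<close>, so a bound \<open>K\<close> on it
    contributes \<open>K * e\<close>.\<close>
  have small_interval: "\<bar>integral {0..1} f\<bar> \<le> K * e"
    if f: "continuous_on {0..1} f" "\<And>x. x \<in> {0..1} \<Longrightarrow> x \<le> e \<or> x \<ge> 2 * e \<Longrightarrow> f x = 0"
      "\<And>x. e \<le> x \<Longrightarrow> x \<le> 2 * e \<Longrightarrow> \<bar>f x\<bar> \<le> K" and e: "0 < e" "e < 1/2" and K: "K \<ge> 0" for f :: "real \<Rightarrow> real" and K e
  proof -
    have "integral {0..1} f = integral {e..2 * e} f"
    proof -
      have i: "f integrable_on {0..1}" by (rule integrable_continuous_real[OF f(1)])
      have "integral {0..1} f = integral {0..e} f + integral {e..1} f"
        using e i by (intro Henstock_Kurzweil_Integration.integral_combine[symmetric]) auto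
      moreover have "integral {e..1} f = integral {e..2 * e} f + integral {2 * e..1} f"
        using e i by (intro Henstock_Kurzweil_Integration.integral_combine[symmetric] integrable_subinterval_real[OF i]) auto
      moreover have "integral {0..e} f = 0"
        using f(2) e by (intro integral_unique has_integral_is_0) auto
      moreover have "integral {2 * e..1} f = 0"
        using f(2) e by (intro integral_unique has_integral_is_0) auto
      ultimately show ?thesis by simp
    qed
    also have "\<bar>\<dots>\<bar> \<le> K * (2 * e - e)"
      using integral_bound[of e "2 * e" f K] f(3) e continuous_on_subset[OF f(1), of "{e..2 * e}"] by auto
    finally show ?thesis using e by simp
  qed
  have cl: "continuous_on {0..1} (\<lambda>x. layer e x W x)" if "e > 0" for e
    by (rule layer_continuous[OF W that])
  have 1: "((\<lambda>e. integral {0..1} (\<lambda>x. g x * layer e x W x)) \<longlongrightarrow> 0) (at_right 0)"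
  proof (rule tendstoI)
    fix \<epsilon> :: real assume \<epsilon>: "\<epsilon> > 0"
    \<comment> \<open>Makes the final bound \<open>4 * B * \<eta>\<close> equal to
      \<open>\<epsilon> / 2\<close>.\<close>
    define \<eta> where "\<eta> = \<epsilon> / (8 * B)"
    have \<eta>: "\<eta> > 0" using \<epsilon> B by (simp add: \<eta>_def)
    obtain r where r: "r > 0" "\<And>x. 0 < x \<Longrightarrow> x < r \<Longrightarrow> \<bar>g x\<bar> * (\<bar>W 0 x\<bar> + x * \<bar>W 1 x\<bar>) \<le> \<eta> * x"
      using small[OF \<eta>] by blast
    have "eventually (\<lambda>e. e > 0 \<and> e < min (1/2) (r/2)) (at_right (0 :: real))"
      using r by (auto simp: eventually_at_right_field intro!: exI[of _ "min (1/2) (r/2)"])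
    then show "eventually (\<lambda>e. dist (integral {0..1} (\<lambda>x. g x * layer e x W x)) 0 < \<epsilon>) (at_right 0)"
    proof eventually_elim
      case (elim e)
      then have e: "e > 0" "e < 1/2" "2 * e < r" by auto
      have "\<bar>g x * layer e x W x\<bar> \<le> 4 * B * \<eta> / e" if x: "e \<le> x" "x \<le> 2 * e" for x
      proof -
        have x0: "x > 0" "x < r" using x e by auto
        have i: "1 / e \<le> 2 / x" using x e x0 by (simp add: field_simps)
        \<comment> \<open>On the layer \<open>1 / e \<le> 2 / x\<close>, so the scale is traded for
          the distance to the end point and \<open>small\<close> applies.\<close>
        have "\<bar>layer e x W x\<bar> \<le> 2 * (B * (2 / x)) * \<bar>W 1 x\<bar> + B * (2 / x)\<^sup>2 * \<bar>W 0 x\<bar>"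
        proof -
          have c1: "\<bar>cutoff 1 (x / e) / e\<bar> \<le> B * (2 / x)"
            using mult_mono[OF B(2)[of "x / e"] i] B(1) e by simp
          have "(1 / e)\<^sup>2 \<le> (2 / x)\<^sup>2" using i e by (intro power_mono) auto
          then have c2: "\<bar>cutoff 2 (x / e) / e\<^sup>2\<bar> \<le> B * (2 / x)\<^sup>2"
            using mult_mono[OF B(3)[of "x / e"], of "(1 / e)\<^sup>2" "(2 / x)\<^sup>2"] B(1) e by (simp add: power_divide)
          have "\<bar>layer e x W x\<bar> \<le> \<bar>2 * (cutoff 1 (x / e) / e) * W 1 x\<bar> + \<bar>cutoff 2 (x / e) / e\<^sup>2 * W 0 x\<bar>"
            unfolding layer_def by (rule abs_triangle_ineq)
          also have "\<dots> = 2 * \<bar>cutoff 1 (x / e) / e\<bar> * \<bar>W 1 x\<bar> + \<bar>cutoff 2 (x / e) / e\<^sup>2\<bar> * \<bar>W 0 x\<bar>"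
            by (simp only: abs_mult abs_numeral)
          also have "\<dots> \<le> 2 * (B * (2 / x)) * \<bar>W 1 x\<bar> + B * (2 / x)\<^sup>2 * \<bar>W 0 x\<bar>"
            using c1 c2 by (intro add_mono mult_right_mono mult_left_mono) auto
          finally show ?thesis .
        qed
        also have "\<dots> = 4 * B / x\<^sup>2 * (\<bar>W 0 x\<bar> + x * \<bar>W 1 x\<bar>)"
          using x0 by (simp add: field_simps power2_eq_square)
        finally have "\<bar>g x * layer e x W x\<bar> \<le> \<bar>g x\<bar> * (4 * B / x\<^sup>2 * (\<bar>W 0 x\<bar> + x * \<bar>W 1 x\<bar>))"
          unfolding abs_mult by (rule mult_left_mono) simp
        also have "\<dots> = 4 * B / x\<^sup>2 * (\<bar>g x\<bar> * (\<bar>W 0 x\<bar> + x * \<bar>W 1 x\<bar>))" by simp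
        also have "\<dots> \<le> 4 * B / x\<^sup>2 * (\<eta> * x)"
          using r(2)[OF x0] B by (intro mult_left_mono) auto
        also have "\<dots> = 4 * B * \<eta> / x" using x0 by (simp add: power2_eq_square)
        also have "\<dots> \<le> 4 * B * \<eta> / e" using x e x0 B \<eta> by (intro divide_left_mono) auto
        finally show ?thesis .
      qed
      then have "\<bar>integral {0..1} (\<lambda>x. g x * layer e x W x)\<bar> \<le> (4 * B * \<eta> / e) * e"
        using e B \<eta> by (intro small_interval continuous_on_mult g cl) (auto simp: layer_eq_0)
      also have "\<dots> = \<epsilon> / 2" using e B by (simp add: \<eta>_def)
      finally show ?case using \<epsilon> by (simp add: dist_real_def)
    qed
  qed
  have 2: "((\<lambda>e. g0 * integral {0..1} (\<lambda>x. layer e x W x)) \<longlongrightarrow> 0) (at_right 0)"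
    using g0
  proof
    assume W10: "W 1 0 = 0"
    have W1: "\<bar>W 1 x\<bar> \<le> M * x" if "x \<in> {0..1}" for x
    proof -
      have "norm (W 1 x - W 1 0) \<le> M * norm (x - 0)"
        by (rule field_differentiable_bound[of "{0..1}" "W 1" "W 2"])
           (use that M derivs_onD[OF W, of _ 1] in \<open>auto simp: numeral_2_eq_2\<close>)
      then show ?thesis using W10 that by simp
    qed
    have bound: "\<bar>integral {0..1} (\<lambda>x. layer e x W x)\<bar> \<le> 2 * B * M * e" if e: "0 < e" "e < 1/2" for e
    proof -
      let ?c = "\<lambda>x. cutoff 1 (x / e) / e"
      have cc: "continuous_on {0..1} ?c"
        using e by (intro continuous_intros continuous_on_compose2[OF cutoff_continuous[of UNIV]]) auto
      \<comment> \<open>\<open>2 \<chi>' W' + \<chi>'' W = (\<chi>' W)' + \<chi>' W'\<close>: the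
        total derivative integrates to 0, and \<open>W' = 0\<close> at the end point compensates the
        factor \<open>1 / e\<close> in the rest. Bounding \<open>\<chi>'' W\<close> directly would
        leave order \<open>1 / e\<close> after integration.\<close>
      have "((\<lambda>x. cutoff 2 (x / e) / e\<^sup>2 * W 0 x + ?c x * W 1 x) has_integral ?c 1 * W 0 1 - ?c 0 * W 0 0) {0..1}"
      proof (rule fundamental_theorem_of_calculus)
        fix x :: real assume x: "x \<in> {0..1}"
        have "(?c has_real_derivative cutoff 2 (x / e) / e\<^sup>2) (at x within {0..1})"
          using cutoff_scaled_has_derivative[OF e(1), of 1 x "{0..1}"] by (simp add: numeral_2_eq_2)
        from DERIV_mult[OF this derivs_onD[OF W x, of 0]]
        show "((\<lambda>x. ?c x * W 0 x) has_vector_derivative cutoff 2 (x / e) / e\<^sup>2 * W 0 x + ?c x * W 1 x) (at x within {0..1})"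
          by (simp add: has_real_derivative_iff_has_vector_derivative mult_ac add_ac)
      qed simp
      moreover have "?c 1 = 0" "?c 0 = 0"
        using cutoff_eq_0[of 0 1] cutoff_Suc_eq_0[of "1 / e" 0] e by (auto simp: field_simps)
      ultimately have "((\<lambda>x. cutoff 2 (x / e) / e\<^sup>2 * W 0 x + ?c x * W 1 x) has_integral 0) {0..1}"
        by (simp only: mult_zero_left diff_self)
      moreover have i: "(\<lambda>x. ?c x * W 1 x) integrable_on {0..1}"
        by (intro integrable_continuous_real continuous_on_mult cc derivs_on_continuous[OF W])
      ultimately have "((\<lambda>x. (cutoff 2 (x / e) / e\<^sup>2 * W 0 x + ?c x * W 1 x) + ?c x * W 1 x) has_integral 0 + integral {0..1} (\<lambda>x. ?c x * W 1 x)) {0..1}"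
        by (intro has_integral_add integrable_integral)
      then have "integral {0..1} (\<lambda>x. layer e x W x) = integral {0..1} (\<lambda>x. ?c x * W 1 x)"
        by (intro integral_unique) (simp add: layer_def algebra_simps)
      also have "\<bar>\<dots>\<bar> \<le> (2 * B * M) * e"
      proof (rule small_interval)
        show "continuous_on {0..1} (\<lambda>x. ?c x * W 1 x)"
          by (intro continuous_on_mult cc derivs_on_continuous[OF W])
        show "?c x * W 1 x = 0" if "x \<le> e \<or> x \<ge> 2 * e" for x
          using that e cutoff_eq_0[of "x / e" 1] cutoff_Suc_eq_0[of "x / e" 0] by (auto simp: field_simps)
        show "\<bar>?c x * W 1 x\<bar> \<le> 2 * B * M" if x: "e \<le> x" "x \<le> 2 * e" for x
        proof -
          have "\<bar>?c x\<bar> \<le> B / e" using B(2)[of "x / e"] e by (simp add: divide_right_mono)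
          moreover have "\<bar>W 1 x\<bar> \<le> M * (2 * e)"
            using order_trans[OF W1[of x] mult_left_mono[of x "2 * e" M]] x e M by auto
          ultimately have "\<bar>?c x\<bar> * \<bar>W 1 x\<bar> \<le> (B / e) * (M * (2 * e))"
            using B e by (intro mult_mono) auto
          then show ?thesis using e by (simp add: abs_mult)
        qed
      qed (use e B M in auto)
      finally show ?thesis by simp
    qed
    have "((\<lambda>e. integral {0..1} (\<lambda>x. layer e x W x)) \<longlongrightarrow> 0) (at_right 0)"
    proof (rule Lim_null_comparison)
      show "eventually (\<lambda>e. norm (integral {0..1} (\<lambda>x. layer e x W x)) \<le> 2 * B * M * e) (at_right 0)"
        using bound by (auto simp: eventually_at_right_field intro!: exI[of _ "1/2"])
      show "((\<lambda>e. 2 * B * M * e) \<longlongrightarrow> 0) (at_right 0)" by (auto intro!: tendsto_eq_intros)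
    qed
    from tendsto_mult_right_zero[OF this] show ?thesis by simp
  qed simp
  have "((\<lambda>e. g0 * integral {0..1} (\<lambda>x. layer e x W x) + integral {0..1} (\<lambda>x. g x * layer e x W x)) \<longlongrightarrow> 0) (at_right 0)"
    using tendsto_add[OF 2 1] by simp
  then show ?thesis
  proof (rule Lim_transform_eventually)
    show "eventually (\<lambda>e. g0 * integral {0..1} (\<lambda>x. layer e x W x) + integral {0..1} (\<lambda>x. g x * layer e x W x) =
       integral {0..1} (\<lambda>x. (g0 + g x) * layer e x W x)) (at_right 0)"
      using eventually_at_right_less[of 0]
    proof eventually_elim
      case (elim e)
      have "integral {0..1} (\<lambda>x. (g0 + g x) * layer e x W x) = integral {0..1} (\<lambda>x. g0 * layer e x W x + g x * layer e x W x)"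
        by (simp add: distrib_right)
      also have "\<dots> = integral {0..1} (\<lambda>x. g0 * layer e x W x) + integral {0..1} (\<lambda>x. g x * layer e x W x)"
        using elim by (intro Henstock_Kurzweil_Integration.integral_add integrable_continuous_real continuous_intros g cl)
      finally show ?case by simp
    qed
  qed
qed

subsection \<open>The Green function\<close>

text \<open>The cutoff derivatives are as large as \<open>1 / x\<^sup>2\<close> over a width
  \<open>x\<close>, so the weighted product must be \<open>o(x)\<close>. Dirichlet: \<open>c\<close>
  is \<open>o(1)\<close> by continuity and \<open>W\<close> is \<open>O(x)\<close>. Neumann:
  \<open>c - c 0\<close> is \<open>o(x)\<close> by the zero derivative, and \<open>W\<close> is
  bounded.\<close>

lemma layer_tendsto_0:
  assumes W: "derivs_on {0..1} W" and c: "continuous_on {0..1} c"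
    and bc: "(c 0 = 0 \<and> W 0 0 = 0) \<or> ((c has_real_derivative 0) (at 0 within {0..1}) \<and> W 1 0 = 0)"
  shows "((\<lambda>e. integral {0..1} (\<lambda>x. c x * layer e x W x)) \<longlongrightarrow> 0) (at_right 0)"
proof -
  obtain M0 where M0: "M0 > 0" "\<And>x. x \<in> {0..1} \<Longrightarrow> \<bar>W 0 x\<bar> \<le> M0" using derivs_on_bounded[OF W] by blast
  obtain M1 where M1: "M1 > 0" "\<And>x. x \<in> {0..1} \<Longrightarrow> \<bar>W 1 x\<bar> \<le> M1" using derivs_on_bounded[OF W] by blast
  define M where "M = M0 + M1"
  have M: "M > 0" "x \<in> {0..1} \<Longrightarrow> \<bar>W 0 x\<bar> \<le> M" "x \<in> {0..1} \<Longrightarrow> \<bar>W 1 x\<bar> \<le> M" for x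
    using M0 M1 M0(2)[of x] M1(2)[of x] unfolding M_def by linarith+
  have "((\<lambda>e. integral {0..1} (\<lambda>x. (c 0 + (c x - c 0)) * layer e x W x)) \<longlongrightarrow> 0) (at_right 0)"
  proof (rule layer_integral_tendsto_0[OF W])
    show "continuous_on {0..1} (\<lambda>x. c x - c 0)" by (intro continuous_intros c)
    show "c 0 = 0 \<or> W 1 0 = 0" using bc by auto
    fix \<eta> :: real assume \<eta>: "\<eta> > 0"
    have q: "\<eta> / (2 * M) > 0" using \<eta> M by simp
    show "\<exists>r>0. \<forall>x. 0 < x \<and> x < r \<longrightarrow> \<bar>c x - c 0\<bar> * (\<bar>W 0 x\<bar> + x * \<bar>W 1 x\<bar>) \<le> \<eta> * x"
      using bc
    proof
      assume a: "c 0 = 0 \<and> W 0 0 = 0"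
      have "(c \<longlongrightarrow> c 0) (at 0 within {0..1})"
        using c by (simp add: continuous_on_def)
      from tendstoD[OF this q] obtain r where r: "r > 0" "\<And>x. x \<in> {0..1} \<Longrightarrow> x \<noteq> 0 \<Longrightarrow> \<bar>x\<bar> < r \<Longrightarrow> \<bar>c x - c 0\<bar> < \<eta> / (2 * M)"
        by (auto simp: eventually_at dist_real_def)
      have W0: "\<bar>W 0 x\<bar> \<le> M * x" if "x \<in> {0..1}" for x
      proof -
        have "norm (W 0 x - W 0 0) \<le> M * norm (x - 0)"
          by (rule field_differentiable_bound[of "{0..1}" "W 0" "W 1"])
             (use that M derivs_onD[OF W, of _ 0] in auto)
        then show ?thesis using a that by simp
      qed
      show ?thesis
      proof (intro exI[of _ "min r 1"] conjI allI impI)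
        fix x assume "0 < x \<and> x < min r 1"
        then have x: "0 < x" "x < r" "x \<in> {0..1}" by auto
        have "\<bar>W 0 x\<bar> + x * \<bar>W 1 x\<bar> \<le> M * x + x * M"
          using W0[OF x(3)] M(3)[OF x(3)] x by (intro add_mono mult_left_mono) auto
        then have "\<bar>c x - c 0\<bar> * (\<bar>W 0 x\<bar> + x * \<bar>W 1 x\<bar>) \<le> \<eta> / (2 * M) * (M * x + x * M)"
          using r(2)[OF x(3)] x q by (intro mult_mono) (auto intro!: add_nonneg_nonneg)
        also have "\<dots> = \<eta> * x" using M by (simp add: field_simps)
        finally show "\<bar>c x - c 0\<bar> * (\<bar>W 0 x\<bar> + x * \<bar>W 1 x\<bar>) \<le> \<eta> * x" .
      qed (use r in auto)
    next
      assume a: "(c has_real_derivative 0) (at 0 within {0..1}) \<and> W 1 0 = 0"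
      then have "((\<lambda>x. (c x - c 0) / (x - 0)) \<longlongrightarrow> 0) (at 0 within {0..1})"
        by (simp add: has_field_derivative_iff)
      from tendstoD[OF this q] obtain r where r: "r > 0" "\<And>x. x \<in> {0..1} \<Longrightarrow> x \<noteq> 0 \<Longrightarrow> \<bar>x\<bar> < r \<Longrightarrow> \<bar>(c x - c 0) / x\<bar> < \<eta> / (2 * M)"
        by (auto simp: eventually_at dist_real_def)
      show ?thesis
      proof (intro exI[of _ "min r 1"] conjI allI impI)
        fix x assume "0 < x \<and> x < min r 1"
        then have x: "0 < x" "x < r" "x \<in> {0..1}" by auto
        have 1: "\<bar>c x - c 0\<bar> \<le> \<eta> / (2 * M) * x"
          using r(2)[OF x(3)] x by (simp add: pos_divide_less_eq abs_divide)
        have "x * \<bar>W 1 x\<bar> \<le> 1 * M" using x M(3)[OF x(3)] by (intro mult_mono) auto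
        then have "\<bar>W 0 x\<bar> + x * \<bar>W 1 x\<bar> \<le> 2 * M" using M(2)[OF x(3)] by simp
        then have "\<bar>c x - c 0\<bar> * (\<bar>W 0 x\<bar> + x * \<bar>W 1 x\<bar>) \<le> (\<eta> / (2 * M) * x) * (2 * M)"
          using 1 x q by (intro mult_mono) (auto intro!: add_nonneg_nonneg)
        also have "\<dots> = \<eta> * x" using M by (simp add: field_simps)
        finally show "\<bar>c x - c 0\<bar> * (\<bar>W 0 x\<bar> + x * \<bar>W 1 x\<bar>) \<le> \<eta> * x" .
      qed (use r in auto)
    qed
  qed
  then show ?thesis by simp
qed

lemma cutoff_tail_tendsto_0:
  assumes h: "continuous_on {0..1} h"
  shows "((\<lambda>e. integral {0..1} (\<lambda>x. (1 - cutoff 0 (x / e)) * h x)) \<longlongrightarrow> 0) (at_right 0)"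
proof -
  have "compact (cutoff 0 ` {0..2})" "compact (h ` {0..1})"
    by (intro compact_continuous_image cutoff_continuous h; simp)+
  then obtain B M where B: "B > 0" "\<And>x. x \<in> {0..2} \<Longrightarrow> \<bar>cutoff 0 x\<bar> \<le> B" and M: "M > 0" "\<And>x. x \<in> {0..1} \<Longrightarrow> \<bar>h x\<bar> \<le> M"
    by (fastforce dest!: compact_imp_bounded simp: bounded_pos)
  have bound: "\<bar>integral {0..1} (\<lambda>x. (1 - cutoff 0 (x / e)) * h x)\<bar> \<le> 2 * (1 + B) * M * e" if e: "0 < e" "e < 1/2" for e
  proof -
    let ?f = "\<lambda>x. (1 - cutoff 0 (x / e)) * h x"
    have cf: "continuous_on {0..1} ?f"
      using e by (intro continuous_intros h continuous_on_compose2[OF cutoff_continuous[of UNIV]]) auto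
    have "integral {0..1} ?f = integral {0..2 * e} ?f + integral {2 * e..1} ?f"
      using e by (intro Henstock_Kurzweil_Integration.integral_combine[symmetric] integrable_continuous_real cf) auto
    moreover have "integral {2 * e..1} ?f = 0"
      using e by (intro integral_unique has_integral_is_0) (auto simp: cutoff_eq_1 field_simps)
    moreover have "\<bar>integral {0..2 * e} ?f\<bar> \<le> ((1 + B) * M) * (2 * e - 0)"
      unfolding real_norm_def[symmetric]
    proof (rule integral_bound)
      show "continuous_on {0..2 * e} ?f" by (rule continuous_on_subset[OF cf]) (use e in auto)
      fix x assume x: "x \<in> {0..2 * e}"
      have "\<bar>1 - cutoff 0 (x / e)\<bar> \<le> 1 + B" using B(2)[of "x / e"] x e by (auto simp: field_simps)
      then show "norm (?f x) \<le> (1 + B) * M"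
        unfolding real_norm_def abs_mult using M(2)[of x] x e by (intro mult_mono) auto
    qed (use e in simp)
    ultimately show ?thesis by (simp add: mult_ac)
  qed
  show ?thesis
  proof (rule Lim_null_comparison)
    show "eventually (\<lambda>e. norm (integral {0..1} (\<lambda>x. (1 - cutoff 0 (x / e)) * h x)) \<le> 2 * (1 + B) * M * e) (at_right 0)"
      using bound by (auto simp: eventually_at_right_field intro!: exI[of _ "1/2"])
    show "((\<lambda>e. 2 * (1 + B) * M * e) \<longlongrightarrow> 0) (at_right 0)" by (auto intro!: tendsto_eq_intros)
  qed
qed

text \<open>For \<open>e \<le> 1/4\<close> the transition zones are disjoint, so subtracting 1 from
  the sum of the one-sided cutoffs gives their product. As a sum it has simple derivatives, and the
  two ends separate. The sign comes from the reflection \<open>1 - x\<close>.\<close>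

definition two_sided_cutoff :: "real \<Rightarrow> nat \<Rightarrow> real \<Rightarrow> real" where
  "two_sided_cutoff e n x =
    cutoff n (x / e) / e ^ n + (-1) ^ n * (cutoff n ((1 - x) / e) / e ^ n) - (if n = 0 then 1 else 0)"

lemma two_sided_cutoff_has_derivative:
  assumes "e > 0"
  shows "(two_sided_cutoff e n has_real_derivative two_sided_cutoff e (Suc n) x) (at x within S)"
proof -
  have "((\<lambda>x. 1 - x) has_real_derivative -1) (at x within S)" by (auto intro!: derivative_eq_intros)
  from DERIV_chain2[OF cutoff_scaled_has_derivative[OF assms, of n "1 - x" UNIV] this]
  have "((\<lambda>x. (-1) ^ n * (cutoff n ((1 - x) / e) / e ^ n)) has_real_derivative
      (-1) ^ n * (cutoff (Suc n) ((1 - x) / e) / e ^ Suc n * -1)) (at x within S)"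
    by (rule DERIV_cmult)
  from DERIV_diff[OF DERIV_add[OF cutoff_scaled_has_derivative[OF assms] this] DERIV_const[of "if n = 0 then 1 else 0"]]
  show ?thesis unfolding two_sided_cutoff_def by simp
qed

lemma two_sided_cutoff_eq_0:
  assumes "0 < e" "e \<le> 1/4" "x \<notin> {e..1 - e}"
  shows "two_sided_cutoff e n x = 0"
proof (cases "x < e")
  case True
  then have "x / e \<le> 1" "(1 - x) / e \<ge> 2" using assms by (auto simp: field_simps)
  then show ?thesis
    by (cases n) (simp_all add: two_sided_cutoff_def cutoff_eq_0 cutoff_eq_1 cutoff_Suc_eq_0)
next
  case False
  then have "(1 - x) / e \<le> 1" "x / e \<ge> 2" using assms by (auto simp: field_simps)
  then show ?thesis
    by (cases n) (simp_all add: two_sided_cutoff_def cutoff_eq_0 cutoff_eq_1 cutoff_Suc_eq_0)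
qed

lemma test_function_cutoff:
  assumes W: "derivs_on {0..1} W" and e: "0 < e" "e \<le> 1/4"
  defines "F \<equiv> leibniz (two_sided_cutoff e) W"
  shows "test_function (F 0)" "deriv (deriv (F 0)) = F 2"
proof -
  have F0: "F n x = 0" if "x \<notin> {e..1 - e}" for n x
    using that e by (simp add: F_def leibniz_def two_sided_cutoff_eq_0)
  \<comment> \<open>\<open>W\<close> is controlled on the unit interval only. Inside, its
    derivatives within the interval are two-sided; elsewhere the cutoff vanishes on a
    neighbourhood.\<close>
  have der: "(F n has_real_derivative F (Suc n) x) (at x)" for n x
  proof (cases "x \<in> {0<..<1}")
    case True
    have "at x within {0..1} = at x"
      using True by (intro at_within_interior) auto
    then have "(W n has_real_derivative W (Suc n) x) (at x)" for n
      using derivs_onD[OF W, of x n] True by simp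
    then show ?thesis unfolding F_def using e
      by (intro leibniz_has_derivative two_sided_cutoff_has_derivative) auto
  next
    case False
    have "((\<lambda>_. 0) has_real_derivative 0) (at x)" by simp
    then have "(F n has_real_derivative 0) (at x)"
      by (rule has_field_derivative_transform_within_open[of _ _ _ "- {e..1 - e}"])
         (use False e F0 in auto)
    moreover have "F (Suc n) x = 0" using False e by (intro F0) auto
    ultimately show ?thesis by simp
  qed
  show "test_function (F 0)"
    unfolding test_function_def
  proof
    show "smooth_on UNIV (F 0)"
      unfolding smooth_on_def by (rule exI[of _ F]) (use der in auto)
    show "\<exists>a b. 0 < a \<and> b < 1 \<and> (\<forall>x. x \<notin> {a..b} \<longrightarrow> F 0 x = 0)"
      by (rule exI[of _ e], rule exI[of _ "1 - e"]) (use e F0 in auto)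
  qed
  have "deriv (F n) = F (Suc n)" for n
    using der by (intro ext DERIV_imp_deriv)
  then show "deriv (deriv (F 0)) = F 2" by (simp add: numeral_2_eq_2)
qed

text \<open>
  The identity is the weak formulation tested with \<open>W\<close>, which is not compactly supported: it is
  cut off near the end points, and the boundary conditions make the error terms vanish.
\<close>

lemma green_function_integral:
  assumes G: "is_green_function bc \<delta> \<alpha> C" and y: "0 < y" "y < 1"
    and W: "derivs_on {0..1} W" and bv: "boundary_values bc W"
  shows "integral {0..1} (\<lambda>x. C x y * (- \<delta>\<^sup>2 * W 2 x + \<alpha> * W 0 x)) = W 0 y"
proof -
  define c where "c = (\<lambda>x. C x y)"
  define f where "f = (\<lambda>x. - \<delta>\<^sup>2 * W 2 x + \<alpha> * W 0 x)"
  \<comment> \<open>Derivatives of the reflected function \<open>W (1 - x)\<close>; with it the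
    right end becomes a second instance of the left one.\<close>
  define V where "V = (\<lambda>n x. (-1) ^ n * W n (1 - x))"
  have c: "continuous_on {0..1} c" and cbc: "satisfies_bc bc c"
    and test: "\<And>\<phi>. test_function \<phi> \<Longrightarrow> integral {0..1} (\<lambda>x. c x * (- \<delta>\<^sup>2 * deriv (deriv \<phi>) x + \<alpha> * \<phi> x)) = \<phi> y"
    using G y unfolding is_green_function_def c_def by auto
  have refl: "(\<lambda>x :: real. 1 - x) ` {0..1} = {0..1}"
    by (auto intro!: image_eqI[where x="1 - _"])
  have c': "continuous_on {0..1} (\<lambda>x. c (1 - x))"
    by (rule continuous_on_compose2[OF c]) (auto intro!: continuous_intros)
  have refl_der: "((\<lambda>x. g (1 - x)) has_real_derivative - D) (at x within {0..1})"
    if "(g has_real_derivative D) (at (1 - x) within {0..1})" for g :: "real \<Rightarrow> real" and D x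
  proof -
    have "((\<lambda>x. 1 - x) has_real_derivative -1) (at x within {0..1})" by (auto intro!: derivative_eq_intros)
    from DERIV_image_chain[OF _ this, of g D] that show ?thesis by (simp add: refl o_def)
  qed
  have V: "derivs_on {0..1} V"
    unfolding derivs_on_def
  proof (intro allI ballI)
    fix n :: nat and x :: real assume "x \<in> {0..1}"
    then have "((\<lambda>x. W n (1 - x)) has_real_derivative - W (Suc n) (1 - x)) (at x within {0..1})"
      by (intro refl_der derivs_onD[OF W]) auto
    from DERIV_cmult[OF this, of "(-1) ^ n"]
    show "(V n has_real_derivative V (Suc n) x) (at x within {0..1})" unfolding V_def by simp
  qed
  have cf: "continuous_on {0..1} (\<lambda>x. c x * f x)"
    unfolding f_def by (intro continuous_intros c derivs_on_continuous[OF W])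
  have cf': "continuous_on {0..1} (\<lambda>x. c (1 - x) * f (1 - x))"
    by (rule continuous_on_compose2[OF cf]) (auto intro!: continuous_intros)
  have L: "((\<lambda>e. integral {0..1} (\<lambda>x. c x * layer e x W x)) \<longlongrightarrow> 0) (at_right 0)"
    using cbc bv by (intro layer_tendsto_0[OF W c]; cases bc) auto
  have R: "((\<lambda>e. integral {0..1} (\<lambda>x. c (1 - x) * layer e x V x)) \<longlongrightarrow> 0) (at_right 0)"
  proof (rule layer_tendsto_0[OF V c'])
    show "(c (1 - 0) = 0 \<and> V 0 0 = 0) \<or> (((\<lambda>x. c (1 - x)) has_real_derivative 0) (at 0 within {0..1}) \<and> V 1 0 = 0)"
      using cbc bv refl_der[of c 0 0] by (cases bc) (auto simp: V_def)
  qed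
  note T1 = cutoff_tail_tendsto_0[OF cf] and T2 = cutoff_tail_tendsto_0[OF cf']
  have "eventually (\<lambda>e. W 0 y = integral {0..1} (\<lambda>x. c x * f x)
      - integral {0..1} (\<lambda>x. (1 - cutoff 0 (x / e)) * (c x * f x))
      - integral {0..1} (\<lambda>x. (1 - cutoff 0 (x / e)) * (c (1 - x) * f (1 - x)))
      - \<delta>\<^sup>2 * integral {0..1} (\<lambda>x. c x * layer e x W x)
      - \<delta>\<^sup>2 * integral {0..1} (\<lambda>x. c (1 - x) * layer e x V x)) (at_right 0)"
  proof -
    have "eventually (\<lambda>e. e > 0 \<and> e < min (1/4) (min (y / 2) ((1 - y) / 2))) (at_right (0 :: real))"
      using y by (auto simp: eventually_at_right_field intro!: exI[of _ "min (1/4) (min (y / 2) ((1 - y) / 2))"])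
    then show ?thesis
    proof eventually_elim
      case (elim e)
      then have e: "e > 0" "e \<le> 1/4" "y / e \<ge> 2" "(1 - y) / e \<ge> 2" by (auto simp: field_simps)
      let ?F = "leibniz (two_sided_cutoff e) W"
      have coeffs: "?F 0 x = two_sided_cutoff e 0 x * W 0 x"
        "?F 2 x = two_sided_cutoff e 0 x * W 2 x + 2 * two_sided_cutoff e 1 x * W 1 x + two_sided_cutoff e 2 x * W 0 x" for x
        by (simp_all add: leibniz_def numeral_2_eq_2)
      have "W 0 y = ?F 0 y" using e by (simp add: coeffs two_sided_cutoff_def cutoff_eq_1)
      also have "\<dots> = integral {0..1} (\<lambda>x. c x * (- \<delta>\<^sup>2 * ?F 2 x + \<alpha> * ?F 0 x))"
        using test[OF test_function_cutoff(1)[OF W e(1,2)]] test_function_cutoff(2)[OF W e(1,2)] by simp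
      \<comment> \<open>The sum form of the cutoff separates the main term, two tails and two
        layers.\<close>
      also have "\<dots> = integral {0..1} (\<lambda>x. c x * f x - (1 - cutoff 0 (x / e)) * (c x * f x)
           - (1 - cutoff 0 ((1 - x) / e)) * (c x * f x)
           - \<delta>\<^sup>2 * (c x * layer e x W x) - \<delta>\<^sup>2 * (c x * layer e (1 - x) V (1 - x)))"
        by (intro arg_cong[where f="integral {0..1}"] ext)
           (simp add: coeffs f_def two_sided_cutoff_def layer_def V_def algebra_simps)
      also have "\<dots> = integral {0..1} (\<lambda>x. c x * f x)
         - integral {0..1} (\<lambda>x. (1 - cutoff 0 (x / e)) * (c x * f x))
         - integral {0..1} (\<lambda>x. (1 - cutoff 0 ((1 - x) / e)) * (c x * f x))
         - \<delta>\<^sup>2 * integral {0..1} (\<lambda>x. c x * layer e x W x)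
         - \<delta>\<^sup>2 * integral {0..1} (\<lambda>x. c x * layer e (1 - x) V (1 - x))"
      proof -
        have k1: "continuous_on {0..1} (\<lambda>x. (1 - cutoff 0 (x / e)) * (c x * f x))"
          using e by (intro continuous_intros cf continuous_on_compose2[OF cutoff_continuous[of UNIV]]) auto
        have k2: "continuous_on {0..1} (\<lambda>x. (1 - cutoff 0 ((1 - x) / e)) * (c x * f x))"
          using e by (intro continuous_intros cf continuous_on_compose2[OF cutoff_continuous[of UNIV]]) auto
        have k3: "continuous_on {0..1} (\<lambda>x. c x * layer e x W x)"
          by (intro continuous_on_mult c layer_continuous[OF W e(1)])
        have k4: "continuous_on {0..1} (\<lambda>x. c x * layer e (1 - x) V (1 - x))"
          by (intro continuous_on_mult c continuous_on_compose2[OF layer_continuous[OF V e(1)]]) (auto intro!: continuous_intros)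
        note int = integrable_integral[OF integrable_continuous_real]
        show ?thesis
          by (intro integral_unique has_integral_diff has_integral_mult_right int cf k1 k2 k3 k4)
      qed
      also have "integral {0..1} (\<lambda>x. (1 - cutoff 0 ((1 - x) / e)) * (c x * f x)) =
          integral {0..1} (\<lambda>x. (1 - cutoff 0 (x / e)) * (c (1 - x) * f (1 - x)))"
        using integral_reflect_unit[of "\<lambda>x. (1 - cutoff 0 ((1 - x) / e)) * (c x * f x)"] by simp
      also have "integral {0..1} (\<lambda>x. c x * layer e (1 - x) V (1 - x)) = integral {0..1} (\<lambda>x. c (1 - x) * layer e x V x)"
        using integral_reflect_unit[of "\<lambda>x. c x * layer e (1 - x) V (1 - x)"] by simp
      finally show ?case .
    qed
  qed
  then have "((\<lambda>_. W 0 y) \<longlongrightarrow> integral {0..1} (\<lambda>x. c x * f x) - 0 - 0 - \<delta>\<^sup>2 * 0 - \<delta>\<^sup>2 * 0) (at_right (0 :: real))"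
    by (simp only: tendsto_cong) (intro tendsto_intros T1 T2 L R)
  then have "W 0 y = integral {0..1} (\<lambda>x. c x * f x)"
    using tendsto_unique[OF _ tendsto_const] by (simp add: tendsto_const_iff)
  then show ?thesis by (simp add: c_def f_def)
qed

subsection \<open>The difference scheme\<close>

text \<open>Left-endpoint sums over \<open>N + 1\<close> cells have error
  \<open>M * h\<^sup>2\<close> per cell, by Taylor expansion of the primitive. The sum here omits
  \<open>j = 0\<close> and has weight \<open>1 / N\<close> for \<open>1 / (N + 1)\<close>; both
  discrepancies vanish.\<close>

lemma riemann_sum_grid:
  fixes f :: "real \<Rightarrow> real"
  assumes D: "derivs_on {0..1} D"
  shows "(\<lambda>N. 1 / real N * (\<Sum>j=1..N. D 0 (grid N j))) \<longlonglongrightarrow> integral {0..1} (D 0)"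
proof -
  define F where "F = (\<lambda>x. integral {0..x} (D 0))"
  obtain M where M: "M > 0" "\<And>x. x \<in> {0..1} \<Longrightarrow> \<bar>D 1 x\<bar> \<le> M" using derivs_on_bounded[OF D] by blast
  have dF: "(F has_real_derivative D 0 x) (at x within {0..1})" if "x \<in> {0..1}" for x
    unfolding F_def using that by (intro integral_has_real_derivative derivs_on_continuous[OF D])
  have step: "\<bar>F y - F x - D 0 x * (y - x)\<bar> \<le> M * (y - x)\<^sup>2" if "x \<in> {0..1}" "y \<in> {0..1}" for x y
  proof -
    let ?f = "\<lambda>i. case i of 0 \<Rightarrow> F | Suc n \<Rightarrow> D n"
    have "norm (?f 0 y - (\<Sum>i\<le>1. ?f i x * (y - x) ^ i / fact i)) \<le> M * norm (y - x) ^ Suc 1 / fact 1"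
    proof (rule field_Taylor[of "{0..1}"])
      fix i :: nat and x :: real assume "x \<in> {0..1}" "i \<le> 1"
      then show "(?f i has_real_derivative ?f (Suc i) x) (at x within {0..1})"
        using dF derivs_onD[OF D] by (cases i) auto
    qed (use that M in \<open>auto simp: numeral_2_eq_2\<close>)
    then show ?thesis by (simp add: power2_eq_square algebra_simps)
  qed
  define h where "h = (\<lambda>N. 1 / real (N + 1))"
  define R where "R = (\<lambda>N. h N * (\<Sum>j=0..N. D 0 (grid N j)))"
  have err: "\<bar>F 1 - F 0 - R N\<bar> \<le> M * h N" for N
  proof -
    have g: "grid N j \<in> {0..1}" if "j \<le> N + 1" for j using that by (simp add: grid_def)
    have gs: "grid N (Suc j) - grid N j = h N" for j by (simp add: grid_def h_def field_simps)
    have "F 1 - F 0 = (\<Sum>j<Suc N. F (grid N (Suc j)) - F (grid N j))"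
      by (subst sum_lessThan_telescope) (simp add: grid_def)
    also have "\<dots> = (\<Sum>j=0..N. F (grid N (Suc j)) - F (grid N j))"
      by (intro sum.cong) auto
    finally have "F 1 - F 0 - R N = (\<Sum>j=0..N. F (grid N (Suc j)) - F (grid N j) - D 0 (grid N j) * h N)"
      by (simp add: R_def sum_subtractf sum_distrib_left mult.commute)
    also have "\<bar>\<dots>\<bar> \<le> (\<Sum>j=0..N. \<bar>F (grid N (Suc j)) - F (grid N j) - D 0 (grid N j) * h N\<bar>)"
      by (rule sum_abs)
    also have "\<dots> \<le> (\<Sum>j=0..N. M * (h N)\<^sup>2)"
    proof (rule sum_mono)
      fix j assume "j \<in> {0..N}"
      then have "grid N j \<in> {0..1}" "grid N (Suc j) \<in> {0..1}" by (intro g; simp)+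
      from step[OF this] show "\<bar>F (grid N (Suc j)) - F (grid N j) - D 0 (grid N j) * h N\<bar> \<le> M * (h N)\<^sup>2"
        by (simp only: gs)
    qed
    also have "\<dots> = M * (real (N + 1) * h N) * h N" by (simp add: power2_eq_square)
    also have "\<dots> = M * h N" unfolding h_def by simp
    finally show ?thesis .
  qed
  have h0: "h \<longlonglongrightarrow> 0" unfolding h_def by real_asymp
  have "R \<longlonglongrightarrow> F 1 - F 0"
  proof (rule LIM_zero_cancel, rule Lim_null_comparison)
    show "eventually (\<lambda>N. norm (R N - (F 1 - F 0)) \<le> M * h N) sequentially"
      using err by (auto simp: abs_minus_commute)
    show "(\<lambda>N. M * h N) \<longlonglongrightarrow> 0" using tendsto_mult_right_zero[OF h0] .
  qed
  moreover have "(\<lambda>N. real (N + 1) / real N) \<longlonglongrightarrow> 1" by real_asymp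
  ultimately have "(\<lambda>N. real (N + 1) / real N * (R N - h N * D 0 0)) \<longlonglongrightarrow> 1 * (F 1 - F 0 - 0 * D 0 0)"
    by (intro tendsto_intros h0)
  moreover have "real (N + 1) / real N * (R N - h N * D 0 0) = 1 / real N * (\<Sum>j=1..N. D 0 (grid N j))" for N
  proof -
    have "(\<Sum>j=0..N. D 0 (grid N j)) = D 0 0 + (\<Sum>j=1..N. D 0 (grid N j))"
      by (subst sum.atLeast_Suc_atMost) (simp_all add: grid_def)
    then have "R N - h N * D 0 0 = h N * (\<Sum>j=1..N. D 0 (grid N j))"
      by (simp add: R_def distrib_left)
    then show ?thesis by (simp add: h_def)
  qed
  ultimately have "(\<lambda>N. 1 / real N * (\<Sum>j=1..N. D 0 (grid N j))) \<longlonglongrightarrow> 1 * (F 1 - F 0 - 0 * D 0 0)"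
    by (simp only:)
  then show ?thesis by (simp add: F_def)
qed

definition node :: "boundary \<Rightarrow> nat \<Rightarrow> nat \<Rightarrow> real" where
  "node bc N j = (case bc of Dirichlet \<Rightarrow> real j / real (N + 1) | Neumann \<Rightarrow> (real j - 1/2) / real N)"

lemma node_in_unit: "N \<ge> 1 \<Longrightarrow> j \<in> {1..N} \<Longrightarrow> node bc N j \<in> {0..1}"
  by (cases bc) (auto simp: node_def field_simps)

text \<open>The test functions are sampled on \<open>grid\<close>, the scheme on
  \<open>node\<close>; for Lipschitz functions the mismatch is of the order of the consistency
  error.\<close>

lemma node_near_grid:
  assumes "N \<ge> 1" "j \<in> {1..N}"
  shows "\<bar>node bc N j - grid N j\<bar> \<le> 1 / real N"
proof (cases bc)
  case Dirichlet
  then show ?thesis using assms by (simp add: node_def grid_def)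
next
  case Neumann
  have N: "real N > 0" "real N + 1 > 0" using assms by auto
  have "(real j - 1/2) / real N - real j / (real N + 1) = ((real j - 1/2) * (real N + 1) - real j * real N) / (real N * (real N + 1))"
    using N by (simp add: diff_frac_eq)
  also have "(real j - 1/2) * (real N + 1) - real j * real N = real j - (real N + 1) / 2"
    by (simp add: algebra_simps)
  finally have "\<bar>node bc N j - grid N j\<bar> = \<bar>real j - (real N + 1) / 2\<bar> / (real N * (real N + 1))"
    using Neumann N by (simp add: node_def grid_def abs_divide abs_mult add.commute)
  also have "\<dots> \<le> (real N + 1) / (real N * (real N + 1))"
    using assms N by (intro divide_right_mono) (auto simp: abs_le_iff field_simps)
  also have "\<dots> = 1 / real N" using N by simp
  finally show ?thesis .
qed

lemma derivs_on_lipschitz: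
  assumes W: "derivs_on {0..1} W"
  obtains M where "M > 0" "\<And>x y. x \<in> {0..1} \<Longrightarrow> y \<in> {0..1} \<Longrightarrow> \<bar>W n x - W n y\<bar> \<le> M * \<bar>x - y\<bar>"
proof -
  obtain M where M: "M > 0" "\<And>x. x \<in> {0..1} \<Longrightarrow> \<bar>W (Suc n) x\<bar> \<le> M" using derivs_on_bounded[OF W] by blast
  have "norm (W n x - W n y) \<le> M * norm (x - y)" if "x \<in> {0..1}" "y \<in> {0..1}" for x y
    by (rule field_differentiable_bound[of "{0..1}" "W n" "W (Suc n)"])
       (use that M derivs_onD[OF W] in auto)
  with M(1) show ?thesis using that by auto
qed

lemma derivs_on_taylor1:
  assumes W: "derivs_on {0..1} W"
  obtains M where "M > 0"
    "\<And>x y. x \<in> {0..1} \<Longrightarrow> y \<in> {0..1} \<Longrightarrow> \<bar>W n y - W n x - W (Suc n) x * (y - x)\<bar> \<le> M * \<bar>y - x\<bar> ^ 2"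
proof -
  obtain M where M: "M > 0" "\<And>x. x \<in> {0..1} \<Longrightarrow> \<bar>W (Suc (Suc n)) x\<bar> \<le> M" using derivs_on_bounded[OF W] by blast
  have "norm (W (n + 0) y - (\<Sum>i\<le>1. W (n + i) x * (y - x) ^ i / fact i)) \<le> M * norm (y - x) ^ Suc 1 / fact 1"
    if "x \<in> {0..1}" "y \<in> {0..1}" for x y
    by (rule field_Taylor[of "{0..1}" 1 "\<lambda>i. W (n + i)"])
       (use that M derivs_onD[OF W] in \<open>auto simp: numeral_2_eq_2\<close>)
  then show ?thesis using that[OF M(1)] by (simp add: power2_eq_square algebra_simps)
qed

lemma derivs_on_taylor2:
  assumes W: "derivs_on {0..1} W"
  obtains M where "M > 0"
    "\<And>x y. x \<in> {0..1} \<Longrightarrow> y \<in> {0..1} \<Longrightarrow> \<bar>W 0 y - W 0 x - W 1 x * (y - x) - W 2 x * (y - x)\<^sup>2 / 2\<bar> \<le> M * \<bar>y - x\<bar> ^ 3"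
proof -
  obtain M where M: "M > 0" "\<And>x. x \<in> {0..1} \<Longrightarrow> \<bar>W 3 x\<bar> \<le> M" using derivs_on_bounded[OF W] by blast
  have "norm (W 0 y - (\<Sum>i\<le>2. W i x * (y - x) ^ i / fact i)) \<le> M * norm (y - x) ^ Suc 2 / fact 2"
    if "x \<in> {0..1}" "y \<in> {0..1}" for x y
    by (rule field_Taylor[of "{0..1}" 2 W])
       (use that M derivs_onD[OF W] in \<open>auto simp: eval_nat_numeral\<close>)
  moreover have "(\<Sum>i\<le>2. W i x * (y - x) ^ i / fact i) = W 0 x + (W 1 x * (y - x) + W 2 x * (y - x)\<^sup>2 / 2)" for x y
    by (simp add: numeral_2_eq_2)
  moreover have "M * norm (y - x) ^ Suc 2 / fact 2 = M / 2 * \<bar>y - x\<bar> ^ 3" for x y :: real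
    by (simp add: eval_nat_numeral)
  ultimately have "\<bar>W 0 y - W 0 x - W 1 x * (y - x) - W 2 x * (y - x)\<^sup>2 / 2\<bar> \<le> M / 2 * \<bar>y - x\<bar> ^ 3"
    if "x \<in> {0..1}" "y \<in> {0..1}" for x y
    using that by (simp only: diff_diff_eq real_norm_def add.assoc)
  then show ?thesis using that[of "M / 2"] M(1) by simp
qed

text \<open>
  The nodes are chosen so that the discrete boundary condition, too, is consistent to the order
  of the interior scheme: for Neumann conditions this needs the midpoints \<open>(j - 1/2) / N\<close>.
\<close>

lemma discrete_laplacian_consistent:
  assumes W: "derivs_on {0..1} W" and bv: "boundary_values bc W"
  obtains K where "K > 0" "\<And>N j. N \<ge> 2 \<Longrightarrow> j \<in> {1..N} \<Longrightarrow>
    \<bar>(real N)\<^sup>2 * (2 * W 0 (node bc N j) - extend_bc bc N (\<lambda>j. W 0 (node bc N j)) (j + 1)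
        - extend_bc bc N (\<lambda>j. W 0 (node bc N j)) (j - 1)) + W 2 (node bc N j)\<bar> \<le> K / real N"
proof -
  obtain M where M: "M > 0"
    "\<And>x y. x \<in> {0..1} \<Longrightarrow> y \<in> {0..1} \<Longrightarrow> \<bar>W 0 y - W 0 x - W 1 x * (y - x) - W 2 x * (y - x)\<^sup>2 / 2\<bar> \<le> M * \<bar>y - x\<bar> ^ 3"
    using derivs_on_taylor2[OF W] by blast
  obtain M1 where M1: "M1 > 0"
    "\<And>x y. x \<in> {0..1} \<Longrightarrow> y \<in> {0..1} \<Longrightarrow> \<bar>W 1 y - W 1 x - W 2 x * (y - x)\<bar> \<le> M1 * \<bar>y - x\<bar> ^ 2"
    using derivs_on_taylor1[OF W, of 1] unfolding Suc_1 by blast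
  obtain M2 where M2: "M2 > 0" "\<And>x. x \<in> {0..1} \<Longrightarrow> \<bar>W 2 x\<bar> \<le> M2" using derivs_on_bounded[OF W] by blast
  define K where "K = M + M1"
  have K: "K > 0" "M \<le> K" "M1 \<le> K" using M M1 by (auto simp: K_def)
  \<comment> \<open>One neighbour at a time, \<open>\<sigma>\<close> being the direction; adding
    both directions cancels the first-order terms.\<close>
  have half: "\<bar>n\<^sup>2 * (W 0 x - W 0 (x + \<sigma> * h)) + n\<^sup>2 * \<sigma> * h * W 1 x + n\<^sup>2 * h\<^sup>2 / 2 * W 2 x\<bar> \<le> K / n"
    if x: "x \<in> {0..1}" "x + \<sigma> * h \<in> {0..1}" and n: "n > 0" and h: "0 < h" "h \<le> 1 / n" and \<sigma>: "\<sigma> = 1 \<or> \<sigma> = -1" for x \<sigma> h n :: real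
  proof -
    have \<sigma>2: "\<sigma>\<^sup>2 = 1" "\<bar>\<sigma>\<bar> = 1" using \<sigma> by auto
    have T: "\<bar>W 0 (x + \<sigma> * h) - W 0 x - W 1 x * (\<sigma> * h) - W 2 x * (\<sigma> * h)\<^sup>2 / 2\<bar> \<le> M * \<bar>\<sigma> * h\<bar> ^ 3"
      using M(2)[OF x] by simp
    have "n\<^sup>2 * (W 0 x - W 0 (x + \<sigma> * h)) + n\<^sup>2 * \<sigma> * h * W 1 x + n\<^sup>2 * h\<^sup>2 / 2 * W 2 x
        = - (n\<^sup>2 * (W 0 (x + \<sigma> * h) - W 0 x - W 1 x * (\<sigma> * h) - W 2 x * (\<sigma> * h)\<^sup>2 / 2))"
      by (simp add: power_mult_distrib \<sigma>2 algebra_simps)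
    then have "\<bar>n\<^sup>2 * (W 0 x - W 0 (x + \<sigma> * h)) + n\<^sup>2 * \<sigma> * h * W 1 x + n\<^sup>2 * h\<^sup>2 / 2 * W 2 x\<bar>
        = n\<^sup>2 * \<bar>W 0 (x + \<sigma> * h) - W 0 x - W 1 x * (\<sigma> * h) - W 2 x * (\<sigma> * h)\<^sup>2 / 2\<bar>"
      by (simp only: abs_minus_cancel abs_mult abs_power2 power2_abs)
    also have "\<dots> \<le> n\<^sup>2 * (M * h ^ 3)"
      using T h by (intro mult_left_mono) (auto simp: abs_mult \<sigma>2)
    also have "\<dots> \<le> n\<^sup>2 * (K * (1 / n) ^ 3)"
      using h K n M by (intro mult_left_mono mult_mono power_mono) auto
    also have "\<dots> = K / n" using n by (simp add: power3_eq_cube power2_eq_square)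
    finally show ?thesis .
  qed
  \<comment> \<open>At a Neumann wall the ghost value equals the value at the node, so one
    difference is 0. Expanding \<open>W 1\<close> from the node to the wall, at distance
    \<open>1 / (2 * n)\<close>, shows that the Taylor terms agree with 0 up to
    \<open>O(1 / n)\<close>.\<close>
  have wall: "\<bar>n\<^sup>2 * \<sigma> * (1 / n) * W 1 x + 1 / 2 * W 2 x\<bar> \<le> K / n"
    if x: "x \<in> {0..1}" "x + \<sigma> / (2 * n) \<in> {0..1}" and 0: "W 1 (x + \<sigma> / (2 * n)) = 0" and n: "n > 0" and \<sigma>: "\<sigma> = 1 \<or> \<sigma> = -1" for x \<sigma> n :: real
  proof -
    have \<sigma>2: "\<sigma> * \<sigma> = 1" "\<bar>\<sigma>\<bar> = 1" using \<sigma> by auto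
    have T: "\<bar>- W 1 x - W 2 x * (\<sigma> / (2 * n))\<bar> \<le> M1 * \<bar>\<sigma> / (2 * n)\<bar> ^ 2"
      using M1(2)[OF x] 0 by simp
    have "n\<^sup>2 * \<sigma> * (1 / n) * W 1 x + 1 / 2 * W 2 x = - (n * \<sigma>) * (- W 1 x - W 2 x * (\<sigma> / (2 * n)))"
      using n \<sigma> by (auto simp: field_simps power2_eq_square)
    then have "\<bar>n\<^sup>2 * \<sigma> * (1 / n) * W 1 x + 1 / 2 * W 2 x\<bar> = n * \<bar>- W 1 x - W 2 x * (\<sigma> / (2 * n))\<bar>"
      using n \<sigma>2 by (simp add: abs_mult)
    also have "\<dots> \<le> n * (M1 * \<bar>\<sigma> / (2 * n)\<bar> ^ 2)" using T n by (intro mult_left_mono) auto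
    also have "\<dots> = M1 / n / 4" using n \<sigma>2 by (simp add: abs_mult power2_eq_square field_simps)
    also have "\<dots> \<le> K / n" using K n M1 by (simp add: field_simps)
    finally show ?thesis .
  qed
  show ?thesis
  proof (rule that[of "2 * K + 2 * M2"])
    show "2 * K + 2 * M2 > 0" using K M2 by simp
    fix N j :: nat assume N: "N \<ge> 2" and j: "j \<in> {1..N}"
    define n where "n = real N"
    have n: "n > 0" "n \<ge> 2" using N by (auto simp: n_def)
    define x where "x = node bc N j"
    have x: "x \<in> {0..1}" unfolding x_def using N j by (intro node_in_unit) auto
    \<comment> \<open>Dirichlet nodes have spacing \<open>1 / (N + 1)\<close> although the scheme
      carries \<open>N\<^sup>2\<close>; hence the correction \<open>scale\<close> below.\<close>
    define h where "h = (case bc of Dirichlet \<Rightarrow> 1 / (n + 1) | Neumann \<Rightarrow> 1 / n)"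
    have h: "0 < h" "h \<le> 1 / n" using n by (cases bc; simp add: h_def field_simps)+
    let ?e = "extend_bc bc N (\<lambda>j. W 0 (node bc N j))"
    have up: "\<bar>n\<^sup>2 * (W 0 x - ?e (j + 1)) + n\<^sup>2 * 1 * h * W 1 x + n\<^sup>2 * h\<^sup>2 / 2 * W 2 x\<bar> \<le> K / n"
    proof (cases bc)
      case Dirichlet
      have "x + 1 * h = real (j + 1) / real (N + 1)"
        unfolding x_def h_def node_def Dirichlet n_def by (simp add: field_simps)
      moreover have "?e (j + 1) = W 0 (real (j + 1) / real (N + 1))"
        using bv j Dirichlet by (auto simp: node_def)
      ultimately show ?thesis using half[of x 1 h n] x n h j by simp
    next
      case Neumann
      show ?thesis
      proof (cases "j = N")
        case True
        have "x + 1 / (2 * n) = 1" unfolding x_def node_def Neumann True n_def using N by (simp add: field_simps)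
        moreover have "?e (j + 1) = W 0 x" using Neumann True by (simp add: x_def)
        ultimately show ?thesis using wall[of x 1 n] x n bv Neumann by (simp add: h_def power2_eq_square)
      next
        case False
        then have "x + 1 * h = node bc N (j + 1)"
          unfolding x_def h_def node_def Neumann n_def using N by (simp add: field_simps)
        moreover have "?e (j + 1) = W 0 (node bc N (j + 1))" using Neumann False j by simp
        moreover have "node bc N (j + 1) \<in> {0..1}" using N j False by (intro node_in_unit) auto
        ultimately show ?thesis using half[of x 1 h n] x n h by simp
      qed
    qed
    have down: "\<bar>n\<^sup>2 * (W 0 x - ?e (j - 1)) + n\<^sup>2 * (-1) * h * W 1 x + n\<^sup>2 * h\<^sup>2 / 2 * W 2 x\<bar> \<le> K / n"
    proof (cases bc)
      case Dirichlet
      have "x + (-1) * h = real (j - 1) / real (N + 1)"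
        unfolding x_def h_def node_def Dirichlet n_def using j by (simp add: diff_divide_distrib of_nat_diff)
      moreover have "?e (j - 1) = W 0 (real (j - 1) / real (N + 1))"
        using bv j Dirichlet by (auto simp: node_def)
      moreover have "real (j - 1) / real (N + 1) \<in> {0..1}" using j by simp
      ultimately show ?thesis using half[of x "-1" h n] x n h by simp
    next
      case Neumann
      show ?thesis
      proof (cases "j = 1")
        case True
        have "x + (-1) / (2 * n) = 0" unfolding x_def node_def Neumann True n_def using N by (simp add: field_simps)
        moreover have "?e (j - 1) = W 0 x" using Neumann True by (simp add: x_def)
        ultimately show ?thesis using wall[of x "-1" n] x n bv Neumann by (simp add: h_def power2_eq_square)
      next
        case False
        then have "x + (-1) * h = node bc N (j - 1)"
          unfolding x_def h_def node_def Neumann n_def using N j by (simp add: field_simps)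
        moreover have "?e (j - 1) = W 0 (node bc N (j - 1))" using Neumann False j by auto
        moreover have "node bc N (j - 1) \<in> {0..1}" using N j False by (intro node_in_unit) auto
        ultimately show ?thesis using half[of x "-1" h n] x n h by simp
      qed
    qed
    have scale: "\<bar>(1 - n\<^sup>2 * h\<^sup>2) * W 2 x\<bar> \<le> 2 * M2 / n"
    proof -
      have "0 \<le> 1 - n * h" "1 - n * h \<le> 1 / n" "0 \<le> n * h" "n * h \<le> 1"
        using n by (cases bc; simp add: h_def field_simps)+
      then have "\<bar>(1 - n * h) * (1 + n * h)\<bar> \<le> 1 / n * 2"
        unfolding abs_mult using n by (intro mult_mono) auto
      moreover have "1 - n\<^sup>2 * h\<^sup>2 = (1 - n * h) * (1 + n * h)" by (simp add: power2_eq_square algebra_simps)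
      ultimately have "\<bar>1 - n\<^sup>2 * h\<^sup>2\<bar> * \<bar>W 2 x\<bar> \<le> (1 / n * 2) * M2"
        using M2(2)[OF x] n by (intro mult_mono) auto
      then show ?thesis by (simp add: abs_mult)
    qed
    have "n\<^sup>2 * (2 * W 0 x - ?e (j + 1) - ?e (j - 1)) + W 2 x =
        (n\<^sup>2 * (W 0 x - ?e (j + 1)) + n\<^sup>2 * 1 * h * W 1 x + n\<^sup>2 * h\<^sup>2 / 2 * W 2 x)
      + (n\<^sup>2 * (W 0 x - ?e (j - 1)) + n\<^sup>2 * (-1) * h * W 1 x + n\<^sup>2 * h\<^sup>2 / 2 * W 2 x)
      + (1 - n\<^sup>2 * h\<^sup>2) * W 2 x"
      by (simp add: algebra_simps)
    then have "\<bar>n\<^sup>2 * (2 * W 0 x - ?e (j + 1) - ?e (j - 1)) + W 2 x\<bar> \<le> K / n + K / n + 2 * M2 / n"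
      using up down scale by linarith
    also have "\<dots> = (2 * K + 2 * M2) / n" by (simp add: add_divide_distrib)
    finally show "\<bar>(real N)\<^sup>2 * (2 * W 0 (node bc N j) - ?e (j + 1) - ?e (j - 1)) + W 2 (node bc N j)\<bar> \<le> (2 * K + 2 * M2) / real N"
      by (simp add: x_def n_def)
  qed
qed

subsection \<open>The phase space Hamiltonian\<close>

text \<open>Closure properties of linear and quadratic forms deliver the coefficient matrix of the
  Hamiltonian for both boundary conditions at once, without writing its entries down.\<close>

definition is_linear_form :: "'i set \<Rightarrow> (('i \<Rightarrow> real) \<Rightarrow> real) \<Rightarrow> bool" where
  "is_linear_form I f \<longleftrightarrow> (\<exists>a. \<forall>x. f x = (\<Sum>i\<in>I. a i * x i))"

definition is_quadratic_form :: "'i set \<Rightarrow> (('i \<Rightarrow> real) \<Rightarrow> real) \<Rightarrow> bool" where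
  "is_quadratic_form I f \<longleftrightarrow> (\<exists>A. (\<forall>i j. A i j = A j i) \<and> f = quadratic_form A I)"

lemma is_linear_form_coordinate: "finite I \<Longrightarrow> i \<in> I \<Longrightarrow> is_linear_form I (\<lambda>x. x i)"
  unfolding is_linear_form_def
proof (intro exI[of _ "\<lambda>j. if j = i then 1 else 0"] allI)
  fix x :: "'a \<Rightarrow> real" assume "finite I" "i \<in> I"
  moreover have "(\<Sum>j\<in>I. (if j = i then 1 else 0) * x j) = (\<Sum>j\<in>I. if j = i then x i else 0)"
    by (intro sum.cong refl) auto
  ultimately show "x i = (\<Sum>j\<in>I. (if j = i then 1 else 0) * x j)" by simp
qed

lemma is_linear_form_0: "is_linear_form I (\<lambda>x. 0)"
  unfolding is_linear_form_def by (rule exI[of _ "\<lambda>j. 0"]) simp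

lemma is_linear_form_diff:
  assumes "is_linear_form I f" "is_linear_form I g"
  shows "is_linear_form I (\<lambda>x. f x - g x)"
proof -
  obtain a b where "\<And>x. f x = (\<Sum>i\<in>I. a i * x i)" "\<And>x. g x = (\<Sum>i\<in>I. b i * x i)"
    using assms unfolding is_linear_form_def by blast
  then show ?thesis unfolding is_linear_form_def
    by (intro exI[of _ "\<lambda>i. a i - b i"]) (simp add: left_diff_distrib sum_subtractf)
qed

lemma is_quadratic_form_square:
  assumes "is_linear_form I f"
  shows "is_quadratic_form I (\<lambda>x. (f x)\<^sup>2)"
proof -
  obtain a where "\<And>x. f x = (\<Sum>i\<in>I. a i * x i)"
    using assms unfolding is_linear_form_def by blast
  then have "(\<lambda>x. (f x)\<^sup>2) = quadratic_form (\<lambda>i j. a i * a j) I"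
    by (simp add: fun_eq_iff quadratic_form_def power2_eq_square sum_product mult_ac)
  then show ?thesis unfolding is_quadratic_form_def
    by (intro exI[of _ "\<lambda>i j. a i * a j"]) (simp add: mult.commute)
qed

lemma is_quadratic_form_add:
  assumes "is_quadratic_form I f" "is_quadratic_form I g"
  shows "is_quadratic_form I (\<lambda>x. f x + g x)"
proof -
  obtain A B where "\<forall>i j. A i j = A j i" "f = quadratic_form A I" "\<forall>i j. B i j = B j i" "g = quadratic_form B I"
    using assms unfolding is_quadratic_form_def by blast
  then show ?thesis unfolding is_quadratic_form_def
    by (intro exI[of _ "\<lambda>i j. A i j + B i j"]) (simp add: fun_eq_iff quadratic_form_def distrib_right sum.distrib)
qed

lemma is_quadratic_form_cmult:
  assumes "is_quadratic_form I f"
  shows "is_quadratic_form I (\<lambda>x. c * f x)"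
proof -
  obtain A where "\<forall>i j. A i j = A j i" "f = quadratic_form A I"
    using assms unfolding is_quadratic_form_def by blast
  then show ?thesis unfolding is_quadratic_form_def
    by (intro exI[of _ "\<lambda>i j. c * A i j"]) (simp add: fun_eq_iff quadratic_form_def sum_distrib_left mult_ac)
qed

lemma is_quadratic_form_sum:
  assumes "finite J" "\<And>j. j \<in> J \<Longrightarrow> is_quadratic_form I (f j)"
  shows "is_quadratic_form I (\<lambda>x. \<Sum>j\<in>J. f j x)"
  using assms
proof (induction J rule: finite_induct)
  case empty
  then show ?case unfolding is_quadratic_form_def
    by (intro exI[of _ "\<lambda>i j. 0"]) (simp add: fun_eq_iff quadratic_form_def)
next
  case (insert j J)
  then show ?case by (simp add: is_quadratic_form_add)
qed

lemma finite_phase_index [simp]: "finite (phase_index N)"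
  by (simp add: phase_index_def)

lemma card_phase_index: "card (phase_index N) = 2 * N"
  by (simp add: phase_index_def card_Plus)

lemma sum_phase_index: "(\<Sum>i\<in>phase_index N. f i) = (\<Sum>j=1..N. f (Inl j)) + (\<Sum>j=1..N. f (Inr j))"
  unfolding phase_index_def by (subst sum.Plus) auto

abbreviation harmonic :: "real \<Rightarrow> real \<Rightarrow> real" where
  "harmonic \<alpha> \<equiv> (\<lambda>u. 1/2 * \<alpha> * u\<^sup>2)"

lemma is_quadratic_form_phase_hamiltonian:
  assumes N: "N \<ge> 1"
  shows "is_quadratic_form (phase_index N) (phase_hamiltonian bc \<delta> (harmonic \<alpha>) N)"
proof -
  let ?I = "phase_index N"
  have coord: "is_linear_form ?I (\<lambda>x. x (Inl j))" "is_linear_form ?I (\<lambda>x. x (Inr j))" if "j \<in> {1..N}" for j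
    using that by (intro is_linear_form_coordinate; auto simp: phase_index_def)+
  have ext: "is_linear_form ?I (\<lambda>x. extend_bc bc N (\<lambda>j. x (Inr j)) j)" if "j \<le> N + 1" for j
    using that coord N by (cases bc; cases "j = 0"; cases "j = N + 1") (auto simp: is_linear_form_0)
  have "is_quadratic_form ?I (\<lambda>x. 1 / real N * (\<Sum>j=1..N. 1/2 * (x (Inl j))\<^sup>2 + 1/2 * \<alpha> * (x (Inr j))\<^sup>2) +
     real N * (\<Sum>j=0..N. 1/2 * \<delta>\<^sup>2 * (extend_bc bc N (\<lambda>j. x (Inr j)) (j + 1) - extend_bc bc N (\<lambda>j. x (Inr j)) j)\<^sup>2))"
    by (intro is_quadratic_form_add is_quadratic_form_cmult is_quadratic_form_sum is_quadratic_form_square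
        is_linear_form_diff coord ext) auto
  then show ?thesis by (simp only: phase_hamiltonian_def[abs_def] hamiltonian_def)
qed

text \<open>The gradient energy is only used as nonnegative, so the constant comes from the kinetic
  and on-site terms and decays like \<open>1 / N\<close>; the consistency error has to beat
  this.\<close>

lemma phase_hamiltonian_coercive:
  assumes "N \<ge> 1"
  shows "min 1 \<alpha> / (2 * real N) * (\<Sum>i\<in>phase_index N. (x i)\<^sup>2) \<le> phase_hamiltonian bc \<delta> (harmonic \<alpha>) N x"
proof -
  have "(\<Sum>j=1..N. 1/2 * (min 1 \<alpha> * (x (Inl j))\<^sup>2) + 1/2 * (min 1 \<alpha> * (x (Inr j))\<^sup>2)) =
      min 1 \<alpha> / 2 * (\<Sum>i\<in>phase_index N. (x i)\<^sup>2)"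
    by (simp only: sum_phase_index sum.distrib distrib_left sum_distrib_left) (simp add: mult_ac)
  then have "min 1 \<alpha> / (2 * real N) * (\<Sum>i\<in>phase_index N. (x i)\<^sup>2) =
      1 / real N * (\<Sum>j=1..N. 1/2 * (min 1 \<alpha> * (x (Inl j))\<^sup>2) + 1/2 * (min 1 \<alpha> * (x (Inr j))\<^sup>2))"
    by (simp only:) simp
  also have "\<dots> \<le> 1 / real N * (\<Sum>j=1..N. 1/2 * (x (Inl j))\<^sup>2 + 1/2 * \<alpha> * (x (Inr j))\<^sup>2)"
  proof (rule mult_left_mono[OF sum_mono[OF add_mono]])
    fix j
    show "1/2 * (min 1 \<alpha> * (x (Inl j))\<^sup>2) \<le> 1/2 * (x (Inl j))\<^sup>2"
      using mult_right_mono[of "min 1 \<alpha>" 1 "(x (Inl j))\<^sup>2"] by simp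
    show "1/2 * (min 1 \<alpha> * (x (Inr j))\<^sup>2) \<le> 1/2 * \<alpha> * (x (Inr j))\<^sup>2"
      using mult_right_mono[of "min 1 \<alpha>" \<alpha> "(x (Inr j))\<^sup>2"] by simp
  qed simp
  also have "\<dots> \<le> phase_hamiltonian bc \<delta> (harmonic \<alpha>) N x"
    unfolding phase_hamiltonian_def hamiltonian_def by (simp add: sum_nonneg)
  finally show ?thesis .
qed

text \<open>Summation by parts against the derivative of the extension in the \<open>k\<close>-th
  position. For Neumann conditions the links at the walls join equal values, which is why
  \<open>d\<close> may be taken to vanish there.\<close>

lemma sum_extend_bc_unit:
  assumes k: "k \<in> {1..N}" and d: "bc = Neumann \<Longrightarrow> d 0 = 0 \<and> d N = 0"
  defines "e \<equiv> extend_bc bc N (\<lambda>i. if i = k then 1 else 0)"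
  shows "(\<Sum>j=0..N. d j * (e (j + 1) - e j)) = d (k - 1) - d k"
proof -
  have "d j * e (j + 1) = (if j = k - 1 then d (k - 1) else 0)" if "j \<in> {0..N}" for j
    using that k d by (cases bc) (auto simp: e_def)
  then have "(\<Sum>j=0..N. d j * e (j + 1)) = (\<Sum>j=0..N. if j = k - 1 then d (k - 1) else 0)"
    by (rule sum.cong[OF refl])
  also have "\<dots> = d (k - 1)" using k by (subst sum.delta) auto
  finally have 1: "(\<Sum>j=0..N. d j * e (j + 1)) = d (k - 1)" .
  have "d j * e j = (if j = k then d k else 0)" if "j \<in> {0..N}" for j
    using that k d by (cases bc) (auto simp: e_def)
  then have "(\<Sum>j=0..N. d j * e j) = (\<Sum>j=0..N. if j = k then d k else 0)"
    by (rule sum.cong[OF refl])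
  also have "\<dots> = d k" using k by (subst sum.delta) auto
  finally have 2: "(\<Sum>j=0..N. d j * e j) = d k" .
  show ?thesis by (simp only: right_diff_distrib sum_subtractf 1 2)
qed

lemma partial_deriv_phase_hamiltonian_Inl:
  assumes k: "k \<in> {1..N}"
  shows "partial_deriv (Inl k) (phase_hamiltonian bc \<delta> V N) x = x (Inl k) / real N"
proof -
  let ?x = "\<lambda>t. x(Inl k := t)"
  have dp: "((\<lambda>t. ?x t (Inl j)) has_real_derivative (if j = k then 1 else 0)) (at t0)" for j t0
    by (cases "j = k") auto
  have "((\<lambda>t. phase_hamiltonian bc \<delta> V N (?x t)) has_real_derivative
     1 / real N * (\<Sum>j=1..N. 1/2 * (2 * (if j = k then 1 else 0) * ?x (x (Inl k)) (Inl j)) + 0) + 0) (at (x (Inl k)))"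
    unfolding phase_hamiltonian_def hamiltonian_def
    by (intro DERIV_add DERIV_cmult DERIV_sum DERIV_power[where n=2, simplified] dp) (auto intro!: derivative_eq_intros dp)
  also have "(\<Sum>j=1..N. 1/2 * (2 * (if j = k then 1 else 0) * ?x (x (Inl k)) (Inl j)) + 0) = (\<Sum>j=1..N. if j = k then x (Inl k) else 0)"
    by (intro sum.cong refl) auto
  also have "\<dots> = x (Inl k)" using k by simp
  finally have D: "((\<lambda>t. phase_hamiltonian bc \<delta> V N (?x t)) has_real_derivative 1 / real N * x (Inl k) + 0) (at (x (Inl k)))" .
  show ?thesis unfolding partial_deriv_def by (rule DERIV_imp_deriv, rule DERIV_cong, rule D) simp
qed

text \<open>The factor \<open>real N\<close> of the gradient energy is split into
  \<open>1 / N\<close> and \<open>N\<^sup>2\<close>, so that the difference quotient of the boundary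
  value problem appears.\<close>

lemma partial_deriv_phase_hamiltonian_Inr:
  fixes bc and x :: "nat + nat \<Rightarrow> real"
  assumes k: "k \<in> {1..N}"
  defines "e \<equiv> extend_bc bc N (\<lambda>j. x (Inr j))"
  shows "partial_deriv (Inr k) (phase_hamiltonian bc \<delta> (harmonic \<alpha>) N) x =
    1 / real N * (\<alpha> * x (Inr k) + \<delta>\<^sup>2 * ((real N)\<^sup>2 * (2 * x (Inr k) - e (k + 1) - e (k - 1))))"
proof -
  let ?x = "\<lambda>t. x(Inr k := t)"
  let ?e = "\<lambda>t. extend_bc bc N (\<lambda>j. ?x t (Inr j))"
  let ?u = "extend_bc bc N (\<lambda>i. if i = k then 1 else 0)"
  let ?t = "x (Inr k)"
  have du: "((\<lambda>t. ?x t (Inr j)) has_real_derivative (if j = k then 1 else 0)) (at t0)" for j t0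
    by (cases "j = k") auto
  \<comment> \<open>The extension is linear in the positions, so its derivative is the extension of
    a unit vector.\<close>
  have de: "((\<lambda>t. ?e t j) has_real_derivative ?u j) (at t0)" for j t0
    using du[of _ t0] by (cases bc) (cases "j = 0"; cases "j = N + 1"; simp)+
  have e: "?e ?t = e" by (simp add: e_def)
  have sq: "((\<lambda>t. (g t)\<^sup>2) has_real_derivative 2 * g t0 * g') (at t0)" if "(g has_real_derivative g') (at t0)" for g :: "real \<Rightarrow> real" and g' t0
    using DERIV_power[OF that, of 2] by (simp add: mult_ac)
  have "((\<lambda>t. phase_hamiltonian bc \<delta> (harmonic \<alpha>) N (?x t)) has_real_derivative
     1 / real N * (\<Sum>j=1..N. 0 + 1/2 * \<alpha> * (2 * ?x ?t (Inr j) * (if j = k then 1 else 0))) +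
     real N * (\<Sum>j=0..N. 1/2 * \<delta>\<^sup>2 * (2 * (?e ?t (j + 1) - ?e ?t j) * (?u (j + 1) - ?u j)))) (at ?t)"
    unfolding phase_hamiltonian_def hamiltonian_def
    by (intro DERIV_add DERIV_cmult DERIV_sum sq DERIV_diff de du) simp
  also have "(\<Sum>j=1..N. 0 + 1/2 * \<alpha> * (2 * ?x ?t (Inr j) * (if j = k then 1 else 0))) = (\<Sum>j=1..N. if j = k then \<alpha> * ?t else 0)"
    by (intro sum.cong refl) auto
  also have "\<dots> = \<alpha> * ?t" using k by simp
  also have "(\<Sum>j=0..N. 1/2 * \<delta>\<^sup>2 * (2 * (?e ?t (j + 1) - ?e ?t j) * (?u (j + 1) - ?u j))) =
      \<delta>\<^sup>2 * (\<Sum>j=0..N. (e (j + 1) - e j) * (?u (j + 1) - ?u j))"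
  proof -
    have "1/2 * \<delta>\<^sup>2 * (2 * a * b) = \<delta>\<^sup>2 * (a * b)" for a b :: real by simp
    then show ?thesis unfolding e by (simp only: sum_distrib_left)
  qed
  also have "(\<Sum>j=0..N. (e (j + 1) - e j) * (?u (j + 1) - ?u j)) = (e (k - 1 + 1) - e (k - 1)) - (e (k + 1) - e k)"
    by (rule sum_extend_bc_unit[OF k]) (use k in \<open>auto simp: e_def\<close>)
  also have "\<dots> = 2 * ?t - e (k + 1) - e (k - 1)"
    using k by (cases bc) (auto simp: e_def)
  finally have D: "((\<lambda>t. phase_hamiltonian bc \<delta> (harmonic \<alpha>) N (?x t)) has_real_derivative
     1 / real N * (\<alpha> * ?t) + real N * (\<delta>\<^sup>2 * (2 * ?t - e (k + 1) - e (k - 1)))) (at ?t)" .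
  have "real N > 0" using k by simp
  then show ?thesis unfolding partial_deriv_def
    by (intro DERIV_imp_deriv DERIV_cong[OF D]) (simp add: power2_eq_square field_simps)
qed

section \<open>Passage to the limit\<close>

text \<open>For fixed \<eta> the limit superior is at most a constant multiple of \<eta>, and \<eta>
  is arbitrary. The factor \<open>a\<close> varies with \<open>N\<close> because the microcanonical
  bound contains \<open>exp (\<beta> * h v)\<close>.\<close>

lemma tendsto_0_by_epsilon:
  fixes f :: "nat \<Rightarrow> 'a :: real_normed_vector"
  assumes bound: "\<And>\<eta>. \<eta> > 0 \<Longrightarrow> eventually (\<lambda>N. norm (f N) \<le> \<eta> * a N + b \<eta> N) sequentially"
    and a: "a \<longlonglongrightarrow> A" and b: "\<And>\<eta>. \<eta> > 0 \<Longrightarrow> b \<eta> \<longlonglongrightarrow> (0 :: real)"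
  shows "f \<longlonglongrightarrow> 0"
proof (rule tendstoI)
  fix \<epsilon> :: real assume \<epsilon>: "\<epsilon> > 0"
  define B where "B = \<bar>A\<bar> + 1"
  define \<eta> where "\<eta> = \<epsilon> / 2 / B"
  have B: "A < B" "B > 0" unfolding B_def by linarith+
  then have \<eta>: "\<eta> > 0" using \<epsilon> by (simp add: \<eta>_def)
  have "eventually (\<lambda>N. a N < B) sequentially"
    using a B(1) by (rule order_tendstoD)
  moreover have "eventually (\<lambda>N. b \<eta> N < \<epsilon> / 2) sequentially"
    using b[OF \<eta>] \<epsilon> by (intro order_tendstoD) auto
  ultimately show "eventually (\<lambda>N. dist (f N) 0 < \<epsilon>) sequentially"
    using bound[OF \<eta>]
  proof eventually_elim
    case (elim N)
    have "\<eta> * a N \<le> \<eta> * B" using elim \<eta> by (intro mult_left_mono) auto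
    also have "\<dots> = \<epsilon> / 2" using B by (simp add: \<eta>_def)
    finally show ?case using elim by simp
  qed
qed

definition test_vector :: "nat \<Rightarrow> (nat \<Rightarrow> real) \<Rightarrow> (nat \<Rightarrow> real) \<Rightarrow> nat + nat \<Rightarrow> real" where
  "test_vector N s t = case_sum (\<lambda>j. s j / real N) (\<lambda>j. t j / real N)"

lemma char_fun_eq:
  "char_fun \<mu> N s t = (\<integral>x. iexp (\<Sum>i\<in>phase_index N. test_vector N s t i * x i) \<partial>\<mu>)"
proof -
  have "\<i> / of_nat N * complex_of_real (\<Sum>j=1..N. s j * x (Inl j)) + \<i> / of_nat N * complex_of_real (\<Sum>j=1..N. t j * x (Inr j))
    = \<i> * complex_of_real (\<Sum>i\<in>phase_index N. test_vector N s t i * x i)" for x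
  proof -
    have "(\<Sum>i\<in>phase_index N. test_vector N s t i * x i) =
        (\<Sum>j=1..N. s j * x (Inl j)) / real N + (\<Sum>j=1..N. t j * x (Inr j)) / real N"
      by (simp add: sum_phase_index test_vector_def sum_divide_distrib)
    then show ?thesis by (simp only:) (simp add: distrib_left)
  qed
  then show ?thesis by (simp only: char_fun_def)
qed

text \<open>Interface to the quadratic forms: the matrix is chosen inside the proof, so everything
  is phrased by \<open>partial_deriv\<close>. The first claim is Euler's identity; it turns
  \<open>\<beta> * h v\<close> into an expression accessible to Riemann sums.\<close>

lemma phase_char_bounds:
  fixes \<alpha> \<beta> \<delta> :: real and bc v s t
  assumes N: "N \<ge> 2" and \<alpha>: "\<alpha> > 0" and \<beta>: "\<beta> > 0"
  defines "h \<equiv> phase_hamiltonian bc \<delta> (harmonic \<alpha>) N"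
  defines "R \<equiv> (\<Sum>i\<in>phase_index N. (test_vector N s t i - \<beta> * partial_deriv i h v)\<^sup>2) / (min 1 \<alpha> / (2 * real N))
    * (real N / \<beta> * (2 + energy_fluctuation N))"
  shows "\<beta> * h v = (\<Sum>i\<in>phase_index N. v i * (\<beta> * partial_deriv i h v)) / 2"
    and "\<eta> > 0 \<Longrightarrow> norm (char_fun (canonical_measure (phase_index N) h \<beta>) N s t - complex_of_real (exp (- (\<beta> * h v)))) \<le> \<eta> + R / \<eta>"
    and "\<eta> > 0 \<Longrightarrow> norm (char_fun (microcanonical_measure (phase_index N) h (real N / \<beta>)) N s t
        - char_fun (canonical_measure (phase_index N) h \<beta>) N s t)
      \<le> \<eta> * (8 * exp (\<beta> * h v) + 2 * R) + (1 / \<eta> + 8) * energy_fluctuation N"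
proof -
  obtain A where A: "\<And>i j. A i j = A j i" "h = quadratic_form A (phase_index N)"
    using is_quadratic_form_phase_hamiltonian[of N bc \<delta> \<alpha>] N unfolding is_quadratic_form_def h_def by auto
  interpret pos_quadratic_energy "phase_index N" A "min 1 \<alpha> / (2 * real N)" "real N / \<beta>" \<beta>
  proof
    show "min 1 \<alpha> / (2 * real N) * (\<Sum>i\<in>phase_index N. (x i)\<^sup>2) \<le> quadratic_form A (phase_index N) x" for x
      using phase_hamiltonian_coercive[of N \<alpha> x bc \<delta>] N unfolding A(2)[symmetric] h_def by simp
  qed (use A(1) N \<alpha> \<beta> in \<open>auto simp: card_phase_index\<close>)
  have grad: "partial_deriv i h v = grad i v" if "i \<in> phase_index N" for i
    using partial_deriv_H[OF that] A(2) by simp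
  have R: "R = residual_bound N (test_vector N s t) v"
    unfolding R_def residual_bound_def residual_sq_def by (simp add: grad cong: sum.cong)
  have "2 * h v = (\<Sum>i\<in>phase_index N. v i * grad i v)"
    unfolding A(2) by (rule grad_euler[symmetric])
  then show "\<beta> * h v = (\<Sum>i\<in>phase_index N. v i * (\<beta> * partial_deriv i h v)) / 2"
    by (simp add: grad mult.left_commute flip: sum_distrib_left cong: sum.cong)
  assume \<eta>: "\<eta> > 0"
  show "norm (char_fun (canonical_measure (phase_index N) h \<beta>) N s t - complex_of_real (exp (- (\<beta> * h v)))) \<le> \<eta> + R / \<eta>"
    unfolding char_fun_eq R A(2) by (rule canonical_char_approx[OF N card_phase_index refl \<eta>])
  show "norm (char_fun (microcanonical_measure (phase_index N) h (real N / \<beta>)) N s t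
        - char_fun (canonical_measure (phase_index N) h \<beta>) N s t)
      \<le> \<eta> * (8 * exp (\<beta> * h v) + 2 * R) + (1 / \<eta> + 8) * energy_fluctuation N"
    unfolding char_fun_eq R A(2) by (rule microcanonical_char_approx[OF N card_phase_index refl \<eta>])
qed

lemma smooth_on_derivs:
  assumes "smooth_on S f"
  obtains D where "derivs_on S D" "\<And>x. x \<in> S \<Longrightarrow> D 0 x = f x"
  using assms unfolding smooth_on_def derivs_on_def by blast

lemma derivs_on_leibniz: "derivs_on S F \<Longrightarrow> derivs_on S G \<Longrightarrow> derivs_on S (leibniz F G)"
  by (simp add: derivs_on_def leibniz_has_derivative)

lemma leibniz_0: "leibniz F G 0 = (\<lambda>x. F 0 x * G 0 x)"
  by (simp add: leibniz_def fun_eq_iff)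

lemma extend_bc_divide: "extend_bc bc N (\<lambda>j. u j / b) j = extend_bc bc N u j / b"
  by (cases bc) simp_all

theorem proposition1:
  fixes \<delta> \<beta> \<alpha> :: real and bc :: boundary and s t :: "real \<Rightarrow> real"
    and C :: "real \<Rightarrow> real \<Rightarrow> real"
  assumes "\<delta> > 0" and "\<beta> > 0" and "\<alpha> > 0"
    and "smooth_on {0..1} s" and "smooth_on {0..1} t"
    and "is_green_function bc \<delta> \<alpha> C"
  shows "let H = (\<lambda>N. phase_hamiltonian bc \<delta> (\<lambda>u. 1/2 * \<alpha> * u\<^sup>2) N);
             m = (\<lambda>N. microcanonical_measure (phase_index N) (H N) (real N / \<beta>));
             M = (\<lambda>N. canonical_measure (phase_index N) (H N) \<beta>);
             L = exp (- 1 / (2 * \<beta>) *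
                   (integral {0..1} (\<lambda>x. (s x)\<^sup>2) +
                    integral {0..1} (\<lambda>y. integral {0..1} (\<lambda>x. t x * C x y * t y))))
         in (\<lambda>N. char_fun (m N) N (\<lambda>j. s (grid N j)) (\<lambda>j. t (grid N j)))
              \<longlonglongrightarrow> complex_of_real L \<and>
            (\<lambda>N. char_fun (M N) N (\<lambda>j. s (grid N j)) (\<lambda>j. t (grid N j)))
              \<longlonglongrightarrow> complex_of_real L"
proof -
  obtain S where S: "derivs_on {0..1} S" "\<And>x. x \<in> {0..1} \<Longrightarrow> S 0 x = s x"
    using smooth_on_derivs[OF assms(4)] by blast
  obtain T where T: "derivs_on {0..1} T" "\<And>x. x \<in> {0..1} \<Longrightarrow> T 0 x = t x"
    using smooth_on_derivs[OF assms(5)] by blast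
  obtain W where W: "derivs_on {0..1} W" "\<And>x. - \<delta>\<^sup>2 * W 2 x + \<alpha> * W 0 x = T 0 x" "boundary_values bc W"
    using ex_ode_solution[OF assms(1,3) T(1)] by blast
  define h where "h = phase_hamiltonian bc \<delta> (harmonic \<alpha>)"
  define w where "w = (\<lambda>N j. W 0 (node bc N j))"
  define X where "X = (\<lambda>N j. (real N)\<^sup>2 * (2 * w N j - extend_bc bc N (w N) (j + 1) - extend_bc bc N (w N) (j - 1)))"
  define g where "g = (\<lambda>N j. \<alpha> * w N j + \<delta>\<^sup>2 * X N j)"
  \<comment> \<open>The vector whose dual functional approximates the test vector. Momenta decouple,
    so the fit is exact there; positions take the continuum solution at the nodes.\<close>
  define v where "v = (\<lambda>N. case_sum (\<lambda>j. s (grid N j) / \<beta>) (\<lambda>j. w N j / \<beta>))"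
  define R where "R = (\<lambda>N. (\<Sum>i\<in>phase_index N. (test_vector N (\<lambda>j. s (grid N j)) (\<lambda>j. t (grid N j)) i -
      \<beta> * partial_deriv i (h N) (v N))\<^sup>2) / (min 1 \<alpha> / (2 * real N)) * (real N / \<beta> * (2 + energy_fluctuation N)))"
  define c where "c = (\<lambda>N. \<beta> * h N (v N))"
  define \<phi>M where "\<phi>M = (\<lambda>N. char_fun (canonical_measure (phase_index N) (h N) \<beta>) N (\<lambda>j. s (grid N j)) (\<lambda>j. t (grid N j)))"
  define \<phi>m where "\<phi>m = (\<lambda>N. char_fun (microcanonical_measure (phase_index N) (h N) (real N / \<beta>)) N (\<lambda>j. s (grid N j)) (\<lambda>j. t (grid N j)))"

  have grid: "grid N j \<in> {0..1}" if "j \<in> {1..N}" for N j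
    using that by (simp add: grid_def)
  have pd_l: "\<beta> * partial_deriv (Inl j) (h N) (v N) = s (grid N j) / real N" if "j \<in> {1..N}" for N j
    unfolding h_def partial_deriv_phase_hamiltonian_Inl[OF that] using assms(2) by (simp add: v_def)
  have pd_r: "\<beta> * partial_deriv (Inr j) (h N) (v N) = g N j / real N" if "j \<in> {1..N}" for N j
  proof -
    have "extend_bc bc N (\<lambda>j. v N (Inr j)) i = extend_bc bc N (w N) i / \<beta>" for i
      by (simp add: v_def extend_bc_divide)
    moreover have "v N (Inr j) = w N j / \<beta>" by (simp add: v_def)
    ultimately have "partial_deriv (Inr j) (h N) (v N) = 1 / real N * (\<alpha> * (w N j / \<beta>) +
        \<delta>\<^sup>2 * ((real N)\<^sup>2 * (2 * (w N j / \<beta>) - extend_bc bc N (w N) (j + 1) / \<beta> - extend_bc bc N (w N) (j - 1) / \<beta>)))"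
      unfolding h_def partial_deriv_phase_hamiltonian_Inr[OF that] by (simp only:)
    also have "\<dots> = g N j / real N / \<beta>"
    proof -
      have "2 * (x / \<beta>) - a / \<beta> - b / \<beta> = (2 * x - a - b) / \<beta>" for x a b
        by (simp add: diff_divide_distrib)
      then show ?thesis by (simp only: g_def X_def) (simp add: add_divide_distrib mult_ac)
    qed
    finally show ?thesis using assms(2) by simp
  qed

  \<comment> \<open>Two errors of order \<open>1 / N\<close> meet: consistency of the scheme at the
    node, and \<open>t\<close> evaluated at the grid point instead of the node.\<close>
  obtain K where K: "K > 0" "\<And>N j. N \<ge> 2 \<Longrightarrow> j \<in> {1..N} \<Longrightarrow> \<bar>g N j - T 0 (grid N j)\<bar> \<le> K / real N"
  proof -
    obtain K1 where K1: "K1 > 0" "\<And>N j. N \<ge> 2 \<Longrightarrow> j \<in> {1..N} \<Longrightarrow> \<bar>X N j + W 2 (node bc N j)\<bar> \<le> K1 / real N"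
      using discrete_laplacian_consistent[OF W(1,3)] unfolding X_def w_def by blast
    obtain M where M: "M > 0" "\<And>x y. x \<in> {0..1} \<Longrightarrow> y \<in> {0..1} \<Longrightarrow> \<bar>T 0 x - T 0 y\<bar> \<le> M * \<bar>x - y\<bar>"
      using derivs_on_lipschitz[OF T(1)] by blast
    show ?thesis
    proof (rule that[of "\<delta>\<^sup>2 * K1 + M"])
      show "\<delta>\<^sup>2 * K1 + M > 0" using K1 M by (simp add: add_nonneg_pos)
      fix N j :: nat assume N: "N \<ge> 2" and j: "j \<in> {1..N}"
      have node: "node bc N j \<in> {0..1}" using N j by (intro node_in_unit) auto
      have "g N j - T 0 (grid N j) = \<delta>\<^sup>2 * (X N j + W 2 (node bc N j)) + (T 0 (node bc N j) - T 0 (grid N j))"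
        using W(2)[of "node bc N j"] by (simp add: g_def w_def algebra_simps)
      also have "\<bar>\<dots>\<bar> \<le> \<bar>\<delta>\<^sup>2 * (X N j + W 2 (node bc N j))\<bar> + \<bar>T 0 (node bc N j) - T 0 (grid N j)\<bar>"
        by (rule abs_triangle_ineq)
      also have "\<bar>\<delta>\<^sup>2 * (X N j + W 2 (node bc N j))\<bar> \<le> \<delta>\<^sup>2 * (K1 / real N)"
        unfolding abs_mult abs_power2 by (rule mult_left_mono[OF K1(2)[OF N j]]) simp
      also have "\<bar>T 0 (node bc N j) - T 0 (grid N j)\<bar> \<le> M * (1 / real N)"
        using order_trans[OF M(2)[OF node grid[OF j]] mult_left_mono[OF node_near_grid[of N j bc]]] N j M(1) by simp
      finally show "\<bar>g N j - T 0 (grid N j)\<bar> \<le> (\<delta>\<^sup>2 * K1 + M) / real N" by (simp add: add_divide_distrib)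
    qed
  qed

  have R0: "R \<longlonglongrightarrow> 0"
  proof (rule Lim_null_comparison)
    \<comment> \<open>\<open>N\<close> squares of size \<open>(K / N\<^sup>2)\<^sup>2\<close> sum to
      \<open>K\<^sup>2 / N\<^sup>3\<close>; dividing by the coercivity constant and multiplying by
      the shell energy costs \<open>2 * N\<^sup>2 / (min 1 \<alpha> * \<beta>)\<close>.\<close>
    let ?b = "\<lambda>N. K\<^sup>2 * 2 / (min 1 \<alpha> * \<beta>) * (2 + energy_fluctuation N) * (1 / real N)"
    show "eventually (\<lambda>N. norm (R N) \<le> ?b N) sequentially"
      using eventually_ge_at_top[of "2 :: nat"]
    proof eventually_elim
      case (elim N)
      have N: "real N > 0" using elim by simp
      let ?sq = "\<Sum>i\<in>phase_index N. (test_vector N (\<lambda>j. s (grid N j)) (\<lambda>j. t (grid N j)) i - \<beta> * partial_deriv i (h N) (v N))\<^sup>2"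
      have "?sq = (\<Sum>j=1..N. (t (grid N j) / real N - g N j / real N)\<^sup>2)"
      proof -
        have "(\<Sum>j=1..N. (test_vector N (\<lambda>j. s (grid N j)) (\<lambda>j. t (grid N j)) (Inl j) - \<beta> * partial_deriv (Inl j) (h N) (v N))\<^sup>2) = 0"
          by (intro sum.neutral ballI) (simp only: pd_l, simp add: test_vector_def)
        moreover have "(\<Sum>j=1..N. (test_vector N (\<lambda>j. s (grid N j)) (\<lambda>j. t (grid N j)) (Inr j) - \<beta> * partial_deriv (Inr j) (h N) (v N))\<^sup>2) =
            (\<Sum>j=1..N. (t (grid N j) / real N - g N j / real N)\<^sup>2)"
          by (intro sum.cong refl) (simp only: pd_r, simp add: test_vector_def)
        ultimately show ?thesis by (simp only: sum_phase_index add_0_left)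
      qed
      also have "\<dots> \<le> (\<Sum>j=1..N. (K / real N / real N)\<^sup>2)"
      proof (rule sum_mono)
        fix j assume j: "j \<in> {1..N}"
        have "\<bar>t (grid N j) / real N - g N j / real N\<bar> = \<bar>g N j - T 0 (grid N j)\<bar> / real N"
          using N T(2)[OF grid[OF j]] by (simp add: abs_minus_commute flip: diff_divide_distrib)
        also have "\<dots> \<le> K / real N / real N" using K(2)[OF elim j] N by (intro divide_right_mono) auto
        finally have "\<bar>t (grid N j) / real N - g N j / real N\<bar>\<^sup>2 \<le> (K / real N / real N)\<^sup>2"
          by (intro power_mono) auto
        then show "(t (grid N j) / real N - g N j / real N)\<^sup>2 \<le> (K / real N / real N)\<^sup>2" by simp
      qed
      also have "\<dots> = K\<^sup>2 / real N ^ 3"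
        using N by (simp add: power_divide power3_eq_cube power2_eq_square)
      finally have sq: "?sq \<le> K\<^sup>2 / real N ^ 3" .
      have "?sq \<ge> 0" by (rule sum_nonneg) simp
      moreover have q: "energy_fluctuation N \<ge> 0" by (rule energy_fluctuation_nonneg[OF elim])
      ultimately have "R N \<ge> 0" unfolding R_def using assms by simp
      moreover have "R N \<le> K\<^sup>2 / real N ^ 3 / (min 1 \<alpha> / (2 * real N)) * (real N / \<beta> * (2 + energy_fluctuation N))"
        unfolding R_def using sq q assms by (intro mult_right_mono divide_right_mono) auto
      moreover have "K\<^sup>2 / real N ^ 3 / (min 1 \<alpha> / (2 * real N)) * (real N / \<beta> * (2 + energy_fluctuation N)) = ?b N"
      proof -
        have "min 1 \<alpha> > 0" using assms by simp
        moreover have "k / n ^ 3 / (a / (2 * n)) * (n / b * q) = k * 2 / (a * b) * q * (1 / n)"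
          if "n > 0" "a > 0" "b > 0" for k n a b q :: real
          using that by (simp add: power3_eq_cube field_simps)
        ultimately show ?thesis using N assms(2) by blast
      qed
      ultimately show ?case by simp
    qed
    have "(\<lambda>N. 1 / real N) \<longlonglongrightarrow> 0" by real_asymp
    then have "?b \<longlonglongrightarrow> K\<^sup>2 * 2 / (min 1 \<alpha> * \<beta>) * (2 + 0) * 0"
      by (intro tendsto_mult tendsto_add tendsto_const energy_fluctuation_tendsto_0)
    then show "?b \<longlonglongrightarrow> 0" by (simp only: mult_zero_right)
  qed

  \<comment> \<open>Both factors are first replaced by grid values, \<open>g\<close> through the
    bound \<open>K\<close> and \<open>w\<close> through a Lipschitz constant, so that a Riemann sum
    remains.\<close>
  have WT: "(\<lambda>N. 1 / real N * (\<Sum>j=1..N. w N j * g N j)) \<longlonglongrightarrow> integral {0..1} (\<lambda>x. T 0 x * W 0 x)"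
  proof -
    have lim: "(\<lambda>N. 1 / real N * (\<Sum>j=1..N. T 0 (grid N j) * W 0 (grid N j))) \<longlonglongrightarrow> integral {0..1} (\<lambda>x. T 0 x * W 0 x)"
      using riemann_sum_grid[OF derivs_on_leibniz[OF T(1) W(1)]] by (simp only: leibniz_0)
    obtain Mw where Mw: "Mw > 0" "\<And>x. x \<in> {0..1} \<Longrightarrow> \<bar>W 0 x\<bar> \<le> Mw" using derivs_on_bounded[OF W(1)] by blast
    obtain Mt where Mt: "Mt > 0" "\<And>x. x \<in> {0..1} \<Longrightarrow> \<bar>T 0 x\<bar> \<le> Mt" using derivs_on_bounded[OF T(1)] by blast
    obtain Lw where Lw: "Lw > 0" "\<And>x y. x \<in> {0..1} \<Longrightarrow> y \<in> {0..1} \<Longrightarrow> \<bar>W 0 x - W 0 y\<bar> \<le> Lw * \<bar>x - y\<bar>"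
      using derivs_on_lipschitz[OF W(1)] by blast
    define B where "B = Mw * K + Mt * Lw"
    have "(\<lambda>N. 1 / real N * (\<Sum>j=1..N. w N j * g N j) - 1 / real N * (\<Sum>j=1..N. T 0 (grid N j) * W 0 (grid N j))) \<longlonglongrightarrow> 0"
    proof (rule Lim_null_comparison)
      show "eventually (\<lambda>N. norm (1 / real N * (\<Sum>j=1..N. w N j * g N j) - 1 / real N * (\<Sum>j=1..N. T 0 (grid N j) * W 0 (grid N j))) \<le> B * (1 / real N)) sequentially"
        using eventually_ge_at_top[of "2 :: nat"]
      proof eventually_elim
        case (elim N)
        have N: "real N > 0" using elim by simp
        have summand: "\<bar>w N j * g N j - T 0 (grid N j) * W 0 (grid N j)\<bar> \<le> B / real N" if j: "j \<in> {1..N}" for j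
        proof -
          have node: "node bc N j \<in> {0..1}" using elim j by (intro node_in_unit) auto
          have "w N j * g N j - T 0 (grid N j) * W 0 (grid N j) =
              w N j * (g N j - T 0 (grid N j)) + T 0 (grid N j) * (w N j - W 0 (grid N j))"
            by (simp add: algebra_simps)
          also have "\<bar>\<dots>\<bar> \<le> \<bar>w N j\<bar> * \<bar>g N j - T 0 (grid N j)\<bar> + \<bar>T 0 (grid N j)\<bar> * \<bar>w N j - W 0 (grid N j)\<bar>"
            unfolding abs_mult[symmetric] by (rule abs_triangle_ineq)
          also have "\<dots> \<le> Mw * (K / real N) + Mt * (Lw * (1 / real N))"
          proof (intro add_mono mult_mono)
            show "\<bar>w N j\<bar> \<le> Mw" unfolding w_def by (rule Mw(2)[OF node])
            show "\<bar>T 0 (grid N j)\<bar> \<le> Mt" by (rule Mt(2)[OF grid[OF j]])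
            show "\<bar>w N j - W 0 (grid N j)\<bar> \<le> Lw * (1 / real N)"
              unfolding w_def
              using order_trans[OF Lw(2)[OF node grid[OF j]] mult_left_mono[OF node_near_grid[of N j bc]]] elim j Lw(1) by simp
          qed (use K elim j Mw Mt in auto)
          also have "\<dots> = B / real N" by (simp add: B_def add_divide_distrib)
          finally show ?thesis .
        qed
        have "\<bar>1 / real N * (\<Sum>j=1..N. w N j * g N j) - 1 / real N * (\<Sum>j=1..N. T 0 (grid N j) * W 0 (grid N j))\<bar> =
            1 / real N * \<bar>\<Sum>j=1..N. w N j * g N j - T 0 (grid N j) * W 0 (grid N j)\<bar>"
          using N by (simp add: sum_subtractf abs_divide flip: diff_divide_distrib)
        also have "\<dots> \<le> 1 / real N * (\<Sum>j=1..N. \<bar>w N j * g N j - T 0 (grid N j) * W 0 (grid N j)\<bar>)"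
          by (intro mult_left_mono sum_abs) simp
        also have "\<dots> \<le> 1 / real N * (\<Sum>j=1..N. B / real N)"
          by (intro mult_left_mono sum_mono summand) auto
        also have "\<dots> = B * (1 / real N)" using N by simp
        finally show ?case by simp
      qed
      have "(\<lambda>N. 1 / real N) \<longlonglongrightarrow> 0" by real_asymp
      from tendsto_mult_right_zero[OF this] show "(\<lambda>N. B * (1 / real N)) \<longlonglongrightarrow> 0" .
    qed
    from tendsto_add[OF this lim] show ?thesis by simp
  qed

  define c0 where "c0 = 1 / (2 * \<beta>) * (integral {0..1} (\<lambda>x. S 0 x * S 0 x) + integral {0..1} (\<lambda>x. T 0 x * W 0 x))"
  have c_lim: "c \<longlonglongrightarrow> c0"
  proof -
    have "(\<lambda>N. 1 / real N * (\<Sum>j=1..N. S 0 (grid N j) * S 0 (grid N j))) \<longlonglongrightarrow> integral {0..1} (\<lambda>x. S 0 x * S 0 x)"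
      using riemann_sum_grid[OF derivs_on_leibniz[OF S(1) S(1)]] by (simp only: leibniz_0)
    then have lim: "(\<lambda>N. 1 / (2 * \<beta>) * (1 / real N * (\<Sum>j=1..N. S 0 (grid N j) * S 0 (grid N j)) + 1 / real N * (\<Sum>j=1..N. w N j * g N j))) \<longlonglongrightarrow> c0"
      unfolding c0_def by (intro tendsto_mult_left tendsto_add WT)
    show ?thesis
    proof (rule Lim_transform_eventually[OF lim])
      show "eventually (\<lambda>N. 1 / (2 * \<beta>) * (1 / real N * (\<Sum>j=1..N. S 0 (grid N j) * S 0 (grid N j)) + 1 / real N * (\<Sum>j=1..N. w N j * g N j)) = c N) sequentially"
        using eventually_ge_at_top[of "2 :: nat"]
      proof eventually_elim
        case (elim N)
        have "c N = (\<Sum>i\<in>phase_index N. v N i * (\<beta> * partial_deriv i (h N) (v N))) / 2"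
          unfolding c_def h_def by (rule phase_char_bounds(1)[OF elim assms(3,2)])
        also have "(\<Sum>i\<in>phase_index N. v N i * (\<beta> * partial_deriv i (h N) (v N))) =
            (\<Sum>j=1..N. s (grid N j) / \<beta> * (s (grid N j) / real N)) + (\<Sum>j=1..N. w N j / \<beta> * (g N j / real N))"
          unfolding sum_phase_index
          by (intro arg_cong2[where f="(+)"] sum.cong refl) (simp_all only: pd_l pd_r, simp_all add: v_def)
        also have "(\<Sum>j=1..N. s (grid N j) / \<beta> * (s (grid N j) / real N)) = (\<Sum>j=1..N. S 0 (grid N j) * S 0 (grid N j)) / (\<beta> * real N)"
          unfolding sum_divide_distrib by (intro sum.cong refl) (simp add: S(2)[OF grid])
        also have "(\<Sum>j=1..N. w N j / \<beta> * (g N j / real N)) = (\<Sum>j=1..N. w N j * g N j) / (\<beta> * real N)"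
          unfolding sum_divide_distrib by (intro sum.cong refl) simp
        finally show ?case by (simp add: add_divide_distrib distrib_left mult_ac)
      qed
    qed
  qed
  have exp_lim: "(\<lambda>N. complex_of_real (exp (- c N))) \<longlonglongrightarrow> complex_of_real (exp (- c0))"
    by (intro tendsto_of_real tendsto_exp tendsto_minus c_lim)

  have M_diff: "(\<lambda>N. \<phi>M N - complex_of_real (exp (- c N))) \<longlonglongrightarrow> 0"
  proof (rule tendsto_0_by_epsilon)
    fix \<eta> :: real assume \<eta>: "\<eta> > 0"
    show "eventually (\<lambda>N. norm (\<phi>M N - complex_of_real (exp (- c N))) \<le> \<eta> * 1 + R N / \<eta>) sequentially"
      using eventually_ge_at_top[of "2 :: nat"]
    proof eventually_elim
      case (elim N)
      show ?case
        using phase_char_bounds(2)[OF elim assms(3,2) \<eta>, of bc \<delta> "\<lambda>j. s (grid N j)" "\<lambda>j. t (grid N j)" "v N"]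
        unfolding \<phi>M_def c_def R_def h_def by simp
    qed
    show "(\<lambda>N. R N / \<eta>) \<longlonglongrightarrow> 0" using tendsto_divide[OF R0 tendsto_const[of \<eta>]] \<eta> by simp
  qed (rule tendsto_const)
  have m_diff: "(\<lambda>N. \<phi>m N - \<phi>M N) \<longlonglongrightarrow> 0"
  proof (rule tendsto_0_by_epsilon)
    fix \<eta> :: real assume \<eta>: "\<eta> > 0"
    show "eventually (\<lambda>N. norm (\<phi>m N - \<phi>M N) \<le> \<eta> * (8 * exp (c N) + 2 * R N) + (1 / \<eta> + 8) * energy_fluctuation N) sequentially"
      using eventually_ge_at_top[of "2 :: nat"]
    proof eventually_elim
      case (elim N)
      show ?case
        using phase_char_bounds(3)[OF elim assms(3,2) \<eta>, of bc \<delta> "\<lambda>j. s (grid N j)" "\<lambda>j. t (grid N j)" "v N"]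
        unfolding \<phi>M_def \<phi>m_def c_def R_def h_def .
    qed
    show "(\<lambda>N. (1 / \<eta> + 8) * energy_fluctuation N) \<longlonglongrightarrow> 0"
      by (rule tendsto_mult_right_zero[OF energy_fluctuation_tendsto_0])
  next
    show "(\<lambda>N. 8 * exp (c N) + 2 * R N) \<longlonglongrightarrow> 8 * exp c0 + 2 * 0"
      by (intro tendsto_intros c_lim R0)
  qed
  have M_lim: "\<phi>M \<longlonglongrightarrow> complex_of_real (exp (- c0))"
    using tendsto_add[OF M_diff exp_lim] by simp
  have m_lim: "\<phi>m \<longlonglongrightarrow> complex_of_real (exp (- c0))"
    using tendsto_add[OF m_diff M_lim] by simp

  \<comment> \<open>The Green function is constrained only for sources inside the interval; the two
    end points are left out here and absorbed as a null set below.\<close>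
  have inner: "integral {0..1} (\<lambda>x. t x * C x y * t y) = T 0 y * W 0 y" if y: "y \<in> {0..1} - {0, 1}" for y
  proof -
    \<comment> \<open>Writing \<open>t\<close> as \<open>- \<delta>\<^sup>2 W'' + \<alpha> W\<close>
      brings the integral into the form of the weak equation for \<open>C\<close>.\<close>
    have "integral {0..1} (\<lambda>x. t x * C x y * t y) = integral {0..1} (\<lambda>x. C x y * (- \<delta>\<^sup>2 * W 2 x + \<alpha> * W 0 x) * t y)"
      by (intro integral_cong) (simp only: W(2), simp add: T(2))
    also have "\<dots> = W 0 y * t y"
      using green_function_integral[OF assms(6) _ _ W(1,3), of y] y by simp
    finally show ?thesis using y T(2)[of y] by simp
  qed
  have "integral {0..1} (\<lambda>y. integral {0..1} (\<lambda>x. t x * C x y * t y)) = integral {0..1} (\<lambda>y. T 0 y * W 0 y)"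
    by (rule integral_spike[of "{0, 1}"]) (use inner in auto)
  moreover have "integral {0..1} (\<lambda>x. (s x)\<^sup>2) = integral {0..1} (\<lambda>x. S 0 x * S 0 x)"
    by (intro integral_cong) (simp add: S(2) power2_eq_square)
  ultimately have L: "exp (- 1 / (2 * \<beta>) * (integral {0..1} (\<lambda>x. (s x)\<^sup>2) +
      integral {0..1} (\<lambda>y. integral {0..1} (\<lambda>x. t x * C x y * t y)))) = exp (- c0)"
    by (simp add: c0_def)
  show ?thesis
    unfolding Let_def L using m_lim M_lim unfolding \<phi>m_def \<phi>M_def h_def by blast
qed

end
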